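(* For each $\ell \geqslant 2$, there exists a constant $C = C(\ell)$ such that the following holds for all sufficiently large $n, k \in \mathbb{N}$ with $k \leqslant n^{(\ell-1)^2/\ell(2\ell-1)}/(\log n)^{2\ell-2}$. Let $\mathcal{I}$ be the collection of $C_{2\ell}$-free graphs on vertex set $[n]$ and let $\mathcal{G}$ be the collection of all graphs on vertex set $[n]$ with at most $k n^{1+1/\ell}$ edges. There exist a collection $\mathcal{S}$ of coloured graphs on vertex set $[n]$, each with at most $C k^{-1/(\ell-1)} n^{1+1/\ell}$ edges, and functions $g \colon \mathcal{I} \to \mathcal{S}$ and $h \colon \mathcal{S} \to \mathcal{G}$ such that: (a) for every $s \geqslant 0$, the number of coloured graphs in $\mathcal{S}$ with $s$ edges is at most $\big( \frac{C n^{1+1/\ell}}{s} \big)^{\ell s} \cdot \exp\big( C k^{-1/(\ell-1)} n^{1+1/\ell} \big)$; (b) $g(I) \subset I \subset g(I) \cup h(g(I))$ for every $I \in \mathcal{I}$, where $g(I)$ is identified with its underlying graph.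
   Context: A coloured graph is a graph together with an arbitrary labelled partition of its edge set (i.e., an ordered sequence of edge-disjoint edge sets whose union is the edge set). Containments between graphs on $[n]$ refer to edge sets. $C_{2\ell}$ is the cycle of length $2\ell$. *)

theory Defs
  imports Complex_Main "HOL-Library.Ramsey" "HOL-Library.Disjoint_Sets"
begin

text \<open>
  A simple graph on a fixed vertex set \<open>V\<close> is identified with its edge set, a set of two-element
  subsets of \<open>V\<close>; containments and unions of graphs are those of edge sets.
\<close>

definition graphs_on :: "'a set \<Rightarrow> 'a set set set" where
  "graphs_on V = Pow (nsets V 2)"

text \<open>The cycle of length \<open>m\<close> (meaningful for \<open>m \<ge> 3\<close>), on the vertices \<open>0, \<dots>, m - 1\<close>.\<close>

definition cycle_graph :: "nat \<Rightarrow> nat set set" where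
  "cycle_graph m = {{i, (i + 1) mod m} | i. i < m}"

text \<open>
  \<open>E\<close> contains a (not necessarily induced) copy of \<open>H\<close>.  Taking \<open>\<Union>H\<close> as the vertex set of \<open>H\<close> is
  harmless for graphs without isolated vertices, such as cycles.
\<close>

definition contains_copy :: "'a set set \<Rightarrow> 'b set set \<Rightarrow> bool" where
  "contains_copy E H \<longleftrightarrow> (\<exists>f. inj_on f (\<Union>H) \<and> (\<forall>e\<in>H. f ` e \<in> E))"

definition free_graphs_on :: "'a set \<Rightarrow> 'b set set \<Rightarrow> 'a set set set" where
  "free_graphs_on V H = {E \<in> graphs_on V. \<not> contains_copy E H}"

text \<open>
  A coloured graph is the finite sequence of its colour classes, whose union is the underlying
  edge set.  The sequence may have any length, its order matters, and classes may be empty.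
\<close>

type_synonym 'a coloured_graph = "'a set set list"

definition underlying :: "'a coloured_graph \<Rightarrow> 'a set set" where
  "underlying c = \<Union>(set c)"

definition coloured_graphs_on :: "'a set \<Rightarrow> 'a coloured_graph set" where
  "coloured_graphs_on V =
     {c. underlying c \<in> graphs_on V \<and> disjoint_family_on (\<lambda>i. c ! i) {..<length c}}"

end

theory Submission
  imports Defs "HOL-Analysis.Analysis"
begin

text \<open>
  Write \<open>\<alpha> = 1 + 1/l\<close> and \<open>M = n\<^sup>\<alpha>\<close>.  In an almost regular bipartite graph, closed walks of length
  \<open>2l\<close> that repeat a vertex are a small proportion of all closed walks: closed walk counts are
  log-convex in the length, so the degenerate ones are controlled by the maximum degrees and the
  number of closed walks of length \<open>2l - 2\<close>.  Passing to a subgraph maximising \<open>e(X, Y) / (|X| |Y|)\<close>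
  with the denominator raised to the power \<open>1/l\<close> gives the almost regularity without loss, so a graph
  with at least \<open>A m\<^sup>\<alpha>\<close> edges on \<open>m\<close> vertices has of order \<open>m\<^sup>2\<close> cycles of length \<open>2l\<close>.

  Applied to random vertex subsets of density \<open>p\<close>, of order \<open>k\<close> to the power \<open>-l/(l - 1)\<close>, from which
  the sets of edges already contained in too many chosen cycles have been destroyed, this turns into a
  balanced family of \<open>2l\<close>-cycles in every graph with \<open>k M\<close> edges: a maximal family subject to the
  degree bounds must be large.  A container lemma, whose fingerprints are chosen to maximise the total
  weight of a degree-bounded family of links minus a multiple of their size, then shrinks the edge
  set by a constant factor at the price of a fingerprint of \<open>O(\<delta> M)\<close> edges,
  where \<open>\<delta>\<close> is \<open>k\<close> to the power \<open>-1/(l - 1)\<close>, as long as \<open>k\<close> is not too large.  Iterating from the complete graph, the sizes of the fingerprints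
  form a geometric progression, up to an error absorbed by the logarithmic factor in the bound on \<open>k\<close>,
  so that the entropy of splitting \<open>s\<close> edges between the levels is only \<open>O(\<delta> M)\<close>.
\<close>

section \<open>Log-convex sequences\<close>

text \<open>The fingerprint density t of the container lemma has to meet two demands. A set of i <
  2l edges of a cycle spans at least i + 1 vertices, so vertex sampling of density p suppresses it
  by p^(i-1) relative to one edge; this allows codegrees of order B p^(i-1) and asks for t >= p. A
  whole cycle has weight 1, which asks for B t^(2l-1) >= 1. As B has order (pn)^(1-1/l) / p^(2l-2),
  the second demand costs n^(-gap) M edges, where gap = (l-1)/(l(2l-1)). Keeping this below \<delta>
  M means k < n^((l-1) gap), the exponent in the bound on k. The logarithms arise because there are
  O(log n) levels and each edge of a very small fingerprint is simply charged n^2 choices: (log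
  n)^2, raised to the power l - 1.

  The obstacle in the count is that each binomial has its own size x in the denominator, while the
  bound wants the total s. As the bounds on x grow geometrically towards the last level, the
  exchange costs only exp of a sum of terms sqrt(s x), which is O(\<delta> M). Colours are the
  individual fingerprints in order of creation, so that every container can be replayed from the
  coloured graph.\<close>

definition log_convex :: "(nat \<Rightarrow> real) \<Rightarrow> bool" where
  "log_convex f \<longleftrightarrow> (\<forall>t. 0 \<le> f t \<and> f (Suc t) ^ 2 \<le> f t * f (Suc (Suc t)))"

text \<open>The ratios f (t + 1) / f t increase. Denominators are cleared to allow zeros; f t = 0
  forces f (Suc t) = 0.\<close>

lemma log_convex_ratio:
  assumes "log_convex f" "s \<le> t"
  shows "f (Suc s) * f t \<le> f s * f (Suc t)"
  using assms(2)
proof (induction t rule: dec_induct)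
  case base
  show ?case by (simp add: mult.commute)
next
  case (step t)
  have nn: "f i \<ge> 0" for i using assms(1) by (auto simp: log_convex_def)
  have sq: "f (Suc t) ^ 2 \<le> f t * f (Suc (Suc t))" using assms(1) by (auto simp: log_convex_def)
  show ?case
  proof (cases "f t = 0")
    case True
    with sq have "f (Suc t) = 0" by simp
    then show ?thesis using nn by simp
  next
    case False
    have "f t * (f (Suc s) * f (Suc t)) = (f (Suc s) * f t) * f (Suc t)" by simp
    also have "\<dots> \<le> (f s * f (Suc t)) * f (Suc t)" using step.IH nn by (intro mult_right_mono) auto
    also have "\<dots> = f s * f (Suc t) ^ 2" by (simp add: power2_eq_square)
    also have "\<dots> \<le> f s * (f t * f (Suc (Suc t)))" using sq nn by (intro mult_left_mono) auto
    finally have "f t * (f (Suc s) * f (Suc t)) \<le> f t * (f s * f (Suc (Suc t)))" by (simp add: mult_ac)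
    then show ?thesis using False nn[of t] by (simp add: mult_le_cancel_left)
  qed
qed

text \<open>Each use of \<open>log_convex_ratio\<close> moves the pair (s, t) one step apart without
  changing its sum, until it reaches (1, s + t - 1). This compares every splitting of a closed walk
  with the most unbalanced one.\<close>

lemma log_convex_outer:
  assumes "log_convex f" "1 \<le> s" "s \<le> t"
  shows "f s * f t \<le> f 1 * f (s + t - 1)"
  using assms(2,3)
proof (induction s arbitrary: t rule: dec_induct)
  case base
  then show ?case by simp
next
  case (step s)
  have "f (Suc s) * f t \<le> f s * f (Suc t)"
    using log_convex_ratio[OF assms(1), of s t] step by simp
  also have "\<dots> \<le> f 1 * f (s + Suc t - 1)" using step by (intro step.IH) auto
  finally show ?case by simp
qed

lemma log_convex_outer':
  assumes "log_convex f" "1 \<le> s" "1 \<le> t"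
  shows "f s * f t \<le> f 1 * f (s + t - 1)"
  using log_convex_outer[of f s t] log_convex_outer[of f t s] assms
  by (cases "s \<le> t") (auto simp: mult.commute add.commute)

text \<open>All ratios are at least the first one, so f grows at least geometrically with ratio f 1
  / f 0.\<close>

lemma log_convex_power_le:
  assumes "log_convex f"
  shows "f 1 ^ Suc t \<le> f 0 ^ t * f (Suc t)"
proof (induction t)
  case (Suc t)
  have nn: "f i \<ge> 0" for i using assms by (auto simp: log_convex_def)
  have "f 1 ^ Suc (Suc t) = f 1 * f 1 ^ Suc t" by simp
  also have "\<dots> \<le> f 1 * (f 0 ^ t * f (Suc t))" using Suc nn by (intro mult_left_mono) auto
  also have "\<dots> = f 0 ^ t * (f 1 * f (Suc t))" by simp
  also have "\<dots> \<le> f 0 ^ t * (f 0 * f (Suc (Suc t)))"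
    using log_convex_ratio[OF assms, of 0 "Suc t"] nn by (intro mult_left_mono) auto
  finally show ?case by (simp add: mult_ac)
qed simp

text \<open>Interpolation of the index t between 0 and t + 1, in a form free of roots. It bounds
  closed walks of length 2l - 2 by those of length 2l.\<close>

lemma log_convex_power_le':
  assumes "log_convex f"
  shows "f t ^ Suc t \<le> f 0 * f (Suc t) ^ t"
proof (induction t)
  case (Suc t)
  have nn: "f i \<ge> 0" for i using assms by (auto simp: log_convex_def)
  have sq: "f (Suc t) ^ 2 \<le> f t * f (Suc (Suc t))" using assms by (auto simp: log_convex_def)
  show ?case
  proof (cases "f (Suc t) = 0")
    case False
    \<comment> \<open>The extra factor f (Suc t) ^ t makes the left side a power of f (Suc t) ^ 2;
      it is cancelled at the end.\<close>
    have "f (Suc t) ^ t * f (Suc t) ^ Suc (Suc t) = (f (Suc t) ^ 2) ^ Suc t"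
      by (simp flip: power_mult power_add add: power2_eq_square power_mult_distrib)
    also have "\<dots> \<le> (f t * f (Suc (Suc t))) ^ Suc t" using sq by (intro power_mono) auto
    also have "\<dots> = f t ^ Suc t * f (Suc (Suc t)) ^ Suc t" by (rule power_mult_distrib)
    also have "\<dots> \<le> (f 0 * f (Suc t) ^ t) * f (Suc (Suc t)) ^ Suc t"
      using Suc nn by (intro mult_right_mono) auto
    finally have "f (Suc t) ^ t * f (Suc t) ^ Suc (Suc t) \<le> f (Suc t) ^ t * (f 0 * f (Suc (Suc t)) ^ Suc t)"
      by (simp add: mult_ac)
    moreover have "f (Suc t) ^ t > 0" using False nn[of "Suc t"] by simp
    ultimately show ?thesis by (simp only: mult_le_cancel_left_pos)
  qed (use nn in simp)
qed simp

section \<open>Counting walks\<close>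

text \<open>The (u, v) entry of the t-th power of the adjacency matrix, so that
  \<open>walks_add\<close> is the product of two such powers.\<close>

primrec walks :: "'a set \<Rightarrow> ('a \<Rightarrow> 'a \<Rightarrow> bool) \<Rightarrow> nat \<Rightarrow> 'a \<Rightarrow> 'a \<Rightarrow> real" where
  "walks V P 0 u v = of_bool (u = v)"
| "walks V P (Suc t) u v = (\<Sum>w\<in>V. of_bool (P u w) * walks V P t w v)"

lemma walks_nonneg: "walks V P t u v \<ge> 0"
  by (induction t arbitrary: u) (auto intro!: sum_nonneg)

lemma walks_one:
  assumes "finite V" "y \<in> V"
  shows "walks V P 1 x y = of_bool (P x y)"
proof -
  have "walks V P 1 x y = (\<Sum>w\<in>V. if w = y then of_bool (P x y) else 0)"
    unfolding One_nat_def walks.simps by (intro sum.cong) auto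
  then show ?thesis using assms by simp
qed

lemma walks_add:
  assumes "finite V" "u \<in> V"
  shows "walks V P (s + t) u v = (\<Sum>w\<in>V. walks V P s u w * walks V P t w v)"
  using assms(2)
proof (induction s arbitrary: u)
  case 0
  have "(\<Sum>w\<in>V. walks V P 0 u w * walks V P t w v) = (\<Sum>w\<in>V. if u = w then walks V P t w v else 0)"
    by (intro sum.cong) auto
  then show ?case using 0 assms(1) by simp
next
  case (Suc s)
  have "walks V P (Suc s + t) u v = (\<Sum>x\<in>V. of_bool (P u x) * (\<Sum>w\<in>V. walks V P s x w * walks V P t w v))"
    using Suc by simp
  also have "\<dots> = (\<Sum>x\<in>V. \<Sum>w\<in>V. of_bool (P u x) * walks V P s x w * walks V P t w v)"
    by (simp add: sum_distrib_left mult.assoc)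
  also have "\<dots> = (\<Sum>w\<in>V. \<Sum>x\<in>V. of_bool (P u x) * walks V P s x w * walks V P t w v)"
    by (rule sum.swap)
  also have "\<dots> = (\<Sum>w\<in>V. walks V P (Suc s) u w * walks V P t w v)"
    by (simp add: sum_distrib_right)
  finally show ?case .
qed

lemma walks_sym:
  assumes "finite V" "symp P" "u \<in> V" "v \<in> V"
  shows "walks V P t u v = walks V P t v u"
  using assms(3,4)
proof (induction t arbitrary: u v)
  case (Suc t)
  note one = walks_one[OF assms(1)]
  have "walks V P (Suc t) u v = (\<Sum>w\<in>V. of_bool (P u w) * walks V P t v w)"
    using Suc by simp
  also have "\<dots> = (\<Sum>w\<in>V. walks V P t v w * walks V P 1 w u)"
    unfolding one[OF Suc.prems(1)] using assms(2) by (intro sum.cong refl) (auto dest: sympD)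
  also have "\<dots> = walks V P (t + 1) v u" using walks_add[OF assms(1) Suc.prems(2), of P t 1 u] by simp
  finally show ?case by simp
qed auto


section \<open>Log-convexity of walk counts\<close>

lemma log_convex_sum:
  assumes "\<And>v. v \<in> S \<Longrightarrow> log_convex (f v)"
  shows "log_convex (\<lambda>t. \<Sum>v\<in>S. f v t)"
  unfolding log_convex_def
proof (intro allI conjI)
  fix t
  have nn: "f v i \<ge> 0" if "v \<in> S" for v i using assms[OF that] by (auto simp: log_convex_def)
  then show "0 \<le> (\<Sum>v\<in>S. f v t)" by (intro sum_nonneg)
  have "(\<Sum>v\<in>S. f v (Suc t)) \<le> (\<Sum>v\<in>S. sqrt (f v t) * sqrt (f v (Suc (Suc t))))"
  proof (intro sum_mono)
    fix v assume v: "v \<in> S"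
    have "f v (Suc t) = sqrt (f v (Suc t) ^ 2)" using nn[OF v] by simp
    also have "\<dots> \<le> sqrt (f v t * f v (Suc (Suc t)))"
      using assms[OF v] by (intro real_sqrt_le_mono) (auto simp: log_convex_def)
    finally show "f v (Suc t) \<le> sqrt (f v t) * sqrt (f v (Suc (Suc t)))"
      by (simp add: real_sqrt_mult)
  qed
  then have "(\<Sum>v\<in>S. f v (Suc t))\<^sup>2 \<le> (\<Sum>v\<in>S. sqrt (f v t) * sqrt (f v (Suc (Suc t))))\<^sup>2"
    using nn by (intro power_mono) (auto intro: sum_nonneg)
  also have "\<dots> \<le> (\<Sum>v\<in>S. (sqrt (f v t))\<^sup>2) * (\<Sum>v\<in>S. (sqrt (f v (Suc (Suc t))))\<^sup>2)"
    by (rule Cauchy_Schwarz_ineq_sum)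
  also have "\<dots> = (\<Sum>v\<in>S. f v t) * (\<Sum>v\<in>S. f v (Suc (Suc t)))"
    using nn by (simp cong: sum.cong)
  finally show "(\<Sum>v\<in>S. f v (Suc t))\<^sup>2 \<le> (\<Sum>v\<in>S. f v t) * (\<Sum>v\<in>S. f v (Suc (Suc t)))" .
qed

text \<open>Here f (2 t) is the squared norm of g t, and f (2 t + 2) is the inner product of g t and
  g (t + 2), so Cauchy-Schwarz applies. Squared norms occur at even indices, hence the 2 t.\<close>

lemma log_convex_inner:
  fixes g :: "nat \<Rightarrow> 'a \<Rightarrow> real"
  assumes "\<And>s t. f (s + t) = (\<Sum>w\<in>V. g s w * g t w)"
  shows "log_convex (\<lambda>t. f (2 * t))"
  unfolding log_convex_def
proof (intro allI conjI)
  fix t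
  have sq: "f (2 * s) = (\<Sum>w\<in>V. (g s w)\<^sup>2)" for s
    using assms[of s s] by (simp add: mult_2 power2_eq_square)
  then show "0 \<le> f (2 * t)" by (simp add: sum_nonneg)
  have "f (2 * Suc t) = (\<Sum>w\<in>V. g t w * g (Suc (Suc t)) w)"
    using assms[of t "Suc (Suc t)"] by (simp add: mult_2)
  then have "(f (2 * Suc t))\<^sup>2 \<le> (\<Sum>w\<in>V. (g t w)\<^sup>2) * (\<Sum>w\<in>V. (g (Suc (Suc t)) w)\<^sup>2)"
    by (simp only: Cauchy_Schwarz_ineq_sum)
  then show "(f (2 * Suc t))\<^sup>2 \<le> f (2 * t) * f (2 * Suc (Suc t))"
    by (simp only: sq)
qed

lemma log_convex_closed_walks:
  assumes "finite V" "symp P" "v \<in> V"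
  shows "log_convex (\<lambda>t. walks V P (2 * t) v v)"
proof (rule log_convex_inner[where g = "\<lambda>t w. walks V P t v w" and V = V])
  show "walks V P (s + t) v v = (\<Sum>w\<in>V. walks V P s v w * walks V P t v w)" for s t
    using walks_sym[OF assms(1,2)] assms(3) unfolding walks_add[OF assms(1,3)]
    by (intro sum.cong) auto
qed

lemma log_convex_walks_between:
  assumes "finite V" "symp P" "X \<subseteq> V"
  shows "log_convex (\<lambda>t. \<Sum>v\<in>X. \<Sum>u\<in>X. walks V P (2 * t) v u)"
proof (rule log_convex_inner[where g = "\<lambda>t w. \<Sum>v\<in>X. walks V P t v w" and V = V])
  fix s t
  have "(\<Sum>v\<in>X. \<Sum>u\<in>X. walks V P (s + t) v u) = (\<Sum>v\<in>X. \<Sum>u\<in>X. \<Sum>w\<in>V. walks V P s v w * walks V P t u w)"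
    using walks_sym[OF assms(1,2)] assms(3)
    by (intro sum.cong refl, subst walks_add[OF assms(1)]) (auto intro!: sum.cong)
  also have "\<dots> = (\<Sum>w\<in>V. \<Sum>v\<in>X. \<Sum>u\<in>X. walks V P s v w * walks V P t u w)"
    by (subst sum.swap[of _ V]) (simp add: sum.swap[of _ V])
  also have "\<dots> = (\<Sum>w\<in>V. (\<Sum>v\<in>X. walks V P s v w) * (\<Sum>u\<in>X. walks V P t u w))"
    by (simp add: sum_product)
  finally show "(\<Sum>v\<in>X. \<Sum>u\<in>X. walks V P (s + t) v u) = \<dots>" .
qed

text \<open>Walks of length 2 l between vertices of X are bounded below through log-convexity from
  the lengths 0 and 2. They are bounded above by card X times the closed ones: the count from v to u
  is the inner product of the length-l walk vectors of v and u, hence at most the mean of their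
  squared norms.\<close>

lemma closed_walks_lower_bound:
  assumes fin: "finite V" and sym: "symp P" and XV: "X \<subseteq> V" "X \<noteq> {}" and YV: "Y \<subseteq> V" "Y \<noteq> {}"
  defines "e \<equiv> \<Sum>x\<in>X. \<Sum>y\<in>Y. (of_bool (P x y) :: real)"
  assumes l: "l \<ge> 1"
  shows "(e\<^sup>2 / (card X * card Y)) ^ l \<le> (\<Sum>v\<in>X. walks V P (2 * l) v v)"
proof -
  let ?n = "\<lambda>t. \<Sum>v\<in>X. \<Sum>u\<in>X. walks V P (2 * t) v u"
  let ?a = "real (card X)" and ?b = "real (card Y)"
  have finX: "finite X" and finY: "finite Y" using fin XV YV finite_subset by auto
  have a: "?a > 0" and b: "?b > 0" using finX finY XV YV by (auto simp: card_gt_0_iff)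
  note one = walks_one[OF fin]
  have n0: "?n 0 = ?a"
    using finX by simp
  have n1: "?n 1 \<ge> e\<^sup>2 / ?b"
  proof -
    have "?n 1 = (\<Sum>v\<in>X. \<Sum>u\<in>X. \<Sum>w\<in>V. of_bool (P v w) * of_bool (P u w))"
    proof (intro sum.cong refl)
      fix v u assume vu: "v \<in> X" "u \<in> X"
      have "walks V P (1 + 1) v u = (\<Sum>w\<in>V. walks V P 1 v w * walks V P 1 w u)"
        using walks_add[OF fin, of v P 1 1 u] vu XV by auto
      also have "\<dots> = (\<Sum>w\<in>V. of_bool (P v w) * of_bool (P u w))"
        using vu XV sympD[OF sym] by (intro sum.cong refl) (subst one, simp, subst one, auto)
      finally show "walks V P (2 * 1) v u = \<dots>" by (simp add: numeral_2_eq_2)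
    qed
    also have "\<dots> = (\<Sum>w\<in>V. \<Sum>v\<in>X. \<Sum>u\<in>X. of_bool (P v w) * of_bool (P u w))"
      by (subst sum.swap[of _ V]) (simp add: sum.swap[of _ V])
    also have "\<dots> = (\<Sum>w\<in>V. (\<Sum>v\<in>X. of_bool (P v w))\<^sup>2)"
      by (simp add: power2_eq_square sum_product)
    also have "\<dots> \<ge> (\<Sum>w\<in>Y. (\<Sum>v\<in>X. of_bool (P v w))\<^sup>2)"
      using fin YV by (intro sum_mono2) auto
    also have "(\<Sum>w\<in>Y. (\<Sum>v\<in>X. (of_bool (P v w) :: real))\<^sup>2) \<ge> e\<^sup>2 / ?b"
    proof -
      have "e = (\<Sum>w\<in>Y. (\<Sum>v\<in>X. of_bool (P v w)))" unfolding e_def by (rule sum.swap)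
      then have "e\<^sup>2 \<le> (\<Sum>w\<in>Y. (\<Sum>v\<in>X. (of_bool (P v w) :: real))\<^sup>2) * ?b"
        by (simp only: sum_squared_le_sum_of_squares)
      then show ?thesis using b by (simp add: divide_le_eq)
    qed
    finally show ?thesis .
  qed
  have lc: "log_convex ?n" by (rule log_convex_walks_between[OF fin sym XV(1)])
  obtain k where k: "l = Suc k" using l by (cases l) auto
  have "(e\<^sup>2 / ?b) ^ l \<le> ?n 1 ^ l" using n1 b by (intro power_mono) auto
  also have "\<dots> \<le> ?a ^ k * ?n l" using log_convex_power_le[OF lc, of k] by (simp only: k n0)
  also have "\<dots> \<le> ?a ^ k * (?a * (\<Sum>v\<in>X. walks V P (2 * l) v v))"
  proof (intro mult_left_mono)
    have amgm: "x * y \<le> (x * x + y * y) / 2" for x y :: real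
      using sum_squares_bound[of x y] by (simp add: power2_eq_square)
    have le: "walks V P (2 * l) v u \<le> (walks V P (2 * l) v v + walks V P (2 * l) u u) / 2"
      if "v \<in> X" "u \<in> X" for v u
    proof -
      have vu: "v \<in> V" "u \<in> V" using that XV by auto
      have eq: "walks V P (2 * l) x y = (\<Sum>w\<in>V. walks V P l x w * walks V P l y w)"
        if "x \<in> V" "y \<in> V" for x y
        using walks_sym[OF fin sym] that unfolding mult_2 walks_add[OF fin that(1)]
        by (intro sum.cong) auto
      have "walks V P (2 * l) v u \<le> (\<Sum>w\<in>V. (walks V P l v w * walks V P l v w + walks V P l u w * walks V P l u w) / 2)"
        unfolding eq[OF vu]
        by (intro sum_mono amgm)
      also have "\<dots> = (walks V P (2 * l) v v + walks V P (2 * l) u u) / 2"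
        unfolding eq[OF vu(1) vu(1)] eq[OF vu(2) vu(2)]
        by (simp add: sum.distrib add_divide_distrib flip: sum_divide_distrib)
      finally show ?thesis .
    qed
    have "?n l \<le> (\<Sum>v\<in>X. \<Sum>u\<in>X. (walks V P (2 * l) v v + walks V P (2 * l) u u) / 2)"
      using le by (intro sum_mono) auto
    also have "\<dots> = ?a * (\<Sum>v\<in>X. walks V P (2 * l) v v)"
      by (simp add: add_divide_distrib sum.distrib flip: sum_divide_distrib sum_distrib_left)
    finally show "?n l \<le> ?a * (\<Sum>v\<in>X. walks V P (2 * l) v v)" .
  qed (use a in auto)
  finally have "(e\<^sup>2 / ?b) ^ l \<le> ?a ^ l * (\<Sum>v\<in>X. walks V P (2 * l) v v)" by (simp add: k mult_ac)
  moreover have "(e\<^sup>2 / (?a * ?b)) ^ l = (e\<^sup>2 / ?b) ^ l / ?a ^ l"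
    by (simp add: power_divide power_mult_distrib)
  ultimately show ?thesis using a by (simp add: pos_divide_le_eq mult.commute)
qed

lemma walks_2:
  assumes "finite V" "symp P" "v \<in> V"
  shows "walks V P 2 v v = real (card {w \<in> V. P v w})"
proof -
  have "walks V P (1 + 1) v v = (\<Sum>w\<in>V. walks V P 1 v w * walks V P 1 w v)"
    by (rule walks_add[OF assms(1,3)])
  also have "\<dots> = (\<Sum>w\<in>V. of_bool (P v w))"
    unfolding walks_one[OF assms(1,3)] using walks_one[OF assms(1)] sympD[OF assms(2)]
    by (intro sum.cong refl) auto
  finally show ?thesis using assms(1) by (simp add: numeral_2_eq_2 Int_def)
qed

lemma walks_parity:
  assumes "\<And>u v. P u v \<Longrightarrow> (u \<in> X) \<noteq> (v \<in> X)" "walks V P t u v \<noteq> 0"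
  shows "even t \<longleftrightarrow> (u \<in> X \<longleftrightarrow> v \<in> X)"
  using assms(2)
proof (induction t arbitrary: u)
  case 0
  then show ?case by auto
next
  case (Suc t)
  then obtain w where "P u w" "walks V P t w v \<noteq> 0"
    by (auto elim!: sum.not_neutral_contains_not_neutral)
  then show ?case using Suc.IH[of w] assms(1)[of u w] by auto
qed

section \<open>Walks as vertex sequences, and closed walks that repeat a vertex\<close>

definition walk_lists :: "'a set \<Rightarrow> ('a \<Rightarrow> 'a \<Rightarrow> bool) \<Rightarrow> nat \<Rightarrow> 'a \<Rightarrow> 'a \<Rightarrow> 'a list set" where
  "walk_lists V P t u v =
     {xs. length xs = Suc t \<and> set xs \<subseteq> V \<and> xs ! 0 = u \<and> xs ! t = v \<and> (\<forall>i<t. P (xs ! i) (xs ! Suc i))}"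

lemma finite_walk_lists: "finite V \<Longrightarrow> finite (walk_lists V P t u v)"
  by (rule finite_subset[OF _ finite_lists_length_eq[of V "Suc t"]]) (auto simp: walk_lists_def)

lemma card_walk_lists:
  assumes "finite V" "u \<in> V"
  shows "real (card (walk_lists V P t u v)) = walks V P t u v"
  using assms(2)
proof (induction t arbitrary: u)
  case 0
  then have "walk_lists V P 0 u v = (if u = v then {[u]} else {})"
    by (auto simp: walk_lists_def length_Suc_conv)
  then show ?case by simp
next
  case (Suc t)
  have eq: "walk_lists V P (Suc t) u v = (\<Union>w\<in>{w\<in>V. P u w}. (#) u ` walk_lists V P t w v)"
  proof (intro equalityI subsetI)
    fix xs assume xs: "xs \<in> walk_lists V P (Suc t) u v"
    then obtain ys where ys: "xs = u # ys" "length ys = Suc t" by (auto simp: walk_lists_def length_Suc_conv)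
    have "P u (ys ! 0)" using xs ys by (auto simp: walk_lists_def)
    moreover have "ys \<in> walk_lists V P t (ys ! 0) v" using xs ys by (auto simp: walk_lists_def)
    moreover have "ys ! 0 \<in> V" using xs ys by (auto simp: walk_lists_def)
    ultimately show "xs \<in> (\<Union>w\<in>{w\<in>V. P u w}. (#) u ` walk_lists V P t w v)" using ys by blast
  next
    fix xs assume "xs \<in> (\<Union>w\<in>{w\<in>V. P u w}. (#) u ` walk_lists V P t w v)"
    then show "xs \<in> walk_lists V P (Suc t) u v"
      using Suc.prems by (auto simp: walk_lists_def nth_Cons split: nat.splits)
  qed
  have "real (card (walk_lists V P (Suc t) u v)) = (\<Sum>w\<in>{w\<in>V. P u w}. real (card ((#) u ` walk_lists V P t w v)))"
    unfolding eq
    using assms(1) by (subst card_UN_disjoint) (simp_all add: finite_walk_lists, auto simp: walk_lists_def)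
  also have "\<dots> = (\<Sum>w\<in>{w\<in>V. P u w}. walks V P t w v)"
    using Suc.IH by (intro sum.cong refl) (subst card_image, auto)
  also have "\<dots> = walks V P (Suc t) u v"
    using assms(1) by (auto intro!: sum.mono_neutral_cong_left)
  finally show ?case .
qed

definition closed_walks :: "'a set \<Rightarrow> ('a \<Rightarrow> 'a \<Rightarrow> bool) \<Rightarrow> nat \<Rightarrow> 'a list set" where
  "closed_walks V P m = (\<Union>v\<in>V. walk_lists V P m v v)"

lemma finite_closed_walks: "finite V \<Longrightarrow> finite (closed_walks V P m)"
  by (simp add: closed_walks_def finite_walk_lists)

lemma card_closed_walks:
  assumes "finite V"
  shows "real (card (closed_walks V P m)) = (\<Sum>v\<in>V. walks V P m v v)"
  unfolding closed_walks_def using assms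
  by (subst card_UN_disjoint) (auto simp: finite_walk_lists card_walk_lists, auto simp: walk_lists_def)

text \<open>A closed walk visiting \<open>v\<close> at times \<open>i < j\<close> splits into two closed walks based at \<open>v\<close>.\<close>

lemma card_closed_walks_revisiting:
  assumes fin: "finite V" and ij: "i < j" "j < m"
  shows "real (card {xs \<in> closed_walks V P m. xs ! i = xs ! j})
     \<le> (\<Sum>v\<in>V. walks V P (j - i) v v * walks V P (m - (j - i)) v v)"
proof -
  \<comment> \<open>The second walk runs from time j to m and, as xs ! m = xs ! 0, goes on with
    times 1 to i; its index m - j stands for both times m and 0.\<close>
  define f where "f xs = (map (\<lambda>k. xs ! (i + k)) [0..<Suc (j - i)],
    map (\<lambda>k. if k \<le> m - j then xs ! (j + k) else xs ! (k - (m - j))) [0..<Suc (m - (j - i))])" for xs :: "'a list"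
  let ?W = "\<lambda>v. walk_lists V P (j - i) v v \<times> walk_lists V P (m - (j - i)) v v"
  let ?D = "{xs \<in> closed_walks V P m. xs ! i = xs ! j}"
  have "inj_on f ?D"
  proof (rule inj_onI)
    fix xs ys assume xs: "xs \<in> ?D" and ys: "ys \<in> ?D" and eq: "f xs = f ys"
    have len: "length xs = Suc m" "length ys = Suc m"
      and ends: "xs ! m = xs ! 0" "ys ! m = ys ! 0"
      using xs ys by (auto simp: closed_walks_def walk_lists_def)
    have 1: "xs ! (i + k) = ys ! (i + k)" if "k \<le> j - i" for k
      using arg_cong[OF eq, of "\<lambda>p. fst p ! k"] that by (simp add: f_def del: upt_Suc)
    have 2: "xs ! (j + k) = ys ! (j + k)" if "k \<le> m - j" for k
      using arg_cong[OF eq, of "\<lambda>p. snd p ! k"] that ij by (simp add: f_def del: upt_Suc)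
    have 3: "xs ! k = ys ! k" if "0 < k" "k \<le> i" for k
    proof -
      have "m - j + k < Suc (m - (j - i))" using that ij by simp
      then show ?thesis
        using arg_cong[OF eq, of "\<lambda>p. snd p ! (m - j + k)"] that
        by (simp add: f_def del: upt_Suc Nat.diff_diff_right Nat.add_diff_assoc2)
    qed
    have 4: "xs ! 0 = ys ! 0" using 2[of "m - j"] ij ends by simp
    show "xs = ys"
    proof (rule nth_equalityI)
      fix k assume "k < length xs"
      then consider "k = 0" | "0 < k" "k \<le> i" | "i \<le> k" "k \<le> j" | "j \<le> k" "k \<le> m" using len by fastforce
      then show "xs ! k = ys ! k"
        using 1[of "k - i"] 2[of "k - j"] 3 4 by cases auto
    qed (use len in simp)
  qed
  moreover have "f ` ?D \<subseteq> (\<Union>v\<in>V. ?W v)"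
  proof (rule image_subsetI)
    fix xs assume xs: "xs \<in> ?D"
    have len: "length xs = Suc m" and ends: "xs ! m = xs ! 0" and V: "set xs \<subseteq> V"
      and P: "\<And>k. k < m \<Longrightarrow> P (xs ! k) (xs ! Suc k)" and eq: "xs ! i = xs ! j"
      using xs by (auto simp: closed_walks_def walk_lists_def)
    have inV: "xs ! k \<in> V" if "k \<le> m" for k using V len that by (auto simp: subset_iff)
    have "fst (f xs) \<in> walk_lists V P (j - i) (xs ! i) (xs ! i)"
      using ij inV P eq by (auto simp: f_def walk_lists_def simp del: upt_Suc)
    moreover have "snd (f xs) \<in> walk_lists V P (m - (j - i)) (xs ! i) (xs ! i)"
    proof -
      have "P (snd (f xs) ! k) (snd (f xs) ! Suc k)" if "k < m - (j - i)" for k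
      proof (cases "k \<le> m - j")
        case True
        have "Suc k - (m - j) = 1" if "\<not> Suc k \<le> m - j" using True that by simp
        then show ?thesis
          using True that ij P[of "j + k"] P[of 0] ends
          by (cases "k = m - j") (auto simp: f_def simp del: upt_Suc)
      next
        case False
        then show ?thesis using that ij P[of "k - (m - j)"]
          by (simp add: f_def Suc_diff_le del: upt_Suc)
      qed
      moreover have "snd (f xs) ! (m - (j - i)) = xs ! i"
        using ij ends eq by (cases "i = 0") (auto simp: f_def simp del: upt_Suc)
      ultimately show ?thesis
        using ij inV eq by (auto simp: f_def walk_lists_def simp del: upt_Suc)
    qed
    ultimately show "f xs \<in> (\<Union>v\<in>V. ?W v)" using inV[of i] ij by (cases "f xs") auto
  qed
  ultimately have "card ?D \<le> card (\<Union>v\<in>V. ?W v)"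
    using fin by (intro card_inj_on_le) (auto intro: finite_walk_lists)
  also have "\<dots> \<le> (\<Sum>v\<in>V. card (?W v))" using fin by (rule card_UN_le)
  finally have "real (card ?D) \<le> (\<Sum>v\<in>V. real (card (?W v)))" by (simp flip: of_nat_sum)
  also have "\<dots> = (\<Sum>v\<in>V. walks V P (j - i) v v * walks V P (m - (j - i)) v v)"
    using card_walk_lists[OF fin] by (simp add: card_cartesian_product)
  finally show ?thesis .
qed

text \<open>A repetition at odd distance is impossible in a bipartite graph. At even distance 2 s
  the walk splits into closed walks of lengths 2 s and 2 (l - s), and log-convexity makes the
  lengths 2 and 2 l - 2 the worst case. The factor counts pairs of times.\<close>

lemma card_degenerate_closed_walks:
  assumes fin: "finite V" and sym: "symp P"
    and bip: "\<And>u v. P u v \<Longrightarrow> (u \<in> X) \<noteq> (v \<in> X)" and l: "l \<ge> 2"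
  shows "real (card {xs \<in> closed_walks V P (2 * l). \<exists>i j. i < j \<and> j < 2 * l \<and> xs ! i = xs ! j})
     \<le> (2 * real l)\<^sup>2 * (\<Sum>v\<in>V. walks V P 2 v v * walks V P (2 * (l - 1)) v v)"
proof -
  let ?Q = "\<Sum>v\<in>V. walks V P 2 v v * walks V P (2 * (l - 1)) v v"
  let ?D = "\<lambda>i j. {xs \<in> closed_walks V P (2 * l). xs ! i = xs ! j}"
  let ?I = "{(i, j). i < j \<and> j < 2 * l}"
  have Q0: "?Q \<ge> 0" by (intro sum_nonneg mult_nonneg_nonneg walks_nonneg)
  have D: "real (card (?D i j)) \<le> ?Q" if ij: "i < j" "j < 2 * l" for i j
  proof (cases "even (j - i)")
    case True
    then obtain s where s: "j - i = 2 * s" unfolding dvd_def by blast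
    have s1: "1 \<le> s" "1 \<le> l - s" and m: "2 * l - 2 * s = 2 * (l - s)" using s ij by auto
    have sl: "s + (l - s) - 1 = l - 1" using s1 by simp
    have "real (card (?D i j)) \<le> (\<Sum>v\<in>V. walks V P (2 * s) v v * walks V P (2 * (l - s)) v v)"
      using card_closed_walks_revisiting[OF fin ij, where P = P] by (simp only: s m)
    also have "\<dots> \<le> ?Q"
    proof (rule sum_mono)
      fix v assume v: "v \<in> V"
      show "walks V P (2 * s) v v * walks V P (2 * (l - s)) v v \<le> walks V P 2 v v * walks V P (2 * (l - 1)) v v"
        using log_convex_outer'[OF log_convex_closed_walks[OF fin sym v] s1] by (simp only: sl mult_1_right)
    qed
    finally show ?thesis .
  next
    case False
    have "walks V P (j - i) v v = 0" for v
      using walks_parity[of P X V "j - i" v v, OF bip] False by auto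
    then show ?thesis
      using card_closed_walks_revisiting[OF fin ij, where P = P] Q0 by simp
  qed
  have finI: "finite ?I" by (rule finite_subset[of _ "{..<2*l} \<times> {..<2*l}"]) auto
  have cardI: "real (card ?I) \<le> (2 * real l)\<^sup>2"
  proof -
    have "card ?I \<le> card ({..<2*l} \<times> {..<2*l})" by (intro card_mono) auto
    then have "real (card ?I) \<le> real (card ({..<2*l} \<times> {..<2*l}))" by (rule of_nat_mono)
    then show ?thesis by (simp add: power2_eq_square)
  qed
  have "{xs \<in> closed_walks V P (2 * l). \<exists>i j. i < j \<and> j < 2 * l \<and> xs ! i = xs ! j} = (\<Union>p\<in>?I. ?D (fst p) (snd p))"
    (is "?L = ?R")
  proof (intro equalityI subsetI)
    fix xs assume "xs \<in> ?L"
    then obtain i j where "(i, j) \<in> ?I" "xs \<in> ?D i j" by blast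
    then show "xs \<in> ?R" by (intro UN_I[of "(i, j)"]) simp_all
  next
    fix xs assume "xs \<in> ?R"
    then obtain p where "p \<in> ?I" "xs \<in> ?D (fst p) (snd p)" by blast
    then have "fst p < snd p \<and> snd p < 2 * l \<and> xs ! fst p = xs ! snd p" "xs \<in> closed_walks V P (2 * l)" by auto
    then show "xs \<in> ?L" by blast
  qed
  then have "real (card {xs \<in> closed_walks V P (2 * l). \<exists>i j. i < j \<and> j < 2 * l \<and> xs ! i = xs ! j})
    \<le> real (\<Sum>p\<in>?I. card (?D (fst p) (snd p)))"
    using card_UN_le[OF finI] by (simp only: of_nat_le_iff)
  also have "\<dots> = (\<Sum>p\<in>?I. real (card (?D (fst p) (snd p))))" by simp
  also have "\<dots> \<le> (\<Sum>p\<in>?I. ?Q)" using D by (intro sum_mono) auto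
  also have "\<dots> = real (card ?I) * ?Q" by simp
  also have "\<dots> \<le> (2 * real l)\<^sup>2 * ?Q" using cardI Q0 by (rule mult_right_mono)
  finally show ?thesis .
qed

text \<open>Let T be the number of closed walks of length 2 l and s its l-th root. Interpolation
  bounds the closed walks of length 2 l - 2 from X by card X powr (1 / l) * s ^ (l - 1), and
  likewise for Y. Condition \<open>large\<close> then makes the degenerate walks at most Q * s ^ (l
  - 1) / 2 <= T / 2, because Q <= s. In its constant 8 l^2, pairs of times account for 4 l^2 and the
  final halving for the factor 2.\<close>

lemma bipartite_cycle_count:
  fixes Dx Dy :: real
  assumes fin: "finite X" "finite Y" and disj: "X \<inter> Y = {}" and ne: "X \<noteq> {}" "Y \<noteq> {}"
    and sym: "symp P" and bip: "\<And>u v. P u v \<Longrightarrow> (u \<in> X \<and> v \<in> Y) \<or> (u \<in> Y \<and> v \<in> X)"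
    and l: "l \<ge> 2"
    and Dx: "\<And>x. x \<in> X \<Longrightarrow> real (card {y \<in> Y. P x y}) \<le> Dx"
    and Dy: "\<And>y. y \<in> Y \<Longrightarrow> real (card {x \<in> X. P x y}) \<le> Dy"
  defines "e \<equiv> \<Sum>x\<in>X. \<Sum>y\<in>Y. (of_bool (P x y) :: real)"
  assumes large: "8 * (real l)\<^sup>2 * (Dx * card X powr (1 / l) + Dy * card Y powr (1 / l)) \<le> e\<^sup>2 / (card X * card Y)"
  shows "(e\<^sup>2 / (card X * card Y)) ^ l / 2
    \<le> real (card {xs \<in> closed_walks (X \<union> Y) P (2 * l). \<forall>i j. i < j \<and> j < 2 * l \<longrightarrow> xs ! i \<noteq> xs ! j})"
proof -
  let ?V = "X \<union> Y"
  let ?W = "walks ?V P"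
  define Q where "Q = e\<^sup>2 / (card X * card Y)"
  define TX where "TX t = (\<Sum>v\<in>X. ?W (2 * t) v v)" for t
  define TY where "TY t = (\<Sum>v\<in>Y. ?W (2 * t) v v)" for t
  define T where "T = TX l + TY l"
  define s where "s = T powr (1 / l)"
  have finV: "finite ?V" using fin by simp
  have bip': "(u \<in> X) \<noteq> (v \<in> X)" if "P u v" for u v using bip[OF that] disj by auto
  have TX0: "TX t \<ge> 0" and TY0: "TY t \<ge> 0" for t
    by (auto simp: TX_def TY_def intro!: sum_nonneg walks_nonneg)
  have Q0: "Q \<ge> 0" by (simp add: Q_def)
  have "Q ^ l \<le> TX l"
    unfolding Q_def e_def TX_def using finV sym ne l by (intro closed_walks_lower_bound) auto
  then have QT: "Q ^ l \<le> T" using TY0[of l] by (simp add: T_def)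
  have T0: "T \<ge> 0" using TX0 TY0 by (simp add: T_def)
  have s0: "s \<ge> 0" by (simp add: s_def)
  have sT: "s ^ l = T"
    using l T0 by (cases "T = 0") (auto simp: s_def powr_power zero_power)
  have Qs: "Q \<le> s" using QT Q0 s0 l by (intro power_le_imp_le_base[of Q "l - 1"]) (simp_all add: sT)
  have lcX: "log_convex TX" and lcY: "log_convex TY"
    unfolding TX_def TY_def by (intro log_convex_sum log_convex_closed_walks finV sym; auto)+
  have root: "F (l - 1) \<le> real c powr (1 / l) * s ^ (l - 1)"
    if F: "log_convex F" "F 0 = real c" "F l \<le> T" for F c
  proof -
    have F0: "F t \<ge> 0" for t using F(1) by (auto simp: log_convex_def)
    have sl: "Suc (l - 1) = l" using l by simp
    have "F (l - 1) ^ l \<le> F 0 * F l ^ (l - 1)" using log_convex_power_le'[OF F(1), of "l - 1"] by (simp only: sl)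
    also have "\<dots> \<le> real c * (s ^ l) ^ (l - 1)" using F F0 sT by (intro mult_mono power_mono) auto
    also have "\<dots> = (real c powr (1 / l)) ^ l * (s ^ (l - 1)) ^ l"
      using l by (cases "c = 0") (simp_all add: powr_power mult.commute flip: power_mult)
    also have "\<dots> = (real c powr (1 / l) * s ^ (l - 1)) ^ Suc (l - 1)" by (simp only: power_mult_distrib sl)
    finally have "F (l - 1) ^ Suc (l - 1) \<le> (real c powr (1 / l) * s ^ (l - 1)) ^ Suc (l - 1)" by (simp only: sl)
    then show ?thesis by (rule power_le_imp_le_base) (use s0 in auto)
  qed
  have TX': "TX (l - 1) \<le> card X powr (1 / l) * s ^ (l - 1)"
    by (rule root[OF lcX]) (use TY0[of l] in \<open>auto simp: TX_def T_def\<close>)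
  have TY': "TY (l - 1) \<le> card Y powr (1 / l) * s ^ (l - 1)"
    by (rule root[OF lcY]) (use TX0[of l] in \<open>auto simp: TY_def T_def\<close>)
  have DxW: "?W 2 x x \<le> Dx" if "x \<in> X" for x
  proof -
    have "{w \<in> ?V. P x w} = {y \<in> Y. P x y}" using bip[of x] that disj by auto
    then show ?thesis using Dx[OF that] walks_2[OF finV sym, of x] that by simp
  qed
  have DyW: "?W 2 y y \<le> Dy" if "y \<in> Y" for y
  proof -
    have "{w \<in> ?V. P y w} = {x \<in> X. P x y}" using bip[of y] that disj sympD[OF sym] by blast
    then show ?thesis using Dy[OF that] walks_2[OF finV sym, of y] that by simp
  qed
  obtain x0 y0 where "x0 \<in> X" "y0 \<in> Y" using ne by auto
  then have D0: "Dx \<ge> 0" "Dy \<ge> 0"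
    using DxW[of x0] DyW[of y0] walks_nonneg[of ?V P 2] by (meson order_trans)+
  let ?C = "closed_walks ?V P (2 * l)"
  let ?B = "{xs \<in> ?C. \<exists>i j. i < j \<and> j < 2 * l \<and> xs ! i = xs ! j}"
  let ?G = "{xs \<in> ?C. \<forall>i j. i < j \<and> j < 2 * l \<longrightarrow> xs ! i \<noteq> xs ! j}"
  have "real (card ?B) \<le> (2 * real l)\<^sup>2 * (\<Sum>v\<in>?V. ?W 2 v v * ?W (2 * (l - 1)) v v)"
    by (rule card_degenerate_closed_walks[OF finV sym bip' l])
  also have "(\<Sum>v\<in>?V. ?W 2 v v * ?W (2 * (l - 1)) v v)
    = (\<Sum>v\<in>X. ?W 2 v v * ?W (2 * (l - 1)) v v) + (\<Sum>v\<in>Y. ?W 2 v v * ?W (2 * (l - 1)) v v)"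
    using fin disj by (rule sum.union_disjoint)
  also have "\<dots> \<le> (\<Sum>v\<in>X. Dx * ?W (2 * (l - 1)) v v) + (\<Sum>v\<in>Y. Dy * ?W (2 * (l - 1)) v v)"
    using DxW DyW by (intro add_mono sum_mono mult_right_mono walks_nonneg) auto
  also have "\<dots> = Dx * TX (l - 1) + Dy * TY (l - 1)"
    by (simp add: TX_def TY_def sum_distrib_left)
  also have "\<dots> \<le> Dx * (card X powr (1 / l) * s ^ (l - 1)) + Dy * (card Y powr (1 / l) * s ^ (l - 1))"
    using TX' TY' D0 by (intro add_mono mult_left_mono) auto
  finally have "real (card ?B) \<le> (2 * real l)\<^sup>2 * (Dx * (card X powr (1 / l) * s ^ (l - 1)) + Dy * (card Y powr (1 / l) * s ^ (l - 1)))"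
    using l by (simp add: mult_left_mono)
  also have "\<dots> = (8 * (real l)\<^sup>2 * (Dx * card X powr (1 / l) + Dy * card Y powr (1 / l))) * s ^ (l - 1) / 2"
    by (simp add: power2_eq_square algebra_simps)
  also have "\<dots> \<le> Q * s ^ (l - 1) / 2"
    using large s0 by (intro divide_right_mono mult_right_mono) (simp_all add: Q_def)
  also have "\<dots> \<le> s * s ^ (l - 1) / 2" using Qs s0 by (intro divide_right_mono mult_right_mono) auto
  also have "s * s ^ (l - 1) = T" using l sT by (cases l) auto
  finally have B: "real (card ?B) \<le> T / 2" .
  have "T = real (card ?C)"
    unfolding card_closed_walks[OF finV] T_def TX_def TY_def using fin disj by (simp add: sum.union_disjoint)
  also have "?C = ?B \<union> ?G" by auto
  also have "real (card (?B \<union> ?G)) \<le> real (card ?B) + real (card ?G)"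
    using card_Un_le[of ?B ?G] by linarith
  finally show ?thesis using B QT by (simp add: Q_def)
qed

section \<open>Regular bipartite subgraphs\<close>

text \<open>Greedy cut: a new vertex joins the side opposite to most of its neighbours so far, so at
  least half of its edges to them cross.\<close>

lemma large_cut_exists:
  assumes "finite V" "E \<subseteq> nsets V 2"
  shows "\<exists>X\<subseteq>V. card E \<le> 2 * card {e \<in> E. card (e \<inter> X) = 1}"
  using assms
proof (induction V arbitrary: E rule: finite_induct)
  case empty
  then show ?case by (auto simp: nsets_empty_iff)
next
  case (insert v V)
  have finE: "finite E" using insert.prems insert.hyps finite_imp_finite_nsets finite_subset by (metis finite_insert)
  let ?E0 = "{e \<in> E. v \<notin> e}" and ?N = "{e \<in> E. v \<in> e}"
  have "?E0 \<subseteq> nsets V 2" using insert.prems by (auto simp: nsets_def)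
  then obtain X where X: "X \<subseteq> V" "card ?E0 \<le> 2 * card {e \<in> ?E0. card (e \<inter> X) = 1}"
    using insert.IH by blast
  let ?N1 = "{e \<in> ?N. e \<inter> X \<noteq> {}}" and ?N2 = "{e \<in> ?N. e \<inter> X = {}}"
  let ?c = "\<lambda>X. {e \<in> E. card (e \<inter> X) = 1}"
  have vX: "v \<notin> X" using X insert.hyps by auto
  have E: "card E = card ?E0 + (card ?N1 + card ?N2)"
  proof -
    have eq: "E = ?E0 \<union> (?N1 \<union> ?N2)" by blast
    have "card (?E0 \<union> (?N1 \<union> ?N2)) = card ?E0 + card (?N1 \<union> ?N2)"
      by (rule card_Un_disjoint) (use finE in auto)
    moreover have "card (?N1 \<union> ?N2) = card ?N1 + card ?N2"
      by (rule card_Un_disjoint) (use finE in auto)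
    ultimately show ?thesis using arg_cong[OF eq, of card] by linarith
  qed
  have Nform: "\<exists>u. e = {v, u} \<and> u \<noteq> v" if "e \<in> ?N" for e
    using that insert.prems by (auto elim!: nsets2_E dest!: subsetD)
  show ?case
  proof (cases "card ?N1 \<ge> card ?N2")
    case True
    have "card {e \<in> ?E0. card (e \<inter> X) = 1} + card ?N1 = card ({e \<in> ?E0. card (e \<inter> X) = 1} \<union> ?N1)"
      by (rule card_Un_disjoint[symmetric]) (use finE in auto)
    also have "\<dots> \<le> card (?c X)"
    proof (rule card_mono)
      have "card (e \<inter> X) = 1" if e: "e \<in> ?N1" for e
      proof -
        obtain u where u: "e = {v, u}" using Nform e by blast
        then have "e \<inter> X = {u}" using e vX by auto
        then show ?thesis by simp
      qed
      then show "{e \<in> ?E0. card (e \<inter> X) = 1} \<union> ?N1 \<subseteq> ?c X" by auto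
    qed (use finE in auto)
    finally show ?thesis using True E X by (intro exI[of _ X]) auto
  next
    case False
    have "card {e \<in> ?E0. card (e \<inter> X) = 1} + card ?N2 = card ({e \<in> ?E0. card (e \<inter> X) = 1} \<union> ?N2)"
      by (rule card_Un_disjoint[symmetric]) (use finE in auto)
    also have "\<dots> \<le> card (?c (insert v X))"
    proof (rule card_mono)
      have "card (e \<inter> insert v X) = 1" if e: "e \<in> ?N2" for e
      proof -
        have "e \<inter> insert v X = {v}" using e by auto
        then show ?thesis by simp
      qed
      then show "{e \<in> ?E0. card (e \<inter> X) = 1} \<union> ?N2 \<subseteq> ?c (insert v X)" by auto
    qed (use finE in auto)
    finally show ?thesis using False E X by (intro exI[of _ "insert v X"]) auto
  qed
qed

definition edge_sum :: "('a \<Rightarrow> 'b \<Rightarrow> bool) \<Rightarrow> 'a set \<Rightarrow> 'b set \<Rightarrow> real" where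
  "edge_sum f X Y = (\<Sum>x\<in>X. \<Sum>y\<in>Y. of_bool (f x y))"

lemma edge_sum_swap: "edge_sum f X Y = edge_sum (\<lambda>y x. f x y) Y X"
  unfolding edge_sum_def by (rule sum.swap)

lemma edge_sum_nonneg: "edge_sum f X Y \<ge> 0"
  by (auto simp: edge_sum_def intro!: sum_nonneg)

lemma edge_sum_mono: "X \<subseteq> X' \<Longrightarrow> finite X' \<Longrightarrow> edge_sum f X Y \<le> edge_sum f X' Y"
  unfolding edge_sum_def by (intro sum_mono2) (auto intro!: sum_nonneg)

lemma edge_sum_minus: "S \<subseteq> X \<Longrightarrow> finite X \<Longrightarrow> edge_sum f (X - S) Y = edge_sum f X Y - edge_sum f S Y"
  unfolding edge_sum_def by (rule sum_diff)

text \<open>At most card X / K vertices have degree above K times the average, and maximality says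
  that a set of relative size \<sigma> carries at most a fraction \<sigma> powr c of the
  edges.\<close>

lemma edge_sum_high_degree:
  fixes K c :: real
  assumes fin: "finite X" "finite Y" and ne: "X \<noteq> {}" "Y \<noteq> {}" and K: "K > 0" "c \<ge> 0"
    and max: "\<And>S. S \<subseteq> X \<Longrightarrow> S \<noteq> {} \<Longrightarrow>
      edge_sum f S Y / (card S * card Y) powr c \<le> edge_sum f X Y / (card X * card Y) powr c"
  shows "edge_sum f {x\<in>X. real (card {y\<in>Y. f x y}) > K * edge_sum f X Y / card X} Y \<le> edge_sum f X Y * (1 / K) powr c"
proof -
  let ?e = "edge_sum f X Y"
  let ?S = "{x\<in>X. real (card {y\<in>Y. f x y}) > K * ?e / card X}"
  have a: "real (card X) > 0" and b: "real (card Y) > 0" using fin ne by (auto simp: card_gt_0_iff)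
  have finS: "finite ?S" using fin by auto
  have "real (card ?S) * (K * ?e / card X) = (\<Sum>x\<in>?S. K * ?e / card X)" by simp
  also have "\<dots> \<le> (\<Sum>x\<in>?S. real (card {y\<in>Y. f x y}))" by (intro sum_mono) auto
  also have "\<dots> = edge_sum f ?S Y" using fin by (simp add: edge_sum_def Int_def)
  also have "\<dots> \<le> ?e" using fin by (intro edge_sum_mono) auto
  finally have le: "real (card ?S) * (K * ?e / card X) \<le> ?e" .
  show ?thesis
  proof (cases "?e = 0 \<or> ?S = {}")
    case True
    have "edge_sum f ?S Y \<le> 0"
    proof (cases "?S = {}")
      case True
      show ?thesis unfolding True by (simp add: edge_sum_def)
    next
      case False
      then have "?e = 0" using True by blast
      moreover have "edge_sum f ?S Y \<le> ?e" using fin by (intro edge_sum_mono) auto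
      ultimately show ?thesis by linarith
    qed
    also have "0 \<le> ?e * (1 / K) powr c" using edge_sum_nonneg[of f X Y] by simp
    finally show ?thesis .
  next
    case False
    then have e: "?e > 0" using edge_sum_nonneg[of f X Y] by auto
    have "?e * (real (card ?S) * K / card X) \<le> ?e * 1" using le by (simp add: mult_ac)
    then have "real (card ?S) * K / card X \<le> 1" using e by (simp only: mult_le_cancel_left_pos)
    then have ratio: "real (card ?S) / card X \<le> 1 / K" using K a by (simp add: field_simps)
    have s: "real (card ?S) > 0" using False finS by (simp only: of_nat_0_less_iff card_gt_0_iff) simp
    have "edge_sum f ?S Y \<le> ?e / (card X * card Y) powr c * (card ?S * card Y) powr c"
      using max[of ?S] False s b by (simp add: pos_divide_le_eq)
    also have "\<dots> = ?e * (real (card ?S) / card X) powr c"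
      using a b s by (simp add: powr_mult powr_divide)
    also have "\<dots> \<le> ?e * (1 / K) powr c"
      using ratio e K by (intro mult_left_mono powr_mono2) auto
    finally show ?thesis .
  qed
qed

text \<open>
  A pair \<open>(X, Y)\<close> maximising \<open>e(X, Y) / (|X| |Y|)\<^sup>c\<close> has no sets of few vertices covering many edges, so
  dropping its vertices of degree above \<open>K\<close> times the average is harmless.  This regularisation
  costs only a constant factor.
\<close>

lemma regular_subgraph:
  fixes K c :: real
  assumes fin: "finite X0" "finite Y0" and ne: "X0 \<noteq> {}" "Y0 \<noteq> {}" and K: "K > 0" "c \<ge> 0" "(1 / K) powr c \<le> 1 / 4"
  obtains X Y where "X \<subseteq> X0" "Y \<subseteq> Y0" "X \<noteq> {}" "Y \<noteq> {}"
    "edge_sum f X0 Y0 / (card X0 * card Y0) powr c \<le> edge_sum f X Y / (card X * card Y) powr c"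
    "edge_sum f {x\<in>X. real (card {y\<in>Y. f x y}) \<le> K * edge_sum f X Y / card X}
       {y\<in>Y. real (card {x\<in>X. f x y}) \<le> K * edge_sum f X Y / card Y} \<ge> edge_sum f X Y / 2"
proof -
  let ?Z = "(Pow X0 - {{}}) \<times> (Pow Y0 - {{}})"
  define F where "F p = edge_sum f (fst p) (snd p) / (card (fst p) * card (snd p)) powr c" for p
  have Z: "finite ?Z" "(X0, Y0) \<in> ?Z" using fin ne by auto
  then have "Max (F ` ?Z) \<in> F ` ?Z" by (intro Max_in) auto
  then obtain p where p: "p \<in> ?Z" and pF: "Max (F ` ?Z) = F p" by (rule imageE) blast
  have pmax: "F q \<le> F p" if "q \<in> ?Z" for q
    unfolding pF[symmetric] using Z that by (intro Max_ge) auto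
  obtain X Y where XY: "p = (X, Y)" by fastforce
  have X: "X \<subseteq> X0" "X \<noteq> {}" and Y: "Y \<subseteq> Y0" "Y \<noteq> {}" using p XY by auto
  have finXY: "finite X" "finite Y" using X Y fin finite_subset by auto
  let ?e = "edge_sum f X Y"
  define LX where "LX = {x\<in>X. real (card {y\<in>Y. f x y}) \<le> K * ?e / card X}"
  define LY where "LY = {y\<in>Y. real (card {x\<in>X. f x y}) \<le> K * ?e / card Y}"
  \<comment> \<open>Each side loses at most a quarter of the edges. The loss in Y is measured
    against all of X, so the losses simply add and half of the edges remain.\<close>
  have hX: "edge_sum f (X - LX) Y \<le> ?e / 4"
  proof -
    have "X - LX = {x\<in>X. real (card {y\<in>Y. f x y}) > K * ?e / card X}" by (auto simp: LX_def)
    moreover have "edge_sum f {x\<in>X. real (card {y\<in>Y. f x y}) > K * ?e / card X} Y \<le> ?e * (1 / K) powr c"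
    proof (rule edge_sum_high_degree[OF finXY X(2) Y(2) K(1,2)])
      fix S assume "S \<subseteq> X" "S \<noteq> {}"
      then show "edge_sum f S Y / (card S * card Y) powr c \<le> ?e / (card X * card Y) powr c"
        using pmax[of "(S, Y)"] X Y XY by (auto simp: F_def)
    qed
    moreover have "?e * (1 / K) powr c \<le> ?e * (1 / 4)" using K edge_sum_nonneg by (intro mult_left_mono) auto
    ultimately show ?thesis by simp
  qed
  have hY: "edge_sum f X (Y - LY) \<le> ?e / 4"
  proof -
    let ?g = "\<lambda>y x. f x y"
    have "Y - LY = {y\<in>Y. real (card {x\<in>X. f x y}) > K * edge_sum ?g Y X / card Y}"
      by (auto simp: LY_def edge_sum_swap[of f X Y])
    moreover have "edge_sum ?g {y\<in>Y. real (card {x\<in>X. f x y}) > K * edge_sum ?g Y X / card Y} X \<le> edge_sum ?g Y X * (1 / K) powr c"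
    proof (rule edge_sum_high_degree[OF finXY(2,1) Y(2) X(2) K(1,2)])
      fix S assume "S \<subseteq> Y" "S \<noteq> {}"
      then show "edge_sum ?g S X / (card S * card X) powr c \<le> edge_sum ?g Y X / (card Y * card X) powr c"
        using pmax[of "(X, S)"] X Y XY by (auto simp: F_def edge_sum_swap[of f X] mult.commute)
    qed
    moreover have "?e * (1 / K) powr c \<le> ?e * (1 / 4)" using K edge_sum_nonneg by (intro mult_left_mono) auto
    ultimately show ?thesis by (simp add: edge_sum_swap[of f X])
  qed
  have sub: "LX \<subseteq> X" "LY \<subseteq> Y" by (auto simp: LX_def LY_def)
  have "edge_sum f LX Y = edge_sum f X Y - edge_sum f (X - LX) Y"
    using edge_sum_minus[of "X - LX" X f Y] sub finXY by (simp add: double_diff)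
  moreover have "edge_sum f LX LY = edge_sum f LX Y - edge_sum f LX (Y - LY)"
    using edge_sum_minus[of "Y - LY" Y "\<lambda>y x. f x y" LX] sub finXY
    by (simp add: double_diff edge_sum_swap[of f LX])
  moreover have "edge_sum f LX (Y - LY) \<le> edge_sum f X (Y - LY)" using sub finXY by (intro edge_sum_mono) auto
  ultimately have "edge_sum f LX LY \<ge> ?e / 2" using hX hY by linarith
  then show ?thesis
    using that[of X Y] X Y pmax[of "(X0, Y0)"] XY ne by (auto simp: F_def LX_def LY_def)
qed

section \<open>Supersaturation of even cycles\<close>

lemma cut_le_edge_sum:
  assumes fin: "finite V" and X: "X \<subseteq> V" and E: "E \<subseteq> nsets V 2"
  shows "real (card {e \<in> E. card (e \<inter> X) = 1}) \<le> edge_sum (\<lambda>u v. {u, v} \<in> E) X (V - X)"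
proof -
  let ?P = "{(x, y) \<in> X \<times> (V - X). {x, y} \<in> E}"
  have finX: "finite X" "finite (V - X)" using fin X finite_subset by auto
  have finP: "finite ?P" by (rule finite_subset[of _ "X \<times> (V - X)"]) (use finX in auto)
  have "{e \<in> E. card (e \<inter> X) = 1} \<subseteq> (\<lambda>(x, y). {x, y}) ` ?P"
  proof
    fix e assume e: "e \<in> {e \<in> E. card (e \<inter> X) = 1}"
    then obtain x y where xy: "e = {x, y}" "x \<in> V" "y \<in> V" "x \<noteq> y" using E by (blast elim: nsets2_E)
    obtain z where z: "e \<inter> X = {z}" using e by (auto simp: card_1_singleton_iff)
    have "z \<in> {x, y}" "z \<in> X" "\<not> (x \<in> X \<and> y \<in> X)" using z xy by auto
    then have "(z = x \<and> y \<notin> X) \<or> (z = y \<and> x \<notin> X)" by auto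
    then show "e \<in> (\<lambda>(x, y). {x, y}) ` ?P"
    proof
      assume "z = x \<and> y \<notin> X"
      then have "(x, y) \<in> ?P" using xy z e by auto
      then show ?thesis using xy by force
    next
      assume "z = y \<and> x \<notin> X"
      then have "(y, x) \<in> ?P" using xy z e by (auto simp: insert_commute)
      then show ?thesis using xy by force
    qed
  qed
  then have "card {e \<in> E. card (e \<inter> X) = 1} \<le> card ?P"
    using finP by (meson card_image_le card_mono finite_imageI le_trans)
  also have "real (card ?P) = edge_sum (\<lambda>u v. {u, v} \<in> E) X (V - X)"
  proof -
    have "edge_sum (\<lambda>u v. {u, v} \<in> E) X (V - X) = (\<Sum>p\<in>X \<times> (V - X). of_bool ({fst p, snd p} \<in> E))"
      unfolding edge_sum_def by (simp add: sum.cartesian_product case_prod_unfold)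
    also have "\<dots> = real (card ((X \<times> (V - X)) \<inter> {p. {fst p, snd p} \<in> E}))"
      using finX by simp
    also have "(X \<times> (V - X)) \<inter> {p. {fst p, snd p} \<in> E} = ?P" by auto
    finally show ?thesis by simp
  qed
  finally show ?thesis by simp
qed

section \<open>Copies of cycles and their supersaturation\<close>

definition cycle_edges :: "nat \<Rightarrow> (nat \<Rightarrow> 'a) \<Rightarrow> 'a set set" where
  "cycle_edges m f = (\<lambda>i. {f i, f (Suc i mod m)}) ` {..<m}"

text \<open>Copies are edge sets rather than embeddings, because they become hyperedges over the
  vertex set E.\<close>

definition cycle_copies :: "'a set set \<Rightarrow> nat \<Rightarrow> 'a set set set" where
  "cycle_copies E m = {C. C \<subseteq> E \<and> (\<exists>f. inj_on f {..<m} \<and> C = cycle_edges m f)}"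

text \<open>A closed walk is determined by its first m vertices, which lie among the m vertices of
  its copy; hence at most m ^ m walks trace the same copy.\<close>

lemma card_closed_walks_le_cycle_copies:
  assumes m: "m \<ge> 1" and finE: "finite E"
  shows "card {xs \<in> closed_walks V (\<lambda>u v. {u, v} \<in> E) m. \<forall>i j. i < j \<and> j < m \<longrightarrow> xs ! i \<noteq> xs ! j}
    \<le> card (cycle_copies E m) * m ^ m"
    (is "card ?S \<le> _")
proof -
  define h where "h xs = cycle_edges m (\<lambda>i. xs ! i)" for xs :: "'a list"
  have fin: "finite (cycle_copies E m)"
    by (rule finite_subset[of _ "Pow E"]) (use finE in \<open>auto simp: cycle_copies_def\<close>)
  have props: "length xs = Suc m \<and> xs ! m = xs ! 0 \<and> (\<forall>i<m. {xs ! i, xs ! Suc i} \<in> E) \<and> inj_on (\<lambda>i. xs ! i) {..<m}"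
    if "xs \<in> ?S" for xs
    using that by (auto simp: closed_walks_def walk_lists_def inj_on_def) (metis nat_neq_iff)
  have h: "h xs \<in> cycle_copies E m" if "xs \<in> ?S" for xs
  proof -
    have "{xs ! i, xs ! (Suc i mod m)} \<in> E" if "i < m" for i
      using props[OF \<open>xs \<in> ?S\<close>] that by (cases "Suc i = m") auto
    then show ?thesis using props[OF that] by (auto simp: h_def cycle_copies_def cycle_edges_def)
  qed
  have fibre: "finite {xs \<in> ?S. h xs = C} \<and> card {xs \<in> ?S. h xs = C} \<le> m ^ m" if C: "C \<in> cycle_copies E m" for C
  proof -
    obtain f where f: "inj_on f {..<m}" "C = cycle_edges m f" using C by (auto simp: cycle_copies_def)
    have U: "\<Union>(cycle_edges m g) = g ` {..<m}" for g :: "nat \<Rightarrow> 'a"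
    proof -
      have "Suc i mod m < m" for i using m by simp
      then show ?thesis by (fastforce simp: cycle_edges_def)
    qed
    then have UC: "finite (\<Union>C)" "card (\<Union>C) = m" using f by (simp_all add: card_image)
    let ?L = "{ys. set ys \<subseteq> \<Union>C \<and> length ys = m}"
    have img: "take m ` {xs \<in> ?S. h xs = C} \<subseteq> ?L"
    proof (rule image_subsetI)
      fix xs assume xs: "xs \<in> {xs \<in> ?S. h xs = C}"
      then have len: "length xs = Suc m" using props[of xs] by auto
      have "set (take m xs) = (\<lambda>i. xs ! i) ` {..<m}" using nth_image[of m xs] len by (simp add: lessThan_atLeast0)
      also have "\<dots> = \<Union>C" using xs U[of "\<lambda>i. xs ! i"] by (simp add: h_def)
      finally show "take m xs \<in> ?L" using len by simp
    qed
    have inj: "inj_on (take m) {xs \<in> ?S. h xs = C}"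
    proof (rule inj_onI)
      fix xs ys assume "xs \<in> {xs \<in> ?S. h xs = C}" "ys \<in> {xs \<in> ?S. h xs = C}" and eq: "take m xs = take m ys"
      then have p: "length xs = Suc m" "xs ! m = xs ! 0" "length ys = Suc m" "ys ! m = ys ! 0"
        using props[of xs] props[of ys] by auto
      have lt: "xs ! i = ys ! i" if "i < m" for i using arg_cong[OF eq, of "\<lambda>l. l ! i"] that by simp
      show "xs = ys"
      proof (rule nth_equalityI)
        fix i assume "i < length xs"
        then consider "i < m" | "i = m" using p by linarith
        then show "xs ! i = ys ! i" using lt[of i] lt[of 0] p m by cases auto
      qed (use p in simp)
    qed
    have L: "finite ?L" "card ?L = m ^ m"
      using UC finite_lists_length_eq[of "\<Union>C" m] card_lists_length_eq[of "\<Union>C" m] by simp_all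
    show ?thesis using inj_on_finite[OF inj img L(1)] card_inj_on_le[OF inj img L(1)] L(2) by simp
  qed
  have eqS: "?S = (\<Union>C\<in>cycle_copies E m. {xs \<in> ?S. h xs = C})" using h by blast
  have "card ?S = card (\<Union>C\<in>cycle_copies E m. {xs \<in> ?S. h xs = C})" by (rule arg_cong[OF eqS])
  also have "\<dots> \<le> (\<Sum>C\<in>cycle_copies E m. card {xs \<in> ?S. h xs = C})" by (rule card_UN_le[OF fin])
  also have "\<dots> \<le> (\<Sum>C\<in>cycle_copies E m. m ^ m)" using fibre by (intro sum_mono) auto
  finally show ?thesis by simp
qed

text \<open>For the pair of sides a, b chosen by \<open>regular_subgraph\<close>, maximality with
  exponent c = 1 / l gives e >= N / 2 * (a b / m^2) powr c. The powers 1 / l of the sides match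
  those in the degree condition of \<open>bipartite_cycle_count\<close>, and as c <= 1 / 2 the
  density e / sqrt (a b) is still at least N / (2 m).\<close>

theorem even_cycle_supersaturation:
  assumes l: "l \<ge> 2" and fin: "finite V" "V \<noteq> {}" and E: "E \<subseteq> nsets V 2"
    and dense: "128 * (real l)\<^sup>2 * 4 ^ l * real (card V) powr (1 + 1 / l) \<le> real (card E)"
  shows "(real (card E) / (4 * real (card V))) ^ (2 * l) / (2 * (2 * real l) ^ (2 * l)) \<le> real (card (cycle_copies E (2 * l)))"
proof -
  define c where "c = 1 / real l"
  \<comment> \<open>Chosen to make (1 / K) powr c = 1 / 4 in
    \<open>regular_subgraph\<close>.\<close>
  define K :: real where "K = 4 ^ l"
  define m where "m = real (card V)"
  define N where "N = real (card E)"
  let ?f = "\<lambda>u v. {u, v} \<in> E"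
  have finE: "finite E" using E fin finite_imp_finite_nsets finite_subset by metis
  have m: "m \<ge> 1" using fin by (simp add: m_def Suc_le_eq card_gt_0_iff)
  have c: "c > 0" "c \<le> 1 / 2" using l by (auto simp: c_def)
  have K: "K > 0" "(1 / K) powr c \<le> 1 / 4"
  proof -
    have "(1 / K) powr c = (1 / 4 :: real)"
      using l by (simp add: K_def c_def powr_divide powr_powr flip: powr_realpow)
    then show "(1 / K) powr c \<le> 1 / 4" by simp
  qed (simp add: K_def)
  have N: "N \<ge> 128 * (real l)\<^sup>2 * K * m powr (1 + c)" using dense by (simp add: N_def K_def m_def c_def)
  have N0: "N > 0"
  proof -
    have "0 < 128 * (real l)\<^sup>2 * K * m powr (1 + c)" using l K m by simp
    then show ?thesis using N by linarith
  qed
  obtain X0 where X0: "X0 \<subseteq> V" "card E \<le> 2 * card {e \<in> E. card (e \<inter> X0) = 1}"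
    using large_cut_exists[OF fin(1) E] by blast
  let ?Y0 = "V - X0"
  have "N \<le> 2 * real (card {e \<in> E. card (e \<inter> X0) = 1})" using X0 by (simp add: N_def)
  then have e0: "N / 2 \<le> edge_sum ?f X0 ?Y0" using cut_le_edge_sum[OF fin(1) X0(1) E] by linarith
  have "edge_sum ?f X0 ?Y0 \<noteq> 0" using e0 N0 by linarith
  then have ne0: "X0 \<noteq> {}" "?Y0 \<noteq> {}" unfolding edge_sum_def by (rule_tac [!] notI) simp_all
  have fin0: "finite X0" "finite ?Y0" using X0 fin finite_subset by auto
  obtain X Y where XY: "X \<subseteq> X0" "Y \<subseteq> ?Y0" "X \<noteq> {}" "Y \<noteq> {}"
    and F: "edge_sum ?f X0 ?Y0 / (card X0 * card ?Y0) powr c \<le> edge_sum ?f X Y / (card X * card Y) powr c"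
    and half: "edge_sum ?f {x\<in>X. real (card {y\<in>Y. ?f x y}) \<le> K * edge_sum ?f X Y / card X}
       {y\<in>Y. real (card {x\<in>X. ?f x y}) \<le> K * edge_sum ?f X Y / card Y} \<ge> edge_sum ?f X Y / 2"
    by (rule regular_subgraph[OF fin0 ne0 K(1) less_imp_le[OF c(1)] K(2)])
  define a where "a = real (card X)"
  define b where "b = real (card Y)"
  define e where "e = edge_sum ?f X Y"
  define LX where "LX = {x\<in>X. real (card {y\<in>Y. ?f x y}) \<le> K * e / a}"
  define LY where "LY = {y\<in>Y. real (card {x\<in>X. ?f x y}) \<le> K * e / b}"
  \<comment> \<open>Vertices of high degree lose their edges but stay in X and Y, so that degrees
    are still compared with the sizes a and b.\<close>
  define P where "P u v \<longleftrightarrow> {u, v} \<in> E \<and> ((u \<in> LX \<and> v \<in> LY) \<or> (u \<in> LY \<and> v \<in> LX))" for u v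
  define e' where "e' = edge_sum ?f LX LY"
  have finXY: "finite X" "finite Y"
    using finite_subset[OF XY(1) fin0(1)] finite_subset[OF XY(2) fin0(2)] by auto
  have disj: "X \<inter> Y = {}" using XY by auto
  have XV: "X \<subseteq> V" and YV: "Y \<subseteq> V" using XY X0 by auto
  have a: "1 \<le> a" "a \<le> m" and b: "1 \<le> b" "b \<le> m"
    using finXY XY card_mono[OF fin(1), OF XV] card_mono[OF fin(1), OF YV]
    by (simp_all add: a_def b_def m_def Suc_le_eq card_gt_0_iff)
  have e'e: "e / 2 \<le> e'" using half by (simp add: e_def e'_def LX_def LY_def a_def b_def)
  have ab: "a * b \<le> m\<^sup>2" using a b m by (auto simp: power2_eq_square intro!: mult_mono)
  have e: "e \<ge> N / 2 * (a * b) powr c * m powr (- 2 * c)"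
  proof -
    have "real (card X0 * card ?Y0) \<le> m\<^sup>2"
      using card_mono[OF fin(1), of X0] card_mono[OF fin(1), of ?Y0] X0
      by (auto simp: m_def power2_eq_square simp flip: of_nat_mult intro!: mult_mono)
    moreover have pos: "0 < real (card X0 * card ?Y0)" using fin0 ne0 by (simp add: card_gt_0_iff)
    ultimately have le: "real (card X0 * card ?Y0) powr c \<le> (m\<^sup>2) powr c"
      using c by (intro powr_mono2) auto
    have "0 < real (card X0 * card ?Y0) powr c" unfolding powr_gt_zero using pos by linarith
    then have "N / 2 / (m\<^sup>2) powr c \<le> edge_sum ?f X0 ?Y0 / (card X0 * card ?Y0) powr c"
      using e0 N0 le by (intro frac_le) auto
    also have "\<dots> \<le> e / (a * b) powr c" using F by (simp add: e_def a_def b_def)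
    finally have "N / 2 / (m\<^sup>2) powr c * (a * b) powr c \<le> e" using a b by (simp add: pos_le_divide_eq)
    moreover have "(m\<^sup>2) powr c = m powr (2 * c)" using m by (simp add: powr_powr flip: powr_numeral)
    ultimately show ?thesis using m by (simp add: powr_minus field_simps)
  qed
  have e0': "e > 0"
  proof -
    have "0 < N / 2 * (a * b) powr c * m powr (- 2 * c)" using N0 a b m by simp
    then show ?thesis using e by linarith
  qed
  have key: "64 * (real l)\<^sup>2 * K * ((a * b) powr c * m powr (1 - c)) \<le> e"
  proof -
    have "64 * (real l)\<^sup>2 * K * ((a * b) powr c * m powr (1 - c))
       = (128 * (real l)\<^sup>2 * K * m powr (1 + c)) / 2 * (a * b) powr c * m powr (- 2 * c)"
      using m by (simp flip: powr_add)
    also have "\<dots> \<le> N / 2 * (a * b) powr c * m powr (- 2 * c)"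
      using N by (intro mult_right_mono divide_right_mono) auto
    finally show ?thesis using e by linarith
  qed
  \<comment> \<open>One inequality for both summands of the degree condition, p being the side in
    question. Each summand takes e^2 / (8 a b), and two of them make (e / 2)^2 / (a b).\<close>
  have side: "8 * (real l)\<^sup>2 * (K * e / p * p powr c) \<le> e\<^sup>2 / (8 * (a * b))"
    if "(p = a \<and> q = b) \<or> (p = b \<and> q = a)" for p q
  proof -
    have pq: "1 \<le> p" "1 \<le> q" "q \<le> m" "a * b = p * q" using that a b by auto
    have "q powr (1 - c) \<le> m powr (1 - c)" using pq c by (intro powr_mono2) auto
    then have "p powr c * (q powr c * q powr (1 - c)) \<le> p powr c * (q powr c * m powr (1 - c))"
      by (intro mult_left_mono) auto
    then have "p powr c * q \<le> (a * b) powr c * m powr (1 - c)"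
      using pq by (simp add: powr_mult mult_ac flip: powr_add)
    then have "64 * (real l)\<^sup>2 * K * (p powr c * q) \<le> 64 * (real l)\<^sup>2 * K * ((a * b) powr c * m powr (1 - c))"
      using K by (intro mult_left_mono) auto
    with key have "64 * (real l)\<^sup>2 * K * (p powr c * q) \<le> e" by linarith
    then have "e * (64 * (real l)\<^sup>2 * K * (p powr c * q)) \<le> e * e" using e0' by (intro mult_left_mono) auto
    then show ?thesis using pq by (simp add: field_simps power2_eq_square)
  qed
  have e'XY: "(\<Sum>x\<in>X. \<Sum>y\<in>Y. (of_bool (P x y) :: real)) = e'"
  proof -
    have "(\<Sum>x\<in>X. \<Sum>y\<in>Y. (of_bool (P x y) :: real)) = (\<Sum>x\<in>LX. \<Sum>y\<in>LY. of_bool (?f x y))"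
    proof (rule sum.mono_neutral_cong_right[OF finXY(1)])
      show "\<forall>x\<in>X - LX. (\<Sum>y\<in>Y. (of_bool (P x y) :: real)) = 0"
      proof
        fix x assume x: "x \<in> X - LX"
        then have "\<not> P x y" for y using disj by (auto simp: P_def LY_def)
        then show "(\<Sum>y\<in>Y. (of_bool (P x y) :: real)) = 0" by simp
      qed
      fix x assume "x \<in> LX"
      then show "(\<Sum>y\<in>Y. (of_bool (P x y) :: real)) = (\<Sum>y\<in>LY. of_bool (?f x y))"
        using disj finXY by (intro sum.mono_neutral_cong_right) (auto simp: P_def LX_def LY_def)
    qed (auto simp: LX_def)
    then show ?thesis by (simp add: e'_def edge_sum_def)
  qed
  have cnt: "(e'\<^sup>2 / (a * b)) ^ l / 2 \<le> real (card {xs \<in> closed_walks (X \<union> Y) P (2 * l). \<forall>i j. i < j \<and> j < 2 * l \<longrightarrow> xs ! i \<noteq> xs ! j})"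
    unfolding a_def b_def e'XY[symmetric] of_nat_mult[symmetric]
  proof (rule bipartite_cycle_count[OF finXY disj XY(3,4) _ _ l, where Dx = "K * e / a" and Dy = "K * e / b"])
    show "symp P" by (auto simp: symp_def P_def insert_commute)
    show "(u \<in> X \<and> v \<in> Y) \<or> (u \<in> Y \<and> v \<in> X)" if "P u v" for u v using that by (auto simp: P_def LX_def LY_def)
    have Ke: "0 \<le> K * e / a" "0 \<le> K * e / b" using K e0' a b by auto
    show "real (card {y \<in> Y. P x y}) \<le> K * e / a" if "x \<in> X" for x
    proof (cases "x \<in> LX")
      case True
      have "card {y \<in> Y. P x y} \<le> card {y \<in> Y. ?f x y}" using finXY by (intro card_mono) (auto simp: P_def)
      then show ?thesis using True by (simp add: LX_def)
    next
      case False
      then have emp: "{y \<in> Y. P x y} = {}" using that disj by (auto simp: P_def LX_def LY_def)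
      show ?thesis unfolding emp using Ke by simp
    qed
    show "real (card {x \<in> X. P x y}) \<le> K * e / b" if "y \<in> Y" for y
    proof (cases "y \<in> LY")
      case True
      have "card {x \<in> X. P x y} \<le> card {x \<in> X. ?f x y}" using finXY by (intro card_mono) (auto simp: P_def)
      then show ?thesis using True by (simp add: LY_def)
    next
      case False
      then have emp: "{x \<in> X. P x y} = {}" using that disj by (auto simp: P_def LX_def LY_def)
      show ?thesis unfolding emp using Ke by simp
    qed
    have "8 * (real l)\<^sup>2 * (K * e / a * a powr c + K * e / b * b powr c) \<le> e\<^sup>2 / (8 * (a * b)) + e\<^sup>2 / (8 * (a * b))"
      unfolding ring_distribs using side[of a b] side[of b a] by (intro add_mono) auto
    also have "\<dots> = (e / 2)\<^sup>2 / (a * b)" by (simp add: power2_eq_square)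
    also have "\<dots> \<le> e'\<^sup>2 / (a * b)" using e'e e0' a b by (intro divide_right_mono power_mono) auto
    finally show "8 * (real l)\<^sup>2 * (K * e / a * card X powr (1 / l) + K * e / b * card Y powr (1 / l))
       \<le> (\<Sum>x\<in>X. \<Sum>y\<in>Y. (of_bool (P x y) :: real))\<^sup>2 / (card X * card Y)"
      unfolding e'XY by (simp add: a_def b_def c_def)
  qed
  \<comment> \<open>The exponent c - 1 / 2 is at most 0, so replacing a b by the larger m^2 only
    lowers the bound.\<close>
  have dens: "(N / (4 * m))\<^sup>2 \<le> e'\<^sup>2 / (a * b)"
  proof -
    have "(m\<^sup>2) powr (c - 1 / 2) = m powr (2 * (c - 1 / 2))"
      using m by (simp add: powr_powr flip: powr_numeral)
    then have "(m\<^sup>2) powr (c - 1 / 2) * m powr (- 2 * c) = m powr (- 1)"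
      by (simp only: flip: powr_add) (simp add: algebra_simps)
    moreover have "m powr (- 1) = 1 / m" using m powr_minus_divide[of m 1] by simp
    ultimately have "N / 2 / m = N / 2 * (m\<^sup>2) powr (c - 1 / 2) * m powr (- 2 * c)"
      by (simp only: mult.assoc) simp
    also have "\<dots> \<le> N / 2 * (a * b) powr (c - 1 / 2) * m powr (- 2 * c)"
      using N0 c ab a b by (intro mult_right_mono mult_left_mono powr_mono2') auto
    also have "\<dots> = N / 2 * (a * b) powr c * m powr (- 2 * c) / sqrt (a * b)"
      using a b by (simp add: powr_diff powr_half_sqrt)
    also have "\<dots> \<le> e / sqrt (a * b)" using e a b by (intro divide_right_mono) auto
    finally have "N / (4 * m) \<le> (e / 2) / sqrt (a * b)" by simp
    also have "\<dots> \<le> e' / sqrt (a * b)" using e'e a b by (intro divide_right_mono) auto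
    finally have "(N / (4 * m))\<^sup>2 \<le> (e' / sqrt (a * b))\<^sup>2" using N0 m by (intro power_mono) auto
    then show ?thesis using a b by (simp add: power_divide)
  qed
  let ?good = "\<lambda>V P. {xs \<in> closed_walks V P (2 * l). \<forall>i j. i < j \<and> j < 2 * l \<longrightarrow> xs ! i \<noteq> xs ! j}"
  have "(N / (4 * m)) ^ (2 * l) / 2 \<le> (e'\<^sup>2 / (a * b)) ^ l / 2"
    using dens unfolding power_mult by (intro divide_right_mono power_mono) auto
  also note cnt
  also have "real (card (?good (X \<union> Y) P)) \<le> real (card (?good V ?f))"
  proof (intro of_nat_mono card_mono)
    show "?good (X \<union> Y) P \<subseteq> ?good V ?f"
    proof -
      have V: "X \<union> Y \<subseteq> V" using XV YV by simp
      have "walk_lists (X \<union> Y) P t u v \<subseteq> walk_lists V ?f t u v" for t u v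
        using order_trans[OF _ V] unfolding walk_lists_def P_def by blast
      then show ?thesis using V unfolding closed_walks_def by blast
    qed
    show "finite (?good V ?f)" using finite_closed_walks[OF fin(1)] by simp
  qed
  also have "\<dots> \<le> real (card (cycle_copies E (2 * l)) * (2 * l) ^ (2 * l))"
    using l finE by (intro of_nat_mono card_closed_walks_le_cycle_copies) auto
  finally have "(N / (4 * m)) ^ (2 * l) / 2 \<le> real (card (cycle_copies E (2 * l))) * (2 * real l) ^ (2 * l)" by simp
  moreover have "(2 * real l) ^ (2 * l) > 0" using l by simp
  ultimately have "(N / (4 * m)) ^ (2 * l) / 2 / (2 * real l) ^ (2 * l) \<le> real (card (cycle_copies E (2 * l)))"
    by (simp only: pos_divide_le_eq)
  then show ?thesis by (simp only: N_def m_def divide_divide_eq_left)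
qed

section \<open>Hypergraph containers\<close>

text \<open>For s = {} this is the total weight. Natural weights let a family of greatest total
  weight exist as soon as the totals are bounded.\<close>

definition wdeg :: "'a set \<Rightarrow> ('a set \<Rightarrow> nat) \<Rightarrow> 'a set \<Rightarrow> nat" where
  "wdeg V w s = (\<Sum>e\<in>{e\<in>Pow V. s \<subseteq> e}. w e)"

lemma wdeg_sum_le:
  assumes fin: "finite V" and A: "A \<subseteq> Pow V" and Q: "finite Q" "\<And>e. e \<in> A \<Longrightarrow> w e > 0 \<Longrightarrow> \<exists>s\<in>Q. s \<subseteq> e"
  shows "(\<Sum>e\<in>A. w e) \<le> (\<Sum>s\<in>Q. wdeg V w s)"
proof -
  have finA: "finite A" using fin A finite_subset by blast
  have "(\<Sum>e\<in>A. w e) \<le> (\<Sum>e\<in>A. \<Sum>s\<in>{s\<in>Q. s \<subseteq> e}. w e)"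
  proof (rule sum_mono)
    fix e assume e: "e \<in> A"
    show "w e \<le> (\<Sum>s\<in>{s\<in>Q. s \<subseteq> e}. w e)"
    proof (cases "w e > 0")
      case True
      then obtain s where "s \<in> {s\<in>Q. s \<subseteq> e}" using Q(2)[OF e] by blast
      then have "card {s\<in>Q. s \<subseteq> e} > 0" using Q(1) card_gt_0_iff by fastforce
      then show ?thesis by simp
    qed simp
  qed
  also have "\<dots> = (\<Sum>s\<in>Q. \<Sum>e\<in>{e\<in>A. s \<subseteq> e}. w e)"
    using finA Q(1) by (rule sum.swap_restrict)
  also have "\<dots> \<le> (\<Sum>s\<in>Q. wdeg V w s)"
    unfolding wdeg_def using fin A by (intro sum_mono sum_mono2) auto
  finally show ?thesis .
qed

lemma wdeg_empty_le:
  assumes fin: "finite V" and ne: "w {} = 0" and A: "A \<subseteq> V" and B: "\<And>v. v \<in> A \<Longrightarrow> real (wdeg V w {v}) \<le> B"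
  shows "real (\<Sum>e\<in>Pow A. w e) \<le> real (card A) * B"
proof -
  have finA: "finite A" using fin A finite_subset by auto
  have "(\<Sum>e\<in>Pow A. w e) \<le> (\<Sum>s\<in>(\<lambda>v. {v}) ` A. wdeg V w s)"
  proof (rule wdeg_sum_le[OF fin])
    fix e assume "e \<in> Pow A" "w e > 0"
    then obtain v where "v \<in> e" "v \<in> A" using ne by (cases "e = {}") auto
    then show "\<exists>s\<in>(\<lambda>v. {v}) ` A. s \<subseteq> e" by auto
  qed (use A finA in auto)
  also have "\<dots> = (\<Sum>v\<in>A. wdeg V w {v})" by (simp add: sum.reindex)
  finally have "real (\<Sum>e\<in>Pow A. w e) \<le> (\<Sum>v\<in>A. real (wdeg V w {v}))" by (simp flip: of_nat_sum)
  also have "\<dots> \<le> (\<Sum>v\<in>A. B)" using B by (rule sum_mono)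
  finally show ?thesis by simp
qed

text \<open>Multiplicity of f in the union of the links of the vertices of S. Leaving out the v in f
  lowers the uniformity by exactly one.\<close>

definition links :: "('a set \<Rightarrow> nat) \<Rightarrow> 'a set \<Rightarrow> 'a set \<Rightarrow> nat" where
  "links w S f = (\<Sum>v\<in>S - f. w (insert v f))"

text \<open>Weight functions play the role of multihypergraphs.\<close>

definition link_family :: "'a set \<Rightarrow> ('a set \<Rightarrow> nat) \<Rightarrow> (nat \<Rightarrow> real) \<Rightarrow> 'a set \<Rightarrow> ('a set \<Rightarrow> nat) \<Rightarrow> bool" where
  "link_family V w D S w' \<longleftrightarrow>
     (\<forall>f. w' f \<le> links w S f \<and> (w' f > 0 \<longrightarrow> f \<subseteq> V)) \<and>
     (\<forall>s. s \<noteq> {} \<longrightarrow> s \<subseteq> V \<longrightarrow> real (wdeg V w' s) \<le> D (card s))"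

lemma maximal_link_family_exists:
  assumes "finite V" "\<And>i. D i \<ge> 0"
  shows "\<exists>w'. link_family V w D S w' \<and> (\<forall>w''. link_family V w D S w'' \<longrightarrow> wdeg V w'' {} \<le> wdeg V w' {})"
proof (rule ex_has_greatest_nat)
  show "link_family V w D S (\<lambda>f. 0)" using assms by (simp add: link_family_def wdeg_def)
  show "\<forall>w'. link_family V w D S w' \<longrightarrow> wdeg V w' {} < Suc (\<Sum>e\<in>Pow V. links w S e)"
    by (auto simp: link_family_def wdeg_def Pow_def less_Suc_eq_le intro!: sum_mono)
qed

text \<open>A fixed choice that depends on S alone for given V, w, D, so that a container can be
  recomputed from its fingerprint.\<close>

definition max_links :: "'a set \<Rightarrow> ('a set \<Rightarrow> nat) \<Rightarrow> (nat \<Rightarrow> real) \<Rightarrow> 'a set \<Rightarrow> 'a set \<Rightarrow> nat" where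
  "max_links V w D S = (SOME w'. link_family V w D S w' \<and>
     (\<forall>w''. link_family V w D S w'' \<longrightarrow> wdeg V w'' {} \<le> wdeg V w' {}))"

lemma max_links:
  assumes "finite V" "\<And>i. D i \<ge> 0"
  shows "link_family V w D S (max_links V w D S)"
    and "link_family V w D S w'' \<Longrightarrow> wdeg V w'' {} \<le> wdeg V (max_links V w D S) {}"
  using someI_ex[OF maximal_link_family_exists[of V D w S, OF assms]] unfolding max_links_def by blast+

lemma sum_links_insert:
  assumes "v \<notin> S" "finite S"
  shows "links w (insert v S) f = links w S f + (if v \<in> f then 0 else w (insert v f))"
proof (cases "v \<in> f")
  case True
  then have "insert v S - f = S - f" by auto
  then show ?thesis using True by (simp add: links_def)
next
  case False
  then have "insert v S - f = insert v (S - f)" by auto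
  then show ?thesis using False assms by (simp add: links_def)
qed

text \<open>Call s saturated if it exceeds half of its degree bound. The edges e through v for which
  e - {v} has no nonempty saturated part could all be added, with v removed, to the family of S. By
  maximality for \<open>insert v S\<close>, their weight is at most the gain beta.\<close>

lemma unsaturated_links_small:
  fixes B t beta :: real
  assumes fin: "finite V" and S: "S \<subseteq> V" and v: "v \<in> V" "v \<notin> S" and B: "B > 0" and t: "t > 0"
    and deg: "\<And>s. s \<noteq> {} \<Longrightarrow> s \<subseteq> V \<Longrightarrow> real (wdeg V w s) \<le> B * t ^ (card s - 1)"
  defines "D \<equiv> \<lambda>i. 2 * t * B * t ^ (i - 1)"
  defines "W \<equiv> max_links V w D"
  assumes small: "real (wdeg V (W (insert v S)) {}) \<le> real (wdeg V (W S) {}) + beta"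
  shows "real (\<Sum>e\<in>{e\<in>Pow V. v \<in> e \<and> (\<forall>s\<subseteq>e - {v}. s \<noteq> {} \<longrightarrow> 2 * real (wdeg V (W S) s) \<le> D (card s))}. w e) \<le> beta"
proof -
  define U where "U = {e\<in>Pow V. v \<in> e \<and> (\<forall>s\<subseteq>e - {v}. s \<noteq> {} \<longrightarrow> 2 * real (wdeg V (W S) s) \<le> D (card s))}"
  define U' where "U' = {f\<in>Pow V. v \<notin> f \<and> insert v f \<in> U}"
  define w'' where "w'' f = W S f + (if f \<in> U' then w (insert v f) else 0)" for f
  have D0: "D i \<ge> 0" for i using B t by (simp add: D_def)
  have finS: "finite S" using fin S finite_subset by auto
  have WS: "link_family V w D S (W S)" unfolding W_def by (rule max_links[OF fin D0])
  have finU': "finite U'" using fin by (simp add: U'_def)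
  have wdeg'': "wdeg V w'' s = wdeg V (W S) s + (\<Sum>f\<in>{f\<in>U'. s \<subseteq> f}. w (insert v f))" for s
  proof -
    have "wdeg V w'' s = wdeg V (W S) s + (\<Sum>f\<in>{f\<in>Pow V. s \<subseteq> f}. if f \<in> U' then w (insert v f) else 0)"
      by (simp add: wdeg_def w''_def sum.distrib)
    also have "(\<Sum>f\<in>{f\<in>Pow V. s \<subseteq> f}. if f \<in> U' then w (insert v f) else 0) = (\<Sum>f\<in>{f\<in>U'. s \<subseteq> f}. w (insert v f))"
      using fin by (intro sum.mono_neutral_cong_right) (auto simp: U'_def)
    finally show ?thesis .
  qed
  have inj: "inj_on (insert v) {f\<in>U'. s \<subseteq> f}" for s
    by (auto simp: inj_on_def U'_def)
  have "link_family V w D (insert v S) w''"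
    unfolding link_family_def
  proof (intro conjI allI impI)
    fix f
    show "w'' f \<le> links w (insert v S) f"
    proof -
      have "W S f \<le> links w S f" using WS by (simp add: link_family_def)
      then show ?thesis unfolding sum_links_insert[OF v(2) finS] w''_def U'_def by auto
    qed
    show "f \<subseteq> V" if "0 < w'' f"
      using that WS by (auto simp: w''_def link_family_def U'_def split: if_splits)
  next
    fix s assume s: "s \<noteq> {}" "s \<subseteq> V"
    show "real (wdeg V w'' s) \<le> D (card s)"
    proof (cases "{f\<in>U'. s \<subseteq> f} = {}")
      case True
      then show ?thesis using WS s unfolding wdeg'' True link_family_def by simp
    next
      case False
      then obtain f where f: "f \<in> U'" "s \<subseteq> f" by auto
      then have vs: "v \<notin> s" and "s \<subseteq> insert v f - {v}" by (auto simp: U'_def)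
      then have unsat: "2 * real (wdeg V (W S) s) \<le> D (card s)" using f s by (auto simp: U'_def U_def)
      have fins: "finite s" using s fin finite_subset by auto
      have "(\<Sum>f\<in>{f\<in>U'. s \<subseteq> f}. w (insert v f)) = (\<Sum>e\<in>insert v ` {f\<in>U'. s \<subseteq> f}. w e)"
        using inj by (simp add: sum.reindex)
      also have "\<dots> \<le> wdeg V w (insert v s)"
        unfolding wdeg_def using fin v by (intro sum_mono2) (auto simp: U'_def)
      finally have "real (\<Sum>f\<in>{f\<in>U'. s \<subseteq> f}. w (insert v f)) \<le> real (wdeg V w (insert v s))" by (rule of_nat_mono)
      also have "\<dots> \<le> B * t ^ (card (insert v s) - 1)" using v s by (intro deg) auto
      also have "\<dots> = B * t ^ card s" using vs fins by simp
      \<comment> \<open>The factor 2 in D is used here: new edges over s come from edges of w over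
        \<open>insert v s\<close>, so they fill at most half of the bound, and an unsaturated s has
        the other half free.\<close>
      also have "\<dots> = D (card s) / 2" using s fins by (cases "card s") (auto simp: D_def)
      finally show ?thesis unfolding wdeg'' of_nat_add using unsat by simp
    qed
  qed
  then have "wdeg V w'' {} \<le> wdeg V (W (insert v S)) {}"
    unfolding W_def by (rule max_links(2)[OF fin D0])
  then have "real (wdeg V w'' {}) \<le> real (wdeg V (W S) {}) + beta" using small by linarith
  then have "real (\<Sum>f\<in>U'. w (insert v f)) \<le> beta" unfolding wdeg'' by simp
  moreover have "(\<Sum>f\<in>U'. w (insert v f)) = (\<Sum>e\<in>U. w e)"
  proof -
    have "insert v ` U' = U"
    proof (intro equalityI subsetI)
      fix e assume "e \<in> U"
      then have "e = insert v (e - {v})" "e - {v} \<in> U'" by (auto simp: U'_def U_def insert_absorb)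
      then show "e \<in> insert v ` U'" by blast
    qed (auto simp: U'_def)
    then show ?thesis using inj[of "{}"] sum.reindex[of "insert v" U' w] by simp
  qed
  ultimately show ?thesis by (simp add: U_def)
qed

section \<open>Containers for hypergraphs of bounded codegree\<close>

lemma sum_UN_le:
  fixes w :: "'b \<Rightarrow> nat"
  assumes "finite I" "\<And>i. i \<in> I \<Longrightarrow> finite (U i)"
  shows "(\<Sum>e\<in>(\<Union>i\<in>I. U i). w e) \<le> (\<Sum>i\<in>I. \<Sum>e\<in>U i. w e)"
  using assms
proof (induction I rule: finite_induct)
  case (insert i I)
  then have "(\<Sum>e\<in>U i \<union> (\<Union>i\<in>I. U i). w e) \<le> (\<Sum>e\<in>U i. w e) + (\<Sum>e\<in>(\<Union>i\<in>I. U i). w e)"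
    by (simp add: sum_Un_nat)
  also have "(\<Sum>e\<in>(\<Union>i\<in>I. U i). w e) \<le> (\<Sum>i\<in>I. \<Sum>e\<in>U i. w e)" using insert by auto
  finally show ?case using insert.hyps by simp
qed simp

text \<open>The codegree condition of the container method: B bounds the degrees, and each further
  vertex of s gains a factor t, the density of the fingerprints.\<close>

definition bounded_weight :: "'a set \<Rightarrow> nat \<Rightarrow> real \<Rightarrow> real \<Rightarrow> ('a set \<Rightarrow> nat) \<Rightarrow> bool" where
  "bounded_weight V j B t w \<longleftrightarrow> (\<forall>e. w e > 0 \<longrightarrow> e \<subseteq> V \<and> card e = j) \<and>
     (\<forall>s. s \<noteq> {} \<longrightarrow> s \<subseteq> V \<longrightarrow> real (wdeg V w s) \<le> B * t ^ (card s - 1))"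

lemma bounded_weight_total:
  assumes "finite V" "bounded_weight V j B t w" "j \<ge> 1"
  shows "real (wdeg V w {}) \<le> real (card V) * B"
proof -
  have "w {} = 0" using assms(2,3) unfolding bounded_weight_def by (metis card.empty gr0I not_one_le_zero)
  moreover have "real (wdeg V w {v}) \<le> B" if "v \<in> V" for v
    using assms(2) that unfolding bounded_weight_def by (metis (no_types) card_Suc_eq_finite diff_Suc_1 empty_iff
        empty_subsetI finite.emptyI insert_not_empty insert_subset is_singletonI is_singleton_altdef mult.right_neutral power_0 diff_self_eq_0)
  moreover have "wdeg V w {} = (\<Sum>e\<in>Pow V. w e)" by (simp add: wdeg_def Pow_def)
  ultimately show ?thesis using wdeg_empty_le[of V w V B] assms(1) by simp
qed

text \<open>\<open>Cn S\<close> collects the vertices whose addition to S gains at most beta. If the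
  link family of S is light, it has few saturated sets, so little weight of w lies over them; the
  remaining weight at vertices of \<open>Cn S\<close> is small as well. Hence edges avoiding
  \<open>Cn S\<close> keep weight c B N / 2, where N = card V, which by the degree bound takes c N /
  2 vertices. If the link family is not light, it is dense enough for another round in uniformity
  j.\<close>

lemma container_step:
  fixes B t c :: real
  assumes fin: "finite V" and B: "B > 0" and t: "t > 0" and c: "c > 0" and j: "j \<ge> 1"
    and w: "bounded_weight V (Suc j) B t w" and dense: "c * B * real (card V) \<le> real (wdeg V w {})"
  obtains W Cn where
    "\<And>S. S \<subseteq> V \<Longrightarrow> bounded_weight V j (2 * t * B) t (W S)"
    "\<And>S f. S \<subseteq> V \<Longrightarrow> W S f > 0 \<Longrightarrow> \<exists>v\<in>S. w (insert v f) > 0"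
    "\<And>S. S \<subseteq> V \<Longrightarrow> Cn S \<subseteq> V"
    "\<And>S. S \<subseteq> V \<Longrightarrow> c / 2 ^ (j + 3) * (2 * t * B) * real (card V) \<le> real (wdeg V (W S) {})
       \<or> real (card (Cn S)) \<le> (1 - c / 2) * real (card V)"
    "\<And>I. I \<subseteq> V \<Longrightarrow> \<exists>S\<subseteq>I. real (card S) \<le> 8 / c * t * real (card V) \<and> I \<subseteq> S \<union> Cn S"
proof -
  let ?N = "real (card V)"
  define D where "D i = 2 * t * B * t ^ (i - 1)" for i :: nat
  define W where "W = max_links V w D"
  \<comment> \<open>Summed over \<open>Cn S\<close> this is at most a quarter of c * B * card V.
    Edges over saturated sets take another quarter, and half is left for the edges avoiding
    \<open>Cn S\<close>.\<close>
  define beta where "beta = c * B / 4"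
  define Cn where "Cn S = {v \<in> V - S. real (wdeg V (W (insert v S)) {}) \<le> real (wdeg V (W S) {}) + beta}" for S
  have D0: "D i \<ge> 0" for i using B t by (simp add: D_def)
  have beta: "beta > 0" using B c by (simp add: beta_def)
  have wsupp: "e \<subseteq> V \<and> card e = Suc j" if "w e > 0" for e using w that by (auto simp: bounded_weight_def)
  have wdegB: "real (wdeg V w s) \<le> B * t ^ (card s - 1)" if "s \<noteq> {}" "s \<subseteq> V" for s
    using w that by (auto simp: bounded_weight_def)
  have lf: "link_family V w D S (W S)" for S unfolding W_def by (rule max_links(1)[OF fin D0])
  have Wlink: "\<exists>v\<in>S - f. w (insert v f) > 0" if "W S f > 0" for S f
  proof -
    have "links w S f > 0" using lf[of S] that unfolding link_family_def by (meson less_le_trans)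
    then show ?thesis unfolding links_def by (metis gr0I sum.neutral less_numeral_extra(3))
  qed
  have bw: "bounded_weight V j (2 * t * B) t (W S)" if S: "S \<subseteq> V" for S
    unfolding bounded_weight_def
  proof (intro conjI allI impI)
    fix f assume f: "W S f > 0"
    then obtain v where v: "v \<in> S - f" "w (insert v f) > 0" using Wlink by blast
    then have "insert v f \<subseteq> V" "card (insert v f) = Suc j" using wsupp by auto
    then show "f \<subseteq> V" "card f = j" using v fin finite_subset[of f V] by auto
  next
    fix s assume "s \<noteq> {}" "s \<subseteq> V"
    then show "real (wdeg V (W S) s) \<le> 2 * t * B * t ^ (card s - 1)"
      using lf[of S] by (auto simp: link_family_def D_def)
  qed
  have small: "real (card (Cn S)) \<le> (1 - c / 2) * ?N"
    if S: "S \<subseteq> V" and few: "real (wdeg V (W S) {}) < c / 2 ^ (j + 3) * (2 * t * B) * ?N" for S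
  proof -
    define sat where "sat = {s\<in>Pow V. s \<noteq> {} \<and> 2 * real (wdeg V (W S) s) > D (card s)}"
    define A where "A = {e\<in>Pow V. \<exists>s\<in>sat. s \<subseteq> e}"
    define U where "U v = {e\<in>Pow V. v \<in> e \<and> (\<forall>s\<subseteq>e - {v}. s \<noteq> {} \<longrightarrow> 2 * real (wdeg V (W S) s) \<le> D (card s))}" for v
    have finsat: "finite sat" using fin by (simp add: sat_def)
    have CnV: "Cn S \<subseteq> V" by (auto simp: Cn_def)
    have finCn: "finite (Cn S)" using fin CnV finite_subset by auto
    have Usmall: "real (\<Sum>e\<in>U v. w e) \<le> beta" if "v \<in> Cn S" for v
      using unsaturated_links_small[OF fin S _ _ B t wdegB, of v beta] that
      unfolding U_def D_def W_def Cn_def by (auto simp: D_def[abs_def])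
    have satw: "real (\<Sum>e\<in>A. w e) \<le> c * B * ?N / 4"
    proof -
      have "(\<Sum>e\<in>A. w e) \<le> (\<Sum>s\<in>sat. wdeg V w s)"
        using finsat by (intro wdeg_sum_le[OF fin]) (auto simp: A_def)
      then have "real (\<Sum>e\<in>A. w e) \<le> (\<Sum>s\<in>sat. real (wdeg V w s))" by (simp flip: of_nat_sum)
      \<comment> \<open>A saturated s has more than t * wdeg V w s of the links, while an edge of W
        S has only 2 ^ j subsets; so the weight of w over saturated sets is charged to the total of
        W S. The divisor 2 ^ (j + 3) of the density turns this into a quarter.\<close>
      also have "\<dots> \<le> (\<Sum>s\<in>sat. real (wdeg V (W S) s) / t)"
      proof (rule sum_mono)
        fix s assume s: "s \<in> sat"
        then have "real (wdeg V w s) \<le> B * t ^ (card s - 1)" by (intro wdegB) (auto simp: sat_def)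
        also have "\<dots> = D (card s) / (2 * t)" using t by (simp add: D_def)
        also have "\<dots> \<le> 2 * real (wdeg V (W S) s) / (2 * t)"
          using s t by (intro divide_right_mono) (auto simp: sat_def)
        finally show "real (wdeg V w s) \<le> real (wdeg V (W S) s) / t" by simp
      qed
      also have "\<dots> = real (\<Sum>s\<in>sat. wdeg V (W S) s) / t" by (simp add: sum_divide_distrib)
      also have "\<dots> \<le> real (2 ^ j * wdeg V (W S) {}) / t"
      proof (intro divide_right_mono of_nat_mono)
        have "(\<Sum>s\<in>sat. wdeg V (W S) s) = (\<Sum>e\<in>Pow V. \<Sum>s\<in>{s\<in>sat. s \<subseteq> e}. W S e)"
          unfolding wdeg_def by (rule sum.swap_restrict[OF finsat]) (use fin in simp)
        also have "\<dots> \<le> (\<Sum>e\<in>Pow V. 2 ^ j * W S e)"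
        proof (rule sum_mono)
          fix e assume e: "e \<in> Pow V"
          show "(\<Sum>s\<in>{s\<in>sat. s \<subseteq> e}. W S e) \<le> 2 ^ j * W S e"
          proof (cases "W S e > 0")
            case True
            then have "card e = j" "finite e" using bw[OF S] fin finite_subset[of e V] by (auto simp: bounded_weight_def)
            moreover have "card {s\<in>sat. s \<subseteq> e} \<le> card (Pow e)" using \<open>finite e\<close> by (intro card_mono) auto
            ultimately show ?thesis by (simp add: card_Pow)
          qed simp
        qed
        also have "\<dots> = 2 ^ j * wdeg V (W S) {}" by (simp add: wdeg_def sum_distrib_left Pow_def)
        finally show "(\<Sum>s\<in>sat. wdeg V (W S) s) \<le> 2 ^ j * wdeg V (W S) {}" .
      qed (use t in auto)
      also have "\<dots> \<le> 2 ^ j * (c / 2 ^ (j + 3) * (2 * t * B) * ?N) / t"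
        unfolding of_nat_mult of_nat_power of_nat_numeral
        using t by (intro divide_right_mono mult_left_mono less_imp_le[OF few]) auto
      also have "\<dots> = c * B * ?N / 4" using t by (simp add: power_add)
      finally show ?thesis .
    qed
    have "Pow V \<subseteq> Pow (V - Cn S) \<union> (A \<union> (\<Union>v\<in>Cn S. U v))"
    proof
      fix e assume e: "e \<in> Pow V"
      show "e \<in> Pow (V - Cn S) \<union> (A \<union> (\<Union>v\<in>Cn S. U v))"
      proof (cases "e \<subseteq> V - Cn S \<or> e \<in> A")
        case False
        then obtain v where v: "v \<in> e" "v \<in> Cn S" using e by auto
        have "2 * real (wdeg V (W S) s) \<le> D (card s)" if "s \<subseteq> e - {v}" "s \<noteq> {}" for s
        proof -
          have "s \<notin> sat" using that False e by (auto simp: A_def)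
          moreover have "s \<in> Pow V" using that e by auto
          ultimately show ?thesis using that by (auto simp: sat_def)
        qed
        then have "e \<in> U v" using e v by (auto simp: U_def)
        then show ?thesis using v by blast
      qed auto
    qed
    moreover have finU: "finite (U v)" for v using fin by (simp add: U_def)
    moreover have finA: "finite A" using fin by (simp add: A_def)
    ultimately have "(\<Sum>e\<in>Pow V. w e) \<le> (\<Sum>e\<in>Pow (V - Cn S) \<union> (A \<union> (\<Union>v\<in>Cn S. U v)). w e)"
      using fin finCn by (intro sum_mono2) auto
    also have "\<dots> \<le> (\<Sum>e\<in>Pow (V - Cn S). w e) + (\<Sum>e\<in>A \<union> (\<Union>v\<in>Cn S. U v). w e)"
      using fin finCn finU finA by (simp add: sum_Un_nat)
    also have "(\<Sum>e\<in>A \<union> (\<Union>v\<in>Cn S. U v). w e) \<le> (\<Sum>e\<in>A. w e) + (\<Sum>e\<in>(\<Union>v\<in>Cn S. U v). w e)"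
      using fin finCn finU finA by (simp add: sum_Un_nat)
    also have "(\<Sum>e\<in>(\<Union>v\<in>Cn S. U v). w e) \<le> (\<Sum>v\<in>Cn S. \<Sum>e\<in>U v. w e)"
      using finCn finU by (intro sum_UN_le) auto
    finally have "wdeg V w {} \<le> (\<Sum>e\<in>Pow (V - Cn S). w e) + ((\<Sum>e\<in>A. w e) + (\<Sum>v\<in>Cn S. \<Sum>e\<in>U v. w e))"
      by (simp add: wdeg_def Pow_def)
    then have "real (wdeg V w {}) \<le> real (\<Sum>e\<in>Pow (V - Cn S). w e) + (real (\<Sum>e\<in>A. w e) + (\<Sum>v\<in>Cn S. real (\<Sum>e\<in>U v. w e)))"
      by (simp flip: of_nat_sum of_nat_add)
    also have "(\<Sum>v\<in>Cn S. real (\<Sum>e\<in>U v. w e)) \<le> (\<Sum>v\<in>Cn S. beta)" using Usmall by (rule sum_mono)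
    also have "\<dots> \<le> ?N * beta"
      using beta card_mono[OF fin CnV] by simp
    also have "real (\<Sum>e\<in>Pow (V - Cn S). w e) \<le> real (card (V - Cn S)) * B"
    proof (rule wdeg_empty_le[OF fin])
      show "w {} = 0" using wsupp[of "{}"] by (cases "w {}") auto
      show "real (wdeg V w {v}) \<le> B" if "v \<in> V - Cn S" for v
        using wdegB[of "{v}"] that by simp
    qed auto
    finally have "c * B * ?N \<le> real (card (V - Cn S)) * B + (c * B * ?N / 4 + ?N * beta)"
      using dense satw by linarith
    then have "B * (c * ?N / 2) \<le> B * real (card (V - Cn S))" by (simp add: beta_def algebra_simps)
    then have "c * ?N / 2 \<le> real (card (V - Cn S))" using B by (simp only: mult_le_cancel_left_pos)
    moreover have "real (card (V - Cn S)) = ?N - real (card (Cn S))"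
      using card_Diff_subset[OF finCn CnV] card_mono[OF fin CnV] by (simp add: of_nat_diff)
    ultimately show ?thesis by (simp add: algebra_simps)
  qed
  have fingerprint: "\<exists>S\<subseteq>I. real (card S) \<le> 8 / c * t * ?N \<and> I \<subseteq> S \<union> Cn S" if I: "I \<subseteq> V" for I
  proof -
    \<comment> \<open>Comparing the maximiser with {} bounds its size; comparing it with
      \<open>insert v S\<close> puts every other v of I into \<open>Cn S\<close>.\<close>
    define F where "F S = real (wdeg V (W S) {}) - beta * real (card S)" for S
    have finI: "finite I" using I fin finite_subset by auto
    then have "Max (F ` Pow I) \<in> F ` Pow I" by (intro Max_in) auto
    then obtain S where S: "S \<subseteq> I" "Max (F ` Pow I) = F S" by (rule imageE) blast
    have max: "F S' \<le> F S" if "S' \<subseteq> I" for S'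
      unfolding S(2)[symmetric] using finI that by (intro Max_ge) auto
    have SV: "S \<subseteq> V" and finS: "finite S" using S I finI finite_subset by auto
    have "0 \<le> F {}" by (simp add: F_def)
    also have "\<dots> \<le> F S" by (rule max) simp
    finally have "beta * real (card S) \<le> real (wdeg V (W S) {})" by (simp add: F_def)
    also have "\<dots> \<le> ?N * (2 * t * B)" by (rule bounded_weight_total[OF fin bw[OF SV] j])
    finally have "B * (c * real (card S)) \<le> B * (8 * t * ?N)" by (simp add: beta_def algebra_simps)
    then have "c * real (card S) \<le> 8 * t * ?N" using B by (simp only: mult_le_cancel_left_pos)
    then have "real (card S) \<le> 8 / c * t * ?N" using c by (simp add: field_simps)
    moreover have "I \<subseteq> S \<union> Cn S"
    proof
      fix v assume v: "v \<in> I"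
      show "v \<in> S \<union> Cn S"
      proof (cases "v \<in> S")
        case False
        have "F (insert v S) \<le> F S" using v S by (intro max) auto
        then have "real (wdeg V (W (insert v S)) {}) \<le> real (wdeg V (W S) {}) + beta"
          using False finS by (simp add: F_def algebra_simps)
        then show ?thesis using v I False by (auto simp: Cn_def)
      qed simp
    qed
    ultimately show ?thesis using S by blast
  qed
  show ?thesis
  proof (rule that[of W Cn])
    show "\<exists>v\<in>S. w (insert v f) > 0" if "W S f > 0" for S f using Wlink[OF that] by blast
    show "c / 2 ^ (j + 3) * (2 * t * B) * ?N \<le> real (wdeg V (W S) {}) \<or> real (card (Cn S)) \<le> (1 - c / 2) * ?N"
      if "S \<subseteq> V" for S using small[OF that] by linarith
  qed (use bw fingerprint in \<open>auto simp: Cn_def\<close>)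
qed

text \<open>C is a separate argument because it is going to be \<open>cont Ss\<close>: the
  fingerprints alone, not I, must determine it. Disjointness turns the fingerprints into colour
  classes.\<close>

definition container_for :: "'a set \<Rightarrow> nat \<Rightarrow> real \<Rightarrow> real \<Rightarrow> 'a set \<Rightarrow> 'a set list \<Rightarrow> 'a set \<Rightarrow> bool" where
  "container_for V q a u I Ss C \<longleftrightarrow> length Ss = q \<and> sorted_wrt (\<lambda>S T. S \<inter> T = {}) Ss \<and>
     (\<forall>S\<in>set Ss. S \<subseteq> I \<and> real (card S) \<le> a) \<and> I \<subseteq> \<Union>(set Ss) \<union> C \<and> C \<subseteq> V \<and> real (card C) \<le> u"

text \<open>Induction on the uniformity. If the link family of the first fingerprint S is dense, I -
  S contains none of its edges, and the induction hypothesis applies with 2 t B for B, c / 2 ^ (j +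
  3) for c and the same t; otherwise \<open>Cn S\<close> is already small. In uniformity 1 the
  container omits the vertices of positive weight. Both \<epsilon> and K come from j and c
  only.\<close>

theorem hypergraph_containers:
  assumes "j \<ge> 1" "c > (0::real)"
  shows "\<exists>\<epsilon>>0. \<exists>K>0. \<forall>(V :: 'a set) w B t. finite V \<longrightarrow> B > 0 \<longrightarrow> t > 0 \<longrightarrow> bounded_weight V j B t w \<longrightarrow>
    c * B * real (card V) \<le> real (wdeg V w {}) \<longrightarrow>
    (\<exists>cont. \<forall>I\<subseteq>V. (\<forall>e. w e > 0 \<longrightarrow> \<not> e \<subseteq> I) \<longrightarrow>
      (\<exists>Ss. container_for V (j - 1) (K * t * real (card V)) ((1 - \<epsilon>) * real (card V)) I Ss (cont Ss)))"
  using assms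
proof (induction j arbitrary: c rule: nat_induct_at_least)
  case base
  have "\<exists>cont. \<forall>I\<subseteq>V. (\<forall>e. w e > 0 \<longrightarrow> \<not> e \<subseteq> I) \<longrightarrow>
      (\<exists>Ss. container_for V (1 - 1) (1 * t * real (card V)) ((1 - c) * real (card V)) I Ss (cont Ss))"
    if fin: "finite V" and B: "B > 0" and w: "bounded_weight V 1 B t w"
      and dense: "c * B * real (card V) \<le> real (wdeg V w {})" for V :: "'a set" and w B t
  proof -
    let ?A = "{v\<in>V. w {v} > 0}" and ?C = "{v\<in>V. w {v} = 0}"
    have supp: "e \<subseteq> V \<and> card e = 1" if "w e > 0" for e using w that by (auto simp: bounded_weight_def)
    have "wdeg V w {} = (\<Sum>e\<in>Pow V. w e)" by (simp add: wdeg_def Pow_def)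
    also have "\<dots> \<le> (\<Sum>e\<in>Pow ?A. w e)"
    proof -
      have w0: "w e = 0" if "e \<in> Pow V - Pow ?A" for e
      proof (rule ccontr)
        assume "w e \<noteq> 0"
        then obtain v where "e = {v}" "v \<in> V" "w {v} > 0" using supp[of e] by (auto simp: card_1_singleton_iff)
        then show False using that by auto
      qed
      have "finite (Pow V)" "Pow ?A \<subseteq> Pow V" using fin by auto
      then show ?thesis by (rule eq_refl[OF sum.mono_neutral_right]) (use w0 in blast)
    qed
    finally have "real (wdeg V w {}) \<le> real (\<Sum>e\<in>Pow ?A. w e)" by (rule of_nat_mono)
    also have "\<dots> \<le> real (card ?A) * B"
    proof (rule wdeg_empty_le[OF fin])
      show "w {} = 0" using supp[of "{}"] by (cases "w {}") auto
      show "real (wdeg V w {v}) \<le> B" if "v \<in> ?A" for v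
      proof -
        have "\<forall>s. s \<noteq> {} \<longrightarrow> s \<subseteq> V \<longrightarrow> real (wdeg V w s) \<le> B * t ^ (card s - 1)"
          using w unfolding bounded_weight_def by (rule conjunct2)
        from this[rule_format, of "{v}"] show ?thesis using that by simp
      qed
    qed auto
    finally have "B * (c * real (card V)) \<le> B * real (card ?A)" using dense by (simp add: mult_ac)
    then have "c * real (card V) \<le> real (card ?A)" using B by (simp only: mult_le_cancel_left_pos)
    moreover have "card V = card ?A + card ?C"
    proof -
      have "card (?A \<union> ?C) = card ?A + card ?C" by (rule card_Un_disjoint) (use fin in auto)
      moreover have "?A \<union> ?C = V" by auto
      ultimately show ?thesis by simp
    qed
    ultimately have C: "real (card ?C) \<le> (1 - c) * real (card V)" by (simp add: algebra_simps)
    have "container_for V (1 - 1) (1 * t * real (card V)) ((1 - c) * real (card V)) I [] ?C"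
      if "I \<subseteq> V" "\<forall>e. w e > 0 \<longrightarrow> \<not> e \<subseteq> I" for I
    proof -
      have "w {v} = 0" if "v \<in> I" for v using \<open>\<forall>e. w e > 0 \<longrightarrow> \<not> e \<subseteq> I\<close> that by (metis bot_nat_0.not_eq_extremum empty_subsetI insert_subset)
      then show ?thesis using that C by (auto simp: container_for_def)
    qed
    then show ?thesis by (intro exI[of _ "\<lambda>_. ?C"]) blast
  qed
  then show ?case using base by (intro exI[of _ c] conjI exI[of _ 1]) auto
next
  case (Suc j)
  have "c / 2 ^ (j + 3) > 0" using Suc.prems by simp
  from Suc.IH[OF this] obtain \<epsilon> K where \<epsilon>: "\<epsilon> > 0" and K: "K > 0" and
    IH: "\<forall>(V :: 'a set) w B t. finite V \<longrightarrow> B > 0 \<longrightarrow> t > 0 \<longrightarrow> bounded_weight V j B t w \<longrightarrow>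
      c / 2 ^ (j + 3) * B * real (card V) \<le> real (wdeg V w {}) \<longrightarrow>
      (\<exists>cont. \<forall>I\<subseteq>V. (\<forall>e. w e > 0 \<longrightarrow> \<not> e \<subseteq> I) \<longrightarrow>
      (\<exists>Ss. container_for V (j - 1) (K * t * real (card V)) ((1 - \<epsilon>) * real (card V)) I Ss (cont Ss)))"
    by (elim exE conjE)
  define \<epsilon>' where "\<epsilon>' = min \<epsilon> (c / 2)"
  define K' where "K' = max K (8 / c)"
  have "\<exists>cont. \<forall>I\<subseteq>V. (\<forall>e. w e > 0 \<longrightarrow> \<not> e \<subseteq> I) \<longrightarrow>
      (\<exists>Ss. container_for V j (K' * t * real (card V)) ((1 - \<epsilon>') * real (card V)) I Ss (cont Ss))"
    if fin: "finite V" and B: "B > 0" and t: "t > 0" and w: "bounded_weight V (Suc j) B t w"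
      and dense: "c * B * real (card V) \<le> real (wdeg V w {})" for V :: "'a set" and w B t
  proof -
    let ?N = "real (card V)"
    obtain W Cn where
      W: "\<And>S. S \<subseteq> V \<Longrightarrow> bounded_weight V j (2 * t * B) t (W S)" and
      Wl: "\<And>S f. S \<subseteq> V \<Longrightarrow> W S f > 0 \<Longrightarrow> \<exists>v\<in>S. w (insert v f) > 0" and
      CnV: "\<And>S. S \<subseteq> V \<Longrightarrow> Cn S \<subseteq> V" and
      dich: "\<And>S. S \<subseteq> V \<Longrightarrow> c / 2 ^ (j + 3) * (2 * t * B) * ?N \<le> real (wdeg V (W S) {})
       \<or> real (card (Cn S)) \<le> (1 - c / 2) * ?N" and
      fp: "\<And>I. I \<subseteq> V \<Longrightarrow> \<exists>S\<subseteq>I. real (card S) \<le> 8 / c * t * ?N \<and> I \<subseteq> S \<union> Cn S"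
      using container_step[OF fin B t Suc.prems Suc.hyps w dense] by blast
    define rich where "rich S \<longleftrightarrow> c / 2 ^ (j + 3) * (2 * t * B) * ?N \<le> real (wdeg V (W S) {})" for S
    have "\<exists>cont. \<forall>I\<subseteq>V. (\<forall>e. W S e > 0 \<longrightarrow> \<not> e \<subseteq> I) \<longrightarrow>
      (\<exists>Ss. container_for V (j - 1) (K * t * ?N) ((1 - \<epsilon>) * ?N) I Ss (cont Ss))" if "S \<subseteq> V" "rich S" for S
    proof -
      have "2 * t * B > 0" using B t by simp
      then show ?thesis
        using IH[THEN spec, THEN spec, THEN spec, THEN spec, THEN mp, THEN mp, THEN mp, THEN mp, THEN mp,
            OF fin _ t W[OF that(1)]] that(2) unfolding rich_def by blast
    qed
    then obtain cont where cont: "\<And>S I. S \<subseteq> V \<Longrightarrow> rich S \<Longrightarrow> I \<subseteq> V \<Longrightarrow> (\<forall>e. W S e > 0 \<longrightarrow> \<not> e \<subseteq> I) \<Longrightarrow>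
      \<exists>Ss. container_for V (j - 1) (K * t * ?N) ((1 - \<epsilon>) * ?N) I Ss (cont S Ss)" by metis
    \<comment> \<open>Whether the links are dense is decided by the first fingerprint, so the
      container remains a function of the list.\<close>
    define cont' where "cont' Ss = (if rich (hd Ss) then cont (hd Ss) (tl Ss) else Cn (hd Ss))" for Ss
    have "\<exists>Ss. container_for V j (K' * t * ?N) ((1 - \<epsilon>') * ?N) I Ss (cont' Ss)"
      if I: "I \<subseteq> V" and indep: "\<forall>e. w e > 0 \<longrightarrow> \<not> e \<subseteq> I" for I
    proof -
      obtain S where S: "S \<subseteq> I" "real (card S) \<le> 8 / c * t * ?N" "I \<subseteq> S \<union> Cn S" using fp[OF I] by blast
      have SV: "S \<subseteq> V" using S I by auto
      have "8 / c * t * ?N \<le> K' * t * ?N" using t by (intro mult_right_mono) (auto simp: K'_def)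
      then have Scard: "real (card S) \<le> K' * t * ?N" using S by linarith
      have KK: "K * t * ?N \<le> K' * t * ?N" using t by (intro mult_right_mono) (auto simp: K'_def)
      have ee: "(1 - \<epsilon>) * ?N \<le> (1 - \<epsilon>') * ?N" "(1 - c / 2) * ?N \<le> (1 - \<epsilon>') * ?N"
        by (intro mult_right_mono; auto simp: \<epsilon>'_def)+
      show ?thesis
      proof (cases "rich S")
        case True
        have "\<forall>e. W S e > 0 \<longrightarrow> \<not> e \<subseteq> I - S"
        proof (intro allI impI notI)
          fix e assume "W S e > 0" "e \<subseteq> I - S"
          then obtain v where "v \<in> S" "w (insert v e) > 0" "insert v e \<subseteq> I" using Wl[OF SV] S by blast
          then show False using indep by blast
        qed
        then obtain Ss where Ss: "container_for V (j - 1) (K * t * ?N) ((1 - \<epsilon>) * ?N) (I - S) Ss (cont S Ss)"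
          using cont[OF SV True, of "I - S"] I by blast
        have "container_for V j (K' * t * ?N) ((1 - \<epsilon>') * ?N) I (S # Ss) (cont' (S # Ss))"
          unfolding container_for_def
        proof (intro conjI)
          show "length (S # Ss) = j" using Ss Suc.hyps by (simp add: container_for_def)
          show "sorted_wrt (\<lambda>S T. S \<inter> T = {}) (S # Ss)" using Ss by (auto simp: container_for_def)
          show "\<forall>T\<in>set (S # Ss). T \<subseteq> I \<and> real (card T) \<le> K' * t * ?N"
          proof
            fix T assume "T \<in> set (S # Ss)"
            then consider "T = S" | "T \<subseteq> I - S" "real (card T) \<le> K * t * ?N"
              using Ss by (auto simp: container_for_def)
            then show "T \<subseteq> I \<and> real (card T) \<le> K' * t * ?N"
              using S Scard KK by cases auto
          qed
          show "I \<subseteq> \<Union>(set (S # Ss)) \<union> cont' (S # Ss)"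
            using Ss True by (auto simp: container_for_def cont'_def)
          show "cont' (S # Ss) \<subseteq> V" using Ss True by (simp add: container_for_def cont'_def)
          have "real (card (cont S Ss)) \<le> (1 - \<epsilon>) * ?N" using Ss by (simp add: container_for_def)
          then show "real (card (cont' (S # Ss))) \<le> (1 - \<epsilon>') * ?N" using ee(1) True by (simp add: cont'_def)
        qed
        then show ?thesis by blast
      next
        case False
        \<comment> \<open>Padding with empty fingerprints fixes the length at j, so that
          concatenated lists can later be cut by position.\<close>
        let ?Ss = "S # replicate (j - 1) {}"
        have "real (card (Cn S)) \<le> (1 - \<epsilon>') * ?N" using dich[OF SV] False ee by (auto simp: rich_def)
        moreover have "sorted_wrt (\<lambda>S T. S \<inter> T = {}) (replicate n ({} :: 'a set))" for n by (induction n) auto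
        moreover have "0 \<le> K' * t * ?N" using Scard by (meson of_nat_0_le_iff order_trans)
        ultimately have "container_for V j (K' * t * ?N) ((1 - \<epsilon>') * ?N) I ?Ss (cont' ?Ss)"
          using False Scard S CnV[OF SV] Suc.hyps unfolding container_for_def cont'_def by auto
        then show ?thesis by blast
      qed
    qed
    then show ?thesis by (intro exI[of _ cont']) blast
  qed
  moreover have "\<epsilon>' > 0" "K' > 0" using \<epsilon> K Suc.prems by (auto simp: \<epsilon>'_def K'_def)
  ultimately show ?case unfolding diff_Suc_1 by (intro exI[of _ \<epsilon>'] conjI exI[of _ K'] allI impI) auto
qed

section \<open>Cycle copies\<close>

lemma cycle_edges_nth_eq_iff:
  assumes m: "m \<ge> 3" and inj: "inj_on f {..<m}" and ij: "i < m" "j < m"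
    and eq: "{f i, f (Suc i mod m)} = {f j, f (Suc j mod m)}"
  shows "i = j"
proof (rule ccontr)
  assume ne: "i \<noteq> j"
  have lt: "Suc i mod m < m" "Suc j mod m < m" using m by auto
  have fne: "f i \<noteq> f j" using ne inj ij by (auto dest: inj_onD)
  have "f i = f (Suc j mod m)" "f j = f (Suc i mod m)" using eq fne by (auto simp: doubleton_eq_iff)
  then have "i = Suc j mod m" "j = Suc i mod m" using inj ij lt by (auto dest: inj_onD)
  moreover have "Suc k mod m = (if Suc k = m then 0 else Suc k)" if "k < m" for k using that by auto
  ultimately show False using ij m by (auto split: if_splits)
qed

lemma inj_on_cycle_edge:
  assumes "m \<ge> 3" "inj_on f {..<m}"
  shows "inj_on (\<lambda>i. {f i, f (Suc i mod m)}) {..<m}"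
  using cycle_edges_nth_eq_iff[OF assms] by (intro inj_onI) simp

lemma card_cycle_copy:
  assumes "C \<in> cycle_copies E m" "m \<ge> 3"
  shows "card C = m"
proof -
  obtain f where f: "inj_on f {..<m}" "C = cycle_edges m f" using assms by (auto simp: cycle_copies_def)
  show ?thesis unfolding f(2) cycle_edges_def card_image[OF inj_on_cycle_edge[OF assms(2) f(1)]] by simp
qed

lemma card_Union_cycle_copy:
  assumes "C \<in> cycle_copies E m" "m \<ge> 3"
  shows "card (\<Union>C) = m"
proof -
  obtain f where f: "inj_on f {..<m}" "C = cycle_edges m f" using assms by (auto simp: cycle_copies_def)
  have "Suc i mod m < m" for i using assms by simp
  then have "\<Union>C = f ` {..<m}" unfolding f cycle_edges_def by fastforce
  then show ?thesis using f by (simp add: card_image)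
qed

text \<open>A proper part of a cycle is a union of paths. With no more vertices than edges, its edge
  indices would be closed under successor modulo m and hence be all of them. The extra vertex is
  what makes such parts rare in a vertex sample.\<close>

lemma card_Union_cycle_part:
  assumes C: "C \<in> cycle_copies E m" and m: "m \<ge> 3" and s: "s \<subseteq> C" "s \<noteq> {}" "card s < m"
  shows "card s + 1 \<le> card (\<Union>s)"
proof (rule ccontr)
  assume less: "\<not> ?thesis"
  obtain f where f: "inj_on f {..<m}" "C = cycle_edges m f" using C by (auto simp: cycle_copies_def)
  let ?g = "\<lambda>i. {f i, f (Suc i mod m)}" and ?s = "\<lambda>i. Suc i mod m"
  define J where "J = {i\<in>{..<m}. ?g i \<in> s}"
  have Jm: "J \<subseteq> {..<m}" "finite J" by (auto simp: J_def)
  have sJ: "?s ` J \<subseteq> {..<m}" using m by auto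
  have sg: "s = ?g ` J" using s f by (auto simp: J_def cycle_edges_def)
  have cs: "card s = card J"
    unfolding sg using inj_on_cycle_edge[OF m f(1)] Jm by (intro card_image) (rule inj_on_subset)
  have "\<Union>s = f ` (J \<union> ?s ` J)" unfolding sg by auto
  moreover have "inj_on f (J \<union> ?s ` J)" using Jm sJ by (intro inj_on_subset[OF f(1)]) auto
  ultimately have "card (\<Union>s) = card (J \<union> ?s ` J)" by (simp add: card_image)
  then have "card (J \<union> ?s ` J) \<le> card J" using less cs by simp
  then have "J = J \<union> ?s ` J" using Jm by (intro card_seteq) auto
  then have closed: "?s i \<in> J" if "i \<in> J" for i using that by blast
  obtain j where j: "j \<in> J" using s sg by auto
  have "(j + t) mod m \<in> J" for t
  proof (induction t)
    case 0
    then show ?case using j Jm by auto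
  next
    case (Suc t)
    show ?case using closed[OF Suc] by (simp add: mod_Suc_eq)
  qed
  note cyc = this
  have "{..<m} \<subseteq> J"
  proof
    fix i assume i: "i \<in> {..<m}"
    have "j < m" using j Jm by auto
    then have "j + (i + m - j) = i + m" by simp
    then show "i \<in> J" using cyc[of "i + m - j"] i by simp
  qed
  then have "card J = m" using Jm by (metis card_lessThan subset_antisym)
  then show False using cs s by simp
qed

lemma cycle_copy_contains:
  assumes C: "C \<in> cycle_copies E m" and "C \<subseteq> I" and m: "m \<ge> 3"
  shows "contains_copy I (cycle_graph m)"
proof -
  obtain f where f: "inj_on f {..<m}" "C = cycle_edges m f" using C by (auto simp: cycle_copies_def)
  have lt: "Suc i mod m < m" for i using m by simp
  have "\<Union>(cycle_graph m) \<subseteq> {..<m}" using lt by (auto simp: cycle_graph_def)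
  then have "inj_on f (\<Union>(cycle_graph m))" by (rule inj_on_subset[OF f(1)])
  moreover have "f ` e \<in> I" if "e \<in> cycle_graph m" for e
  proof -
    obtain i where "e = {i, Suc i mod m}" "i < m" using \<open>e \<in> cycle_graph m\<close> by (auto simp: cycle_graph_def)
    then have "f ` e \<in> C" using f by (auto simp: cycle_edges_def)
    then show ?thesis using \<open>C \<subseteq> I\<close> by blast
  qed
  ultimately show ?thesis unfolding contains_copy_def by blast
qed

lemma cycle_copies_mono: "E \<subseteq> F \<Longrightarrow> cycle_copies E m \<subseteq> cycle_copies F m"
  by (auto simp: cycle_copies_def)

lemma finite_cycle_copies: "finite E \<Longrightarrow> finite (cycle_copies E m)"
  by (rule finite_subset[of _ "Pow E"]) (auto simp: cycle_copies_def)

section \<open>Sampling vertices\<close>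

lemma card_nsets_containing:
  assumes fin: "finite V" and U: "U \<subseteq> V" "card U \<le> r"
  shows "card {R \<in> nsets V r. U \<subseteq> R} = (card V - card U) choose (r - card U)"
proof -
  have finU: "finite U" using fin U finite_subset by auto
  have "bij_betw (\<lambda>R. R \<union> U) (nsets (V - U) (r - card U)) {R \<in> nsets V r. U \<subseteq> R}"
  proof (rule bij_betwI[where g = "\<lambda>R. R - U"])
    show "(\<lambda>R. R \<union> U) \<in> nsets (V - U) (r - card U) \<rightarrow> {R \<in> nsets V r. U \<subseteq> R}"
    proof
      fix R assume R: "R \<in> nsets (V - U) (r - card U)"
      then have "card (R \<union> U) = card R + card U" using finU by (intro card_Un_disjoint) (auto simp: nsets_def)
      then show "R \<union> U \<in> {R \<in> nsets V r. U \<subseteq> R}" using R U finU by (auto simp: nsets_def)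
    qed
    show "(\<lambda>R. R - U) \<in> {R \<in> nsets V r. U \<subseteq> R} \<rightarrow> nsets (V - U) (r - card U)"
      using finU by (auto simp: nsets_def card_Diff_subset)
  qed (auto simp: nsets_def)
  then have "card {R \<in> nsets V r. U \<subseteq> R} = card (nsets (V - U) (r - card U))" by (rule bij_betw_same_card[symmetric])
  also have "\<dots> = (card V - card U) choose (r - card U)" using finU U by (simp add: card_Diff_subset)
  finally show ?thesis .
qed

lemma binomial_shift_mult:
  assumes "v < r" "r \<le> n"
  shows "((n - Suc v) choose (r - Suc v)) * (n - v) = ((n - v) choose (r - v)) * (r - v)"
proof -
  have "n - v = Suc (n - Suc v)" "r - v = Suc (r - Suc v)" using assms by auto
  then show ?thesis using Suc_times_binomial[of "r - Suc v" "n - Suc v"] by (simp add: mult.commute)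
qed

text \<open>A uniform r-subset contains v given points with probability the product of (r - i) / (n
  - i) over i < v, and each factor is at most r / n.\<close>

lemma binomial_shift_le:
  assumes "v \<le> r" "r \<le> n"
  shows "((n - v) choose (r - v)) * n ^ v \<le> (n choose r) * r ^ v"
  using assms(1)
proof (induction v)
  case (Suc v)
  have "(r - v) * n \<le> r * (n - v)"
    using assms(2) Suc.prems by (simp add: diff_mult_distrib diff_mult_distrib2 diff_le_mono2)
  then have "((n - v) choose (r - v)) * ((r - v) * n) \<le> ((n - v) choose (r - v)) * (r * (n - v))"
    by (rule mult_le_mono2)
  then have "((n - Suc v) choose (r - Suc v)) * (n - v) * n \<le> ((n - v) choose (r - v)) * r * (n - v)"
    using binomial_shift_mult[of v r n] Suc.prems assms by (simp add: mult.assoc)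
  then have "(n - v) * (((n - Suc v) choose (r - Suc v)) * n) \<le> (n - v) * (((n - v) choose (r - v)) * r)"
    by (simp add: mult_ac)
  then have le: "((n - Suc v) choose (r - Suc v)) * n \<le> ((n - v) choose (r - v)) * r"
    using Suc.prems assms by simp
  have "((n - Suc v) choose (r - Suc v)) * n ^ Suc v = ((n - Suc v) choose (r - Suc v)) * n * n ^ v" by simp
  also have "\<dots> \<le> ((n - v) choose (r - v)) * r * n ^ v" using le by (rule mult_le_mono1)
  also have "\<dots> = ((n - v) choose (r - v)) * n ^ v * r" by simp
  also have "\<dots> \<le> (n choose r) * r ^ v * r" using Suc by (intro mult_le_mono1) auto
  finally show ?case by (simp add: mult_ac)
qed simp

lemma sample_upper:
  assumes fin: "finite V" "V \<noteq> {}" and U: "U \<subseteq> V" and r: "r \<le> card V"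
  shows "real (card {R \<in> nsets V r. U \<subseteq> R}) \<le> real (card V choose r) * (real r / real (card V)) ^ card U"
proof (cases "card U \<le> r")
  case True
  have n: "real (card V) > 0" using fin by (simp add: card_gt_0_iff)
  have "real (((card V - card U) choose (r - card U)) * card V ^ card U) \<le> real ((card V choose r) * r ^ card U)"
    using binomial_shift_le[OF True r] by (rule of_nat_mono)
  then show ?thesis unfolding card_nsets_containing[OF fin(1) U True]
    using n by (simp add: power_divide pos_le_divide_eq)
next
  case False
  have emp: "{R \<in> nsets V r. U \<subseteq> R} = {}"
  proof -
    have "card U \<le> card R" if "R \<in> nsets V r" "U \<subseteq> R" for R
      using that fin finite_subset[of R V] by (intro card_mono) (auto simp: nsets_def)
    then show ?thesis using False by (fastforce simp: nsets_def)
  qed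
  show ?thesis unfolding emp by simp
qed

text \<open>The probability is r (r - 1) / (n (n - 1)), and r - 1 >= r / 2. Samples have exactly r
  vertices so that supersaturation is always applied with the same vertex number.\<close>

lemma sample_lower_pair:
  assumes fin: "finite V" and U: "U \<subseteq> V" "card U = 2" and r: "2 \<le> r" "r \<le> card V"
  shows "real (card V choose r) * (real r / real (card V)) ^ 2 / 2 \<le> real (card {R \<in> nsets V r. U \<subseteq> R})"
proof -
  let ?n = "card V"
  let ?T = "real (?n choose r)" and ?N = "real ((?n - 2) choose (r - 2))"
  have "((?n - 1) choose (r - 1)) * ?n = (?n choose r) * r"
    using binomial_shift_mult[of 0 r ?n] r by simp
  moreover have "((?n - 2) choose (r - 2)) * (?n - 1) = ((?n - 1) choose (r - 1)) * (r - 1)"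
    using binomial_shift_mult[of 1 r ?n] r by (simp add: numeral_2_eq_2)
  ultimately have "((?n - 2) choose (r - 2)) * (?n - 1) * ?n = (?n choose r) * r * (r - 1)"
    by (metis mult.assoc mult.commute)
  then have "real (((?n - 2) choose (r - 2)) * (?n - 1) * ?n) = real ((?n choose r) * r * (r - 1))" by (rule arg_cong)
  then have eq: "?N * (real ?n - 1) * real ?n = ?T * real r * (real r - 1)" using r by (simp add: of_nat_diff)
  have "?T * real r * (real r / 2) \<le> ?T * real r * (real r - 1)" using r by (intro mult_left_mono) auto
  also have "\<dots> \<le> ?N * real ?n * real ?n" unfolding eq[symmetric] by (intro mult_right_mono mult_left_mono) auto
  finally have "?T * (real r)\<^sup>2 / 2 \<le> ?N * (real ?n)\<^sup>2" by (simp add: power2_eq_square mult_ac)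
  moreover have "real ?n > 0" using r by simp
  ultimately show ?thesis using card_nsets_containing[OF fin U(1), of r] U r
    by (simp add: power_divide divide_le_eq)
qed

section \<open>Balanced supersaturation\<close>

text \<open>The constants of \<open>even_cycle_supersaturation\<close>: the density that it requires
  and, in \<open>copy_density\<close>, the denominator of its count.\<close>

definition cycle_threshold :: "nat \<Rightarrow> real" where
  "cycle_threshold l = 128 * (real l)\<^sup>2 * 4 ^ l"

definition copy_density :: "nat \<Rightarrow> real" where
  "copy_density l = 1 / (2 * (2 * real l) ^ (2 * l))"

text \<open>A bound linear in the number of edges can be averaged over random samples, so the power
  2 l of the ratio x is weakened to x. For x < 1 the bound is negative, so sparse samples need no
  separate treatment.\<close>

lemma linear_supersaturation:
  assumes l: "l \<ge> 2" and fin: "finite V" "V \<noteq> {}" and E: "E \<subseteq> nsets V 2"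
  shows "copy_density l * (real (card V))\<^sup>2 * (real (card E) / (cycle_threshold l * real (card V) powr (1 + 1 / l)) - 1)
    \<le> real (card (cycle_copies E (2 * l)))"
proof -
  define m where "m = real (card V)"
  define A where "A = cycle_threshold l"
  define x where "x = real (card E) / (A * m powr (1 + 1 / l))"
  have m: "m > 0" using fin by (simp add: m_def card_gt_0_iff)
  have A: "A \<ge> 4"
  proof -
    have "128 * 1 * 1 \<le> 128 * (real l)\<^sup>2 * (4::real) ^ l" using l by (intro mult_mono one_le_power) auto
    then show ?thesis by (simp add: A_def cycle_threshold_def)
  qed
  have cd: "copy_density l > 0" using l by (simp add: copy_density_def)
  have "copy_density l * m\<^sup>2 * (x - 1) \<le> real (card (cycle_copies E (2 * l)))"
  proof (cases "x \<ge> 1")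
    case True
    have E': "real (card E) = x * (A * m powr (1 + 1 / l))" using m A by (simp add: x_def)
    have "1 * (A * m powr (1 + 1 / l)) \<le> real (card E)" unfolding E' using True A by (intro mult_right_mono) auto
    then have "(real (card E) / (4 * m)) ^ (2 * l) / (2 * (2 * real l) ^ (2 * l)) \<le> real (card (cycle_copies E (2 * l)))"
      unfolding m_def A_def cycle_threshold_def using even_cycle_supersaturation[OF l fin E] by simp
    then have "(real (card E) / (4 * m)) ^ (2 * l) * copy_density l \<le> real (card (cycle_copies E (2 * l)))"
      by (simp add: copy_density_def)
    moreover have "x * m\<^sup>2 \<le> (real (card E) / (4 * m)) ^ (2 * l)"
    proof -
      have "m powr (1 + 1 / l) = m * m powr (1 / l)" using m by (simp add: powr_add)
      then have E4: "real (card E) / (4 * m) = x * (A / 4) * m powr (1 / l)" unfolding E' using m by simp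
      have "(real (card E) / (4 * m)) ^ (2 * l) = x ^ (2 * l) * (A / 4) ^ (2 * l) * (m powr (1 / l)) ^ (2 * l)"
        unfolding E4 power_mult_distrib by (rule refl)
      also have "(m powr (1 / l)) ^ (2 * l) = ((m powr (1 / l)) ^ l)\<^sup>2"
        by (simp only: mult.commute[of 2 l] power_mult)
      also have "(m powr (1 / l)) ^ l = m" using m l by (simp add: powr_power)
      finally have eq: "(real (card E) / (4 * m)) ^ (2 * l) = x ^ (2 * l) * (A / 4) ^ (2 * l) * m\<^sup>2" .
      have "x * 1 \<le> x ^ (2 * l) * (A / 4) ^ (2 * l)"
        using True A l self_le_power[of x "2 * l"] by (intro mult_mono one_le_power) auto
      then show ?thesis unfolding eq by (intro mult_right_mono) auto
    qed
    then have "x * m\<^sup>2 * copy_density l \<le> (real (card E) / (4 * m)) ^ (2 * l) * copy_density l"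
      using cd by (intro mult_right_mono) auto
    moreover have "copy_density l * m\<^sup>2 * (x - 1) \<le> x * m\<^sup>2 * copy_density l"
      using cd by (simp add: algebra_simps)
    ultimately show ?thesis by linarith
  next
    case False
    then have "copy_density l * m\<^sup>2 * (x - 1) \<le> 0" using cd by (intro mult_nonneg_nonpos) auto
    also have "0 \<le> real (card (cycle_copies E (2 * l)))" by simp
    finally show ?thesis .
  qed
  then show ?thesis by (simp add: x_def m_def A_def)
qed

text \<open>In a random r-set R, delete one edge of every member of Sat inside R; the cycles left
  contain no member of Sat. Then average \<open>linear_supersaturation\<close>: an edge lies in R
  with probability at least p^2 / 2, a member s of Sat with probability at most p ^ (card s + 1), a
  cycle with probability at most p ^ (2 l).\<close>

lemma card_unsaturated_copies:
  assumes l: "l \<ge> 2" and fin: "finite V" and r: "2 \<le> r" "r \<le> card V" and G: "G \<subseteq> nsets V 2"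
    and Sat: "\<And>s. s \<in> Sat \<Longrightarrow> s \<subseteq> G \<and> s \<noteq> {} \<and> card s + 1 \<le> card (\<Union>s)"
  defines "p \<equiv> real r / real (card V)"
  shows "copy_density l * (real r)\<^sup>2 *
      ((real (card G) * p\<^sup>2 / 2 - (\<Sum>s\<in>Sat. p ^ (card s + 1))) / (cycle_threshold l * real r powr (1 + 1 / l)) - 1)
    \<le> real (card {C \<in> cycle_copies G (2 * l). \<forall>s\<in>Sat. \<not> s \<subseteq> C}) * p ^ (2 * l)"
proof -
  let ?RR = "nsets V r" and ?good = "{C \<in> cycle_copies G (2 * l). \<forall>s\<in>Sat. \<not> s \<subseteq> C}"
  define T where "T = real (card V choose r)"
  define A where "A = cycle_threshold l * real r powr (1 + 1 / l)"
  define cd where "cd = copy_density l * (real r)\<^sup>2"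
  define pick :: "'a set set \<Rightarrow> 'a set" where "pick s = (SOME e. e \<in> s)" for s
  define GR where "GR R = {e\<in>G. e \<subseteq> R}" for R
  define SR where "SR R = {s\<in>Sat. \<Union>s \<subseteq> R}" for R
  define FR where "FR R = GR R - pick ` SR R" for R
  have finG: "finite G" using G fin finite_imp_finite_nsets finite_subset by metis
  have finSat: "finite Sat" by (rule finite_subset[of _ "Pow G"]) (use Sat finG in auto)
  have finRR: "finite ?RR" using fin by (rule finite_imp_finite_nsets)
  have Vne: "V \<noteq> {}" using r by auto
  have T: "T > 0" using r by (simp add: T_def)
  have p: "0 \<le> p" "p \<le> 1" using r by (auto simp: p_def divide_le_eq)
  have A: "A > 0" using l r by (simp add: A_def cycle_threshold_def)
  have cd: "cd \<ge> 0" by (simp add: cd_def copy_density_def)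
  have GV: "e \<subseteq> V \<and> card e = 2" if "e \<in> G" for e using that G by (auto simp: nsets_def)
  have UV: "\<Union>s \<subseteq> V" if "s \<subseteq> G" for s using that GV by blast
  have inst: "cd * ((real (card (GR R)) - real (card (SR R))) / A - 1) \<le> real (card {C\<in>?good. \<Union>C \<subseteq> R})"
    if R: "R \<in> ?RR" for R
  proof -
    have finR: "finite R" "card R = r" "R \<noteq> {}" "R \<subseteq> V" using R r by (auto simp: nsets_def)
    have "card (GR R) \<le> card (FR R) + card (pick ` SR R)"
      unfolding FR_def using finSat by (intro order_trans[OF _ diff_card_le_card_Diff[THEN add_le_mono1]]) (auto simp: SR_def)
    moreover have "card (pick ` SR R) \<le> card (SR R)" using finSat by (intro card_image_le) (auto simp: SR_def)
    ultimately have "real (card (GR R)) - real (card (SR R)) \<le> real (card (FR R))" by linarith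
    then have "cd * ((real (card (GR R)) - real (card (SR R))) / A - 1) \<le> cd * (real (card (FR R)) / A - 1)"
      using cd A by (intro mult_left_mono diff_right_mono divide_right_mono) auto
    also have "\<dots> \<le> real (card (cycle_copies (FR R) (2 * l)))"
    proof -
      have "FR R \<subseteq> nsets R 2" using GV finR by (auto simp: FR_def GR_def nsets_def intro: finite_subset)
      from linear_supersaturation[OF l finR(1,3) this] show ?thesis by (simp add: cd_def A_def finR)
    qed
    also have "\<dots> \<le> real (card {C\<in>?good. \<Union>C \<subseteq> R})"
    proof (intro of_nat_mono card_mono)
      show "cycle_copies (FR R) (2 * l) \<subseteq> {C\<in>?good. \<Union>C \<subseteq> R}"
      proof
        fix C assume C: "C \<in> cycle_copies (FR R) (2 * l)"
        then have CF: "C \<subseteq> FR R" by (simp add: cycle_copies_def)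
        have "FR R \<subseteq> G" by (auto simp: FR_def GR_def)
        then have CG: "C \<in> cycle_copies G (2 * l)" using C cycle_copies_mono by blast
        have UR: "\<Union>C \<subseteq> R" using CF by (auto simp: FR_def GR_def)
        have nS: "\<not> s \<subseteq> C" if s: "s \<in> Sat" for s
        proof
          assume sC: "s \<subseteq> C"
          then have "s \<in> SR R" using s UR by (auto simp: SR_def)
          moreover have "pick s \<in> s" using Sat[OF s] unfolding pick_def by (auto intro: someI)
          ultimately show False using sC CF by (auto simp: FR_def)
        qed
        show "C \<in> {C\<in>?good. \<Union>C \<subseteq> R}" by (intro CollectI conjI ballI CG UR nS)
      qed
      show "finite {C\<in>?good. \<Union>C \<subseteq> R}" using finite_cycle_copies[OF finG] by simp
    qed
    finally show ?thesis .
  qed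
  have double: "(\<Sum>R\<in>?RR. real (card {x\<in>X. F x \<subseteq> R})) = (\<Sum>x\<in>X. real (card {R\<in>?RR. F x \<subseteq> R}))"
    if "finite X" for X :: "'b set" and F
  proof -
    have "(\<Sum>R\<in>?RR. real (card {x\<in>X. F x \<subseteq> R})) = (\<Sum>R\<in>?RR. \<Sum>x\<in>{x\<in>X. F x \<subseteq> R}. 1)" by simp
    also have "\<dots> = (\<Sum>x\<in>X. \<Sum>R\<in>{R\<in>?RR. F x \<subseteq> R}. 1)" using finRR that by (rule sum.swap_restrict)
    finally show ?thesis by simp
  qed
  have 1: "(\<Sum>R\<in>?RR. real (card (GR R))) \<ge> T * (real (card G) * p\<^sup>2 / 2)"
  proof -
    have "T * (real (card G) * p\<^sup>2 / 2) = (\<Sum>e\<in>G. T * p\<^sup>2 / 2)" by simp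
    also have "\<dots> \<le> (\<Sum>e\<in>G. real (card {R\<in>?RR. e \<subseteq> R}))"
      unfolding T_def p_def using GV sample_lower_pair[OF fin _ _ r] by (intro sum_mono) blast
    finally show ?thesis unfolding GR_def double[OF finG, of "\<lambda>e. e"] .
  qed
  have 2: "(\<Sum>R\<in>?RR. real (card (SR R))) \<le> T * (\<Sum>s\<in>Sat. p ^ (card s + 1))"
  proof -
    have "(\<Sum>s\<in>Sat. real (card {R\<in>?RR. \<Union>s \<subseteq> R})) \<le> (\<Sum>s\<in>Sat. T * p ^ (card s + 1))"
    proof (rule sum_mono)
      fix s assume s: "s \<in> Sat"
      have "real (card {R\<in>?RR. \<Union>s \<subseteq> R}) \<le> T * p ^ card (\<Union>s)"
        unfolding T_def p_def using Sat[OF s] UV by (intro sample_upper[OF fin Vne _ r(2)]) blast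
      also have "\<dots> \<le> T * p ^ (card s + 1)"
        using Sat[OF s] p T by (intro mult_left_mono power_decreasing) auto
      finally show "real (card {R\<in>?RR. \<Union>s \<subseteq> R}) \<le> T * p ^ (card s + 1)" .
    qed
    then show ?thesis unfolding SR_def double[OF finSat, of Union] by (simp add: sum_distrib_left)
  qed
  have 3: "(\<Sum>R\<in>?RR. real (card {C\<in>?good. \<Union>C \<subseteq> R})) \<le> T * (real (card ?good) * p ^ (2 * l))"
  proof -
    have fg: "finite ?good" using finite_cycle_copies[OF finG] by simp
    have "(\<Sum>C\<in>?good. real (card {R\<in>?RR. \<Union>C \<subseteq> R})) \<le> (\<Sum>C\<in>?good. T * p ^ (2 * l))"
    proof (rule sum_mono)
      fix C assume C: "C \<in> ?good"
      then have cc: "C \<in> cycle_copies G (2 * l)" by blast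
      then have "C \<subseteq> G" by (simp add: cycle_copies_def)
      then have "real (card {R\<in>?RR. \<Union>C \<subseteq> R}) \<le> T * p ^ card (\<Union>C)"
        unfolding T_def p_def using UV by (intro sample_upper[OF fin Vne _ r(2)]) blast
      then show "real (card {R\<in>?RR. \<Union>C \<subseteq> R}) \<le> T * p ^ (2 * l)"
        using card_Union_cycle_copy[OF cc] l by simp
    qed
    then show ?thesis unfolding double[OF fg, of Union] by (simp add: mult_ac)
  qed
  have cR: "real (card ?RR) = T" using fin by (simp add: T_def)
  have "T * (cd * ((real (card G) * p\<^sup>2 / 2 - (\<Sum>s\<in>Sat. p ^ (card s + 1))) / A - 1))
     = cd * ((T * (real (card G) * p\<^sup>2 / 2) - T * (\<Sum>s\<in>Sat. p ^ (card s + 1))) / A - T)"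
    by (simp add: algebra_simps diff_divide_distrib)
  also have "\<dots> \<le> cd * (((\<Sum>R\<in>?RR. real (card (GR R))) - (\<Sum>R\<in>?RR. real (card (SR R)))) / A - T)"
    using cd A 1 2 by (intro mult_left_mono diff_mono divide_right_mono) auto
  also have "\<dots> = (\<Sum>R\<in>?RR. cd * ((real (card (GR R)) - real (card (SR R))) / A - 1))"
    by (simp add: sum_distrib_left[symmetric] sum_subtractf sum_divide_distrib[symmetric] cR T_def)
  also have "\<dots> \<le> (\<Sum>R\<in>?RR. real (card {C\<in>?good. \<Union>C \<subseteq> R}))" using inst by (rule sum_mono)
  also note 3
  finally show ?thesis using T by (simp add: A_def cd_def)
qed

text \<open>Take H of maximal size with degrees at most 2 D and call s saturated if its degree
  exceeds D. Every copy without a saturated part belongs to H, so H is large unless there are many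
  saturated sets. But each of those takes more than D members of H, so many of them force H to be
  large too.\<close>

theorem balanced_supersaturation:
  assumes l: "l \<ge> 2" and fin: "finite V" and r: "2 \<le> r" "r \<le> card V" and G: "G \<subseteq> nsets V 2"
  defines "p \<equiv> real r / real (card V)"
  assumes dense: "4 * cycle_threshold l * real r powr (1 + 1 / l) \<le> real (card G) * p\<^sup>2"
  obtains H where "H \<subseteq> cycle_copies G (2 * l)"
    "copy_density l / 2 * (real r)\<^sup>2 \<le> real (card H) * p ^ (2 * l)"
    "\<And>s. s \<subseteq> G \<Longrightarrow> s \<noteq> {} \<Longrightarrow> card s < 2 * l \<Longrightarrow>
      real (card {C\<in>H. s \<subseteq> C}) \<le> 2 * (real r powr (1 - 1 / l) / p ^ (2 * l - 2)) * p ^ (card s - 1)"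
proof -
  \<comment> \<open>Normalised so that p ^ (card s + 1) = D (card s) * p ^ (2 l) / r powr (1 - 1 /
    l): the chance of meeting a saturated set in the sample is charged to the members of H above
    it.\<close>
  define D where "D i = real r powr (1 - 1 / l) / p ^ (2 * l - 2) * p ^ (i - 1)" for i :: nat
  define A where "A = cycle_threshold l"
  define cd where "cd = copy_density l"
  define ok where "ok H \<longleftrightarrow> H \<subseteq> cycle_copies G (2 * l) \<and>
    (\<forall>s\<subseteq>G. s \<noteq> {} \<longrightarrow> card s < 2 * l \<longrightarrow> real (card {C\<in>H. s \<subseteq> C}) \<le> 2 * D (card s))" for H
  have p: "0 < p" "p \<le> 1" using r by (auto simp: p_def divide_le_eq)
  have finG: "finite G" using G fin finite_imp_finite_nsets finite_subset by metis
  have finC: "finite (cycle_copies G (2 * l))" by (rule finite_cycle_copies[OF finG])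
  have l3: "2 * l \<ge> 3" using l by simp
  have "\<exists>H. ok H \<and> (\<forall>H'. ok H' \<longrightarrow> card H' \<le> card H)"
  proof (rule ex_has_greatest_nat)
    show "ok {}" using p by (simp add: ok_def D_def)
    show "\<forall>H. ok H \<longrightarrow> card H < Suc (card (cycle_copies G (2 * l)))"
      using finC by (auto simp: ok_def less_Suc_eq_le intro: card_mono)
  qed
  then obtain H where H: "ok H" and max: "\<And>H'. ok H' \<Longrightarrow> card H' \<le> card H" by blast
  have Hsub: "H \<subseteq> cycle_copies G (2 * l)" and Hdeg: "\<And>s. s \<subseteq> G \<Longrightarrow> s \<noteq> {} \<Longrightarrow> card s < 2 * l \<Longrightarrow> real (card {C\<in>H. s \<subseteq> C}) \<le> 2 * D (card s)"
    using H by (auto simp: ok_def)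
  have finH: "finite H" using Hsub finC finite_subset by blast
  define Sat where "Sat = {s\<in>Pow G. s \<noteq> {} \<and> card s < 2 * l \<and> real (card {C\<in>H. s \<subseteq> C}) > D (card s)}"
  have finSat: "finite Sat" using finG by (simp add: Sat_def)
  have D0: "D i \<ge> 0" for i using p by (simp add: D_def)
  have Sat: "s \<subseteq> G \<and> s \<noteq> {} \<and> card s + 1 \<le> card (\<Union>s)" if s: "s \<in> Sat" for s
  proof -
    have "real (card {C\<in>H. s \<subseteq> C}) > 0" using s D0[of "card s"] by (auto simp: Sat_def)
    then have "{C\<in>H. s \<subseteq> C} \<noteq> {}" by (metis card.empty of_nat_0 less_irrefl)
    then obtain C where C: "C \<in> cycle_copies G (2 * l)" "s \<subseteq> C" using Hsub by auto
    have "s \<noteq> {}" "card s < 2 * l" "s \<subseteq> G" using s by (auto simp: Sat_def)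
    then show ?thesis using card_Union_cycle_part[OF C(1) l3 C(2)] by simp
  qed
  let ?good = "{C \<in> cycle_copies G (2 * l). \<forall>s\<in>Sat. \<not> s \<subseteq> C}"
  have "?good \<subseteq> H"
  proof (rule subsetI, rule ccontr)
    fix C assume C: "C \<in> ?good" and nH: "C \<notin> H"
    have "ok (insert C H)"
      unfolding ok_def
    proof (intro conjI allI impI)
      show "insert C H \<subseteq> cycle_copies G (2 * l)" using C Hsub by simp
    next
      fix s assume s: "s \<subseteq> G" "s \<noteq> {}" "card s < 2 * l"
      show "real (card {C'\<in>insert C H. s \<subseteq> C'}) \<le> 2 * D (card s)"
      proof (cases "s \<subseteq> C")
        case True
        then have "s \<notin> Sat" using C by blast
        then have le: "real (card {C\<in>H. s \<subseteq> C}) \<le> D (card s)" using s by (simp add: Sat_def)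
        \<comment> \<open>Adding one copy to a degree of at most D stays within 2 D only if D is at
          least 1; this follows from card s - 1 <= 2 l - 2.\<close>
        have "1 \<le> D (card s)"
        proof -
          have "p ^ (2 * l - 2) \<le> p ^ (card s - 1)" using p s by (intro power_decreasing) auto
          then have "1 \<le> p ^ (card s - 1) / p ^ (2 * l - 2)" using p by (simp add: le_divide_eq)
          moreover have "1 \<le> real r powr (1 - 1 / l)" using r l by (intro ge_one_powr_ge_zero) auto
          ultimately have "1 * 1 \<le> real r powr (1 - 1 / l) * (p ^ (card s - 1) / p ^ (2 * l - 2))" by (intro mult_mono) auto
          then show ?thesis by (simp add: D_def)
        qed
        moreover have "card {C'\<in>insert C H. s \<subseteq> C'} \<le> card {C\<in>H. s \<subseteq> C} + 1"
        proof -
          have "{C'\<in>insert C H. s \<subseteq> C'} = insert C {C\<in>H. s \<subseteq> C}" using True by auto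
          then show ?thesis using finH by (simp add: card_insert_if)
        qed
        ultimately show ?thesis using le by linarith
      next
        case False
        then have "{C'\<in>insert C H. s \<subseteq> C'} = {C\<in>H. s \<subseteq> C}" by auto
        then show ?thesis using Hdeg[OF s] by simp
      qed
    qed
    then have "card (insert C H) \<le> card H" by (rule max)
    then show False using finH nH by simp
  qed
  then have goodH: "real (card ?good) \<le> real (card H)" using finH by (intro of_nat_mono card_mono)
  define h where "h = real (card H) * p ^ (2 * l)"
  have rp: "real r powr (1 - 1 / l) > 0" using r by simp
  have Sum: "(\<Sum>s\<in>Sat. p ^ (card s + 1)) \<le> h * 4 ^ l / real r powr (1 - 1 / l)"
  proof -
    have "(\<Sum>s\<in>Sat. p ^ (card s + 1)) \<le> (\<Sum>s\<in>Sat. real (card {C\<in>H. s \<subseteq> C}) * (p ^ (2 * l) / real r powr (1 - 1 / l)))"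
    proof (rule sum_mono)
      fix s assume s: "s \<in> Sat"
      then have "card s > 0" using finG finite_subset[of s G] by (auto simp: Sat_def card_gt_0_iff)
      then have e1: "p ^ (card s + 1) = p ^ (card s - 1) * p ^ 2" by (simp flip: power_add)
      have "2 * l = 2 + (2 * l - 2)" using l by simp
      then have "p ^ (2 * l) = p ^ 2 * p ^ (2 * l - 2)" by (metis power_add)
      then have e2: "p ^ (2 * l) / p ^ (2 * l - 2) = p ^ 2" using p by simp
      have "p ^ (card s + 1) = D (card s) * (p ^ (2 * l) / real r powr (1 - 1 / l))"
        unfolding e1 D_def e2[symmetric] using rp by (simp add: field_simps)
      also have "\<dots> \<le> real (card {C\<in>H. s \<subseteq> C}) * (p ^ (2 * l) / real r powr (1 - 1 / l))"
        using s p by (intro mult_right_mono) (auto simp: Sat_def)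
      finally show "p ^ (card s + 1) \<le> \<dots>" .
    qed
    also have "\<dots> = real (\<Sum>s\<in>Sat. card {C\<in>H. s \<subseteq> C}) * (p ^ (2 * l) / real r powr (1 - 1 / l))"
      by (simp add: sum_distrib_right sum_divide_distrib)
    also have "\<dots> \<le> real (card H * 4 ^ l) * (p ^ (2 * l) / real r powr (1 - 1 / l))"
    proof (intro mult_right_mono of_nat_mono)
      have "(\<Sum>s\<in>Sat. card {C\<in>H. s \<subseteq> C}) = (\<Sum>s\<in>Sat. \<Sum>C\<in>{C\<in>H. s \<subseteq> C}. 1)" by simp
      also have "\<dots> = (\<Sum>C\<in>H. \<Sum>s\<in>{s\<in>Sat. s \<subseteq> C}. 1)" using finSat finH by (rule sum.swap_restrict)
      also have "\<dots> = (\<Sum>C\<in>H. card {s\<in>Sat. s \<subseteq> C})" by simp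
      also have "\<dots> \<le> (\<Sum>C\<in>H. 4 ^ l)"
      proof (rule sum_mono)
        fix C assume "C \<in> H"
        then have C: "C \<in> cycle_copies G (2 * l)" using Hsub by blast
        then have "finite C" using finG finite_subset[of C G] by (simp add: cycle_copies_def)
        then have "card {s\<in>Sat. s \<subseteq> C} \<le> card (Pow C)" by (intro card_mono) auto
        then show "card {s\<in>Sat. s \<subseteq> C} \<le> 4 ^ l"
          using card_cycle_copy[OF C l3] \<open>finite C\<close> by (simp add: card_Pow power_mult)
      qed
      finally show "(\<Sum>s\<in>Sat. card {C\<in>H. s \<subseteq> C}) \<le> card H * 4 ^ l" by simp
    qed (use p in auto)
    finally show ?thesis by (simp add: h_def mult_ac)
  qed
  have A: "A \<ge> 4 ^ l" and cd: "0 < cd" "cd \<le> 1"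
  proof -
    have "1 * (4::real) ^ l \<le> (128 * (real l)\<^sup>2) * 4 ^ l"
    proof (intro mult_right_mono)
      have "1 * 1 \<le> 128 * (real l)\<^sup>2" using l by (intro mult_mono one_le_power) auto
      then show "1 \<le> 128 * (real l)\<^sup>2" by simp
    qed simp
    then show "A \<ge> 4 ^ l" by (simp add: A_def cycle_threshold_def)
    have "1 \<le> (2 * real l) ^ (2 * l)" using l by (intro one_le_power) auto
    then show "cd \<le> 1" by (simp add: cd_def copy_density_def divide_le_eq)
    show "0 < cd" using l by (simp add: cd_def copy_density_def)
  qed
  have A0: "A > 0" using A by (meson less_le_trans zero_less_numeral zero_less_power)
  have h0: "h \<ge> 0" using p by (simp add: h_def)
  \<comment> \<open>The hypothesis \<open>dense\<close>, halved by the sampling, gives 2 after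
    division by the threshold; \<open>linear_supersaturation\<close> loses 1, and 1 remains. The 4 ^
    l counts the subsets of a copy.\<close>
  have "cd * (real r)\<^sup>2 * (1 - h * 4 ^ l / (A * (real r)\<^sup>2)) \<le>
    cd * (real r)\<^sup>2 * ((real (card G) * p\<^sup>2 / 2 - (\<Sum>s\<in>Sat. p ^ (card s + 1))) / (A * real r powr (1 + 1 / l)) - 1)"
  proof (intro mult_left_mono)
    have ra: "A * real r powr (1 + 1 / l) > 0" using A0 r by simp
    have "real r powr (1 - 1 / l) * real r powr (1 + 1 / l) = (real r)\<^sup>2"
      using r by (simp flip: powr_add)
    then have "h * 4 ^ l / real r powr (1 - 1 / l) / (A * real r powr (1 + 1 / l)) = h * 4 ^ l / (A * (real r)\<^sup>2)"
      by (simp add: mult_ac)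
    then have "(2 * (A * real r powr (1 + 1 / l)) - h * 4 ^ l / real r powr (1 - 1 / l)) / (A * real r powr (1 + 1 / l)) = 2 - h * 4 ^ l / (A * (real r)\<^sup>2)"
      using A0 r by (simp only: diff_divide_distrib) simp
    moreover have "(2 * (A * real r powr (1 + 1 / l)) - h * 4 ^ l / real r powr (1 - 1 / l)) / (A * real r powr (1 + 1 / l))
      \<le> (real (card G) * p\<^sup>2 / 2 - (\<Sum>s\<in>Sat. p ^ (card s + 1))) / (A * real r powr (1 + 1 / l))"
      using ra Sum dense by (intro divide_right_mono diff_mono) (auto simp: A_def)
    ultimately show "1 - h * 4 ^ l / (A * (real r)\<^sup>2) \<le> (real (card G) * p\<^sup>2 / 2 - (\<Sum>s\<in>Sat. p ^ (card s + 1))) / (A * real r powr (1 + 1 / l)) - 1"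
      by linarith
  qed (use cd in auto)
  also have "\<dots> \<le> real (card ?good) * p ^ (2 * l)"
    unfolding A_def cd_def p_def by (rule card_unsaturated_copies[OF l fin r G Sat])
  also have "\<dots> \<le> h" unfolding h_def using goodH p by (intro mult_right_mono) auto
  finally have "cd * (real r)\<^sup>2 * (1 - h * 4 ^ l / (A * (real r)\<^sup>2)) \<le> h" .
  moreover have "cd * (real r)\<^sup>2 * (h * 4 ^ l / (A * (real r)\<^sup>2)) \<le> h"
  proof -
    have "cd * (real r)\<^sup>2 * (h * 4 ^ l / (A * (real r)\<^sup>2)) = cd * (4 ^ l / A) * h" using r by simp
    also have "\<dots> \<le> 1 * 1 * h"
      using cd A A0 h0 by (intro mult_right_mono mult_mono) (auto simp: divide_le_eq)
    finally show ?thesis by simp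
  qed
  ultimately have "cd * (real r)\<^sup>2 \<le> 2 * h" by (simp add: right_diff_distrib)
  then have "copy_density l / 2 * (real r)\<^sup>2 \<le> real (card H) * p ^ (2 * l)" by (simp add: cd_def h_def)
  with Hsub show ?thesis
  proof (rule that)
    fix s assume "s \<subseteq> G" "s \<noteq> {}" "card s < 2 * l"
    from Hdeg[OF this] show "real (card {C\<in>H. s \<subseteq> C}) \<le> 2 * (real r powr (1 - 1 / l) / p ^ (2 * l - 2)) * p ^ (card s - 1)"
      by (simp only: D_def mult.assoc)
  qed
qed

section \<open>Containers for cycle-free graphs\<close>

text \<open>This is (1 - 1 / l) / (2 l - 1), the exponent of n in the (2 l - 1)-th root of the
  degree bound B in \<open>cycle_free_containers\<close>.\<close>

definition gap_exponent :: "nat \<Rightarrow> real" where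
  "gap_exponent l = (real l - 1) / (real l * (2 * real l - 1))"

text \<open>Takes p = r / n of order (a / k) powr (l / (l - 1)). For N = k n powr (1 + 1 / l) edges,
  N p^2 is k p powr (1 - 1 / l) times r powr (1 + 1 / l), hence between a and 2 a times it, and k p
  has order k powr (- 1 / (l - 1)). The upper bound on k gives x >= 2, so rounding up costs at most
  a factor 2.\<close>

lemma sample_size_exists:
  fixes l :: nat
  assumes l: "l \<ge> 2" and n: "n > (0::nat)" and a: "a \<ge> (4::real)" and k: "k \<ge> a" "2 * k \<le> real n powr (1 - 1 / l)"
  obtains r where "2 \<le> r" "r \<le> n" "a \<le> k * (real r / real n) powr (1 - 1 / l)"
    "k * (real r / real n) powr (1 - 1 / l) \<le> 2 * a"
    "k * (real r / real n) \<le> 2 * a powr (real l / (real l - 1)) * k powr (- 1 / (real l - 1))"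
proof -
  define q where "q = real l / (real l - 1)"
  define x where "x = real n * (a / k) powr q"
  define r where "r = nat \<lceil>x\<rceil>"
  have l1: "real l - 1 > 0" using l by simp
  have q: "q > 0" "(1 - 1 / l) * q = 1" "1 - 1 / l > 0" "1 - 1 / real l \<le> 1" using l l1 by (auto simp: q_def field_simps)
  have k0: "k > 0" using k a by linarith
  have nn: "real n > 0" using n by simp
  have ak: "0 < a / k" "a / k \<le> 1" using k a k0 by (auto simp: divide_le_eq)
  have x2: "x \<ge> 2"
  proof -
    have "2 * k / real n powr (1 - 1 / l) \<le> 1" using k nn by (simp add: divide_le_eq)
    then have "2 * a * (1 / real n powr (1 - 1 / l)) \<le> a / k" using k0 a nn by (simp add: field_simps)
    then have "(2 * a * (1 / real n powr (1 - 1 / l))) powr q \<le> (a / k) powr q"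
      using q a by (intro powr_mono2) auto
    moreover have "(2 * a * (1 / real n powr (1 - 1 / l))) powr q = (2 * a) powr q * (1 / real n)"
      using a nn q by (simp add: powr_mult powr_divide powr_powr)
    ultimately have "(2 * a) powr q * (1 / real n) * real n \<le> x" using nn unfolding x_def
      by (subst mult.commute[of "real n"]) (intro mult_right_mono, auto)
    moreover have "2 * a \<ge> 1" using a by simp
    then have "(2 * a) powr 1 \<le> (2 * a) powr q"
      using l l1 by (intro powr_mono) (auto simp: q_def)
    ultimately show ?thesis using nn a by simp
  qed
  have rx: "x \<le> real r" "real r \<le> 2 * x" using x2 unfolding r_def by linarith+
  have "x \<le> real n * 1" unfolding x_def using ak q by (intro mult_left_mono powr_le1) auto
  then have rn: "r \<le> n" unfolding r_def by (simp add: ceiling_le_iff)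
  have r2: "2 \<le> r" using x2 rx by linarith
  have xn: "x / real n = (a / k) powr q" using nn by (simp add: x_def)
  have xp: "(x / real n) powr (1 - 1 / l) = a / k" unfolding xn using ak q a k0 by (simp add: powr_powr mult.commute)
  have x0: "x / real n \<ge> 0" using x2 nn by simp
  have lo: "a / k \<le> (real r / real n) powr (1 - 1 / l)"
    unfolding xp[symmetric] using rx x0 q by (intro powr_mono2 divide_right_mono) auto
  have hi: "(real r / real n) powr (1 - 1 / l) \<le> 2 * (a / k)"
  proof -
    have "(real r / real n) powr (1 - 1 / l) \<le> (2 * (x / real n)) powr (1 - 1 / l)"
      using rx nn q by (intro powr_mono2) (auto simp: field_simps)
    also have "\<dots> = 2 powr (1 - 1 / l) * (a / k)" unfolding xp[symmetric] using x0 by (subst powr_mult) auto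
    also have "\<dots> \<le> 2 powr 1 * (a / k)" using q ak by (intro mult_right_mono powr_mono) auto
    finally show ?thesis by simp
  qed
  have kp: "k * (real r / real n) \<le> 2 * a powr (real l / (real l - 1)) * k powr (- 1 / (real l - 1))"
  proof -
    have lq: "real l / (real l - 1) = q" by (simp add: q_def)
    have lq1: "- 1 / (real l - 1) = 1 - q" using l1 by (simp add: q_def field_simps)
    have "real r / real n \<le> 2 * (x / real n)" using rx nn by (simp add: field_simps)
    also have "\<dots> = 2 * (a powr q / k powr q)" unfolding xn using a k0 by (simp add: powr_divide)
    finally have "k * (real r / real n) \<le> k * (2 * (a powr q / k powr q))" using k0 by (intro mult_left_mono) auto
    also have "\<dots> = 2 * a powr q * k powr (1 - q)" using k0 by (simp add: powr_diff)
    finally show ?thesis unfolding lq lq1 .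
  qed
  show ?thesis
  proof (rule that[OF r2 rn _ _ kp])
    show "a \<le> k * (real r / real n) powr (1 - 1 / l)" using lo k0 by (simp add: divide_le_eq mult.commute)
    show "k * (real r / real n) powr (1 - 1 / l) \<le> 2 * a" using hi k0 by (simp add: field_simps)
  qed
qed

text \<open>Up to constants the two terms bound p N and B powr (- 1 / (2 l - 1)) * N for a graph
  with N = k n powr (1 + 1 / l) edges: the costs of the codegrees of proper parts of cycles and of
  the weight 1 of a whole cycle.\<close>

definition fingerprint_size :: "nat \<Rightarrow> real \<Rightarrow> real \<Rightarrow> real" where
  "fingerprint_size l n k = (k powr (- 1 / (real l - 1)) + n powr (- gap_exponent l)) * n powr (1 + 1 / real l)"

theorem cycle_free_containers:
  fixes l :: nat
  assumes l: "l \<ge> 2"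
  shows "\<exists>\<epsilon>>0. \<epsilon> < 1 \<and> (\<exists>C>0. \<exists>k0\<ge>1. \<forall>(V :: 'a set) G. finite V \<longrightarrow> V \<noteq> {} \<longrightarrow> G \<subseteq> nsets V 2 \<longrightarrow>
    k0 * real (card V) powr (1 + 1 / real l) \<le> real (card G) \<longrightarrow>
    (\<exists>cont. \<forall>I\<subseteq>G. \<not> contains_copy I (cycle_graph (2 * l)) \<longrightarrow>
      (\<exists>Ss. container_for G (2 * l - 1)
        (C * fingerprint_size l (card V) (real (card G) / real (card V) powr (1 + 1 / real l)))
        ((1 - \<epsilon>) * real (card G)) I Ss (cont Ss))))"
proof -
  define A where "A = cycle_threshold l"
  \<comment> \<open>Exceeds the 4 A of \<open>balanced_supersaturation\<close>. With c as below, 4 *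
    a * c = copy_density l / 2, the constant in the lower bound for the size of H.\<close>
  define a where "a = 8 * A"
  define c where "c = copy_density l / (64 * A)"
  define q where "q = real l / (real l - 1)"
  have l1: "real l - 1 > 0" using l by simp
  have l3: "2 * l \<ge> 3" using l by simp
  have A: "A \<ge> 1"
  proof -
    have "128 * 1 * 1 \<le> 128 * (real l)\<^sup>2 * (4::real) ^ l" using l by (intro mult_mono one_le_power) auto
    then show ?thesis by (simp add: A_def cycle_threshold_def)
  qed
  have cd: "copy_density l > 0" using l by (simp add: copy_density_def)
  have c: "c > 0" using cd A by (simp add: c_def)
  have a: "a \<ge> 4" using A by (simp add: a_def)
  have "1 \<le> 2 * l" using l by simp
  from hypergraph_containers[OF this c] obtain \<epsilon> K where \<epsilon>: "\<epsilon> > 0" and K: "K > 0" and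
    cont: "\<forall>(V :: 'a set set) w B t. finite V \<longrightarrow> B > 0 \<longrightarrow> t > 0 \<longrightarrow> bounded_weight V (2 * l) B t w \<longrightarrow>
      c * B * real (card V) \<le> real (wdeg V w {}) \<longrightarrow>
      (\<exists>cont. \<forall>I\<subseteq>V. (\<forall>e. w e > 0 \<longrightarrow> \<not> e \<subseteq> I) \<longrightarrow>
      (\<exists>Ss. container_for V (2 * l - 1) (K * t * real (card V)) ((1 - \<epsilon>) * real (card V)) I Ss (cont Ss)))"
    by (elim exE conjE)
  define C where "C = K * (2 * a powr q + 2 * a)"
  have main: "\<exists>cont. \<forall>I\<subseteq>G. \<not> contains_copy I (cycle_graph (2 * l)) \<longrightarrow>
      (\<exists>Ss. container_for G (2 * l - 1)
        (C * fingerprint_size l (card V) (real (card G) / real (card V) powr (1 + 1 / real l)))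
        ((1 - min \<epsilon> (1 / 2)) * real (card G)) I Ss (cont Ss))"
    if fin: "finite V" and Vne: "V \<noteq> {}" and G: "G \<subseteq> nsets V 2"
      and dense: "a * real (card V) powr (1 + 1 / real l) \<le> real (card G)" for V :: "'a set" and G
  proof -
    define n where "n = card V"
    define N where "N = real (card G)"
    define al where "al = 1 + 1 / real l"
    define k where "k = N / real n powr al"
    have n: "n > 0" using fin Vne by (simp add: n_def card_gt_0_iff)
    have finG: "finite G" using G fin finite_imp_finite_nsets finite_subset by metis
    have nal: "real n powr al > 0" using n by simp
    have kN: "N = k * real n powr al" using nal by (simp add: k_def)
    have ka: "k \<ge> a" using dense nal by (simp add: k_def N_def n_def al_def le_divide_eq)
    have kn: "2 * k \<le> real n powr (1 - 1 / l)"
    proof -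
      have "card G \<le> n choose 2" using card_mono[OF finite_imp_finite_nsets[OF fin] G] by (simp add: n_def)
      then have "2 * card G \<le> n * (n - 1)" by (simp add: choose_two)
      also have "\<dots> \<le> n * n" by simp
      finally have "2 * N \<le> real n * real n" unfolding N_def by (metis of_nat_le_iff of_nat_mult of_nat_numeral)
      also have "\<dots> = real n powr (1 - 1 / l) * real n powr al" using n by (simp add: al_def flip: powr_add) (simp add: powr_numeral power2_eq_square)
      finally have "2 * k * real n powr al \<le> real n powr (1 - 1 / l) * real n powr al" by (simp add: kN)
      then show ?thesis using nal by simp
    qed
    obtain r where r: "2 \<le> r" "r \<le> n" and plo: "a \<le> k * (real r / real n) powr (1 - 1 / l)"
      and phi: "k * (real r / real n) powr (1 - 1 / l) \<le> 2 * a"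
      and kp: "k * (real r / real n) \<le> 2 * a powr q * k powr (- 1 / (real l - 1))"
      unfolding q_def by (rule sample_size_exists[OF l n a ka kn])
    define p where "p = real r / real n"
    have p: "0 < p" "p \<le> 1" using r by (auto simp: p_def divide_le_eq)
    have rn: "real r = p * real n" using n by (simp add: p_def)
    have Np: "N * p\<^sup>2 = k * p powr (1 - 1 / l) * real r powr al"
    proof -
      have "p\<^sup>2 = p powr (1 - 1 / l) * p powr al"
        using p by (simp add: al_def flip: powr_add)
      then show ?thesis using p by (simp add: kN rn powr_mult)
    qed
    have ral: "real r powr al > 0" using r by simp
    have Nlo: "a * real r powr al \<le> N * p\<^sup>2" unfolding Np using plo ral by (intro mult_right_mono) (auto simp: p_def)
    have Nhi: "N * p\<^sup>2 \<le> 2 * a * real r powr al" unfolding Np using phi ral by (intro mult_right_mono) (auto simp: p_def)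
    have "4 * cycle_threshold l * real r powr (1 + 1 / l) \<le> a * real r powr al"
      unfolding al_def A_def[symmetric] using A by (intro mult_right_mono) (auto simp: a_def)
    then have dense': "4 * cycle_threshold l * real r powr (1 + 1 / l) \<le> real (card G) * (real r / real (card V))\<^sup>2"
      using Nlo by (simp add: N_def p_def n_def)
    define B where "B = 2 * (real r powr (1 - 1 / l) / p ^ (2 * l - 2))"
    obtain H where H: "H \<subseteq> cycle_copies G (2 * l)"
      and Hbig: "copy_density l / 2 * (real r)\<^sup>2 \<le> real (card H) * p ^ (2 * l)"
      and Hdeg: "\<And>s. s \<subseteq> G \<Longrightarrow> s \<noteq> {} \<Longrightarrow> card s < 2 * l \<Longrightarrow> real (card {C\<in>H. s \<subseteq> C}) \<le> B * p ^ (card s - 1)"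
      unfolding B_def p_def n_def
      using balanced_supersaturation[OF l fin r(1) _ G dense'] r(2) by (auto simp: n_def)
    have B: "B > 0" using p r by (simp add: B_def)
    \<comment> \<open>The summand p serves the proper parts of copies; the other one gives B * t ^
      (2 l - 1) >= 1, room for a single copy of weight 1.\<close>
    define t where "t = p + B powr (- 1 / (2 * real l - 1))"
    have t: "t > 0" "p \<le> t" "B powr (- 1 / (2 * real l - 1)) \<le> t" using p by (auto simp: t_def add_pos_nonneg)
    define w where "w e = (if e \<in> H then 1 else 0 :: nat)" for e
    have finH: "finite H" using H finite_cycle_copies[OF finG] finite_subset by blast
    have HG: "C \<subseteq> G \<and> card C = 2 * l" if "C \<in> H" for C
      using H that card_cycle_copy[of C G "2 * l"] l3 by (auto simp: cycle_copies_def)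
    have wdeg: "wdeg G w s = card {C\<in>H. s \<subseteq> C}" for s
    proof -
      have "wdeg G w s = (\<Sum>e\<in>{C\<in>H. s \<subseteq> C}. 1)"
        unfolding wdeg_def by (rule sum.mono_neutral_cong_right) (use finG HG in \<open>auto simp: w_def\<close>)
      then show ?thesis by simp
    qed
    have bw: "bounded_weight G (2 * l) B t w"
      unfolding bounded_weight_def
    proof (intro conjI allI impI)
      fix e assume "w e > 0"
      then have "e \<in> H" by (simp add: w_def split: if_splits)
      then show "e \<subseteq> G" "card e = 2 * l" using HG by auto
    next
      fix s assume s: "s \<noteq> {}" "s \<subseteq> G"
      show "real (wdeg G w s) \<le> B * t ^ (card s - 1)"
      proof (cases "card s < 2 * l")
        case True
        have "p ^ (card s - 1) \<le> t ^ (card s - 1)" using p t by (intro power_mono) auto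
        then have "B * p ^ (card s - 1) \<le> B * t ^ (card s - 1)" using B by (intro mult_left_mono) auto
        then show ?thesis using Hdeg[OF s(2,1) True] by (simp add: wdeg)
      next
        case False
        have sC: "C = s" if "C \<in> H" "s \<subseteq> C" for C
        proof -
          have "finite C" "card C = 2 * l" using HG[OF that(1)] finG finite_subset by auto
          then show ?thesis using that False card_seteq[of C s] by auto
        qed
        show ?thesis
        proof (cases "s \<in> H")
          case True
          have "{C\<in>H. s \<subseteq> C} = {s}" using sC True by auto
          moreover have "1 \<le> B * t ^ (card s - 1)"
          proof -
            have cs: "card s - 1 = 2 * l - 1" using HG[OF True] by simp
            have rl: "real (2 * l - 1) = 2 * real l - 1" using l by simp
            have "(B powr (- 1 / (2 * real l - 1))) ^ (2 * l - 1) = B powr (- 1 / (2 * real l - 1) * real (2 * l - 1))"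
              using B by (simp add: powr_power)
            also have "\<dots> = B powr (- 1)" unfolding rl using l by simp
            finally have "(B powr (- 1 / (2 * real l - 1))) ^ (2 * l - 1) = 1 / B" using B by (simp add: powr_minus_divide)
            moreover have "(B powr (- 1 / (2 * real l - 1))) ^ (2 * l - 1) \<le> t ^ (2 * l - 1)" using t by (intro power_mono) auto
            ultimately show ?thesis unfolding cs using B by (simp add: divide_le_eq mult.commute)
          qed
          ultimately show ?thesis by (simp add: wdeg)
        next
          case False
          then have emp: "{C\<in>H. s \<subseteq> C} = {}" using sC by auto
          show ?thesis unfolding wdeg emp using B t by simp
        qed
      qed
    qed
    have dens: "c * B * real (card G) \<le> real (wdeg G w {})"
    proof -
      have "2 * l = 2 + (2 * l - 2)" using l by simp
      then have pp: "p ^ (2 * l) = p\<^sup>2 * p ^ (2 * l - 2)" by (metis power_add)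
      have "c * B * N * p ^ (2 * l) = 2 * c * real r powr (1 - 1 / l) * (N * p\<^sup>2)"
        unfolding pp using p by (simp add: B_def field_simps)
      also have "\<dots> \<le> 2 * c * real r powr (1 - 1 / l) * (2 * a * real r powr al)"
        using Nhi c by (intro mult_left_mono) auto
      also have "\<dots> = 4 * a * c * (real r)\<^sup>2"
      proof -
        have "real r powr (1 - 1 / l) * real r powr al = (real r)\<^sup>2" using r by (simp add: al_def flip: powr_add)
        then show ?thesis by simp
      qed
      also have "\<dots> = copy_density l / 2 * (real r)\<^sup>2" using A by (simp add: a_def c_def)
      also note Hbig
      finally have "c * B * N \<le> real (card H)" using p by simp
      then show ?thesis by (simp add: wdeg N_def)
    qed
    have size: "K * t * N \<le> C * fingerprint_size l n k"
    proof -
      have 1: "p * N \<le> 2 * a powr q * (k powr (- 1 / (real l - 1)) * real n powr al)"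
      proof -
        have "p * N = k * p * real n powr al" by (simp add: kN)
        also have "\<dots> \<le> 2 * a powr q * k powr (- 1 / (real l - 1)) * real n powr al"
          using kp nal by (intro mult_right_mono) (auto simp: p_def)
        finally show ?thesis by simp
      qed
      \<comment> \<open>B is at least n powr (1 - 1 / l) * p powr (- (2 l - 1) * (1 - 1 / l)), so
        its root contributes p powr (1 - 1 / l), and k * p powr (1 - 1 / l) is at most 2 a.\<close>
      have 2: "B powr (- 1 / (2 * real l - 1)) * N \<le> 2 * a * (real n powr (- gap_exponent l) * real n powr al)"
      proof -
        have "p ^ (2 * l - 2) = p powr (2 * real l - 2)" using p l by (simp flip: powr_realpow)
        then have B': "real n powr (1 - 1 / l) * p powr (1 - 1 / l - (2 * real l - 2)) \<le> B"
        proof -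
          have "real r powr (1 - 1 / l) = real n powr (1 - 1 / l) * p powr (1 - 1 / l)"
            unfolding rn using p by (subst powr_mult) auto
          moreover have "p powr (1 - 1 / l - (2 * real l - 2)) = p powr (1 - 1 / l) / p ^ (2 * l - 2)"
            by (subst powr_diff) (simp only: \<open>p ^ (2 * l - 2) = p powr (2 * real l - 2)\<close>)
          ultimately have "real n powr (1 - 1 / l) * p powr (1 - 1 / l - (2 * real l - 2)) = B / 2"
            by (simp only: B_def) simp
          then show ?thesis using B by linarith
        qed
        have "B powr (- 1 / (2 * real l - 1)) \<le> (real n powr (1 - 1 / l) * p powr (1 - 1 / l - (2 * real l - 2))) powr (- 1 / (2 * real l - 1))"
          using B' l n p by (intro powr_mono2') auto
        also have "\<dots> = real n powr ((1 - 1 / l) * (- 1 / (2 * real l - 1))) * p powr ((1 - 1 / l - (2 * real l - 2)) * (- 1 / (2 * real l - 1)))"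
          using n p by (simp only: powr_mult powr_powr)
        also have "(1 - 1 / l) * (- 1 / (2 * real l - 1)) = - gap_exponent l"
          using l by (simp add: gap_exponent_def field_simps)
        also have "(1 - 1 / l - (2 * real l - 2)) * (- 1 / (2 * real l - 1)) = 1 - 1 / l"
          using l by (simp add: field_simps)
        finally have "B powr (- 1 / (2 * real l - 1)) * N \<le> (real n powr (- gap_exponent l) * p powr (1 - 1 / l)) * N"
          by (intro mult_right_mono) (auto simp: N_def)
        also have "\<dots> = real n powr (- gap_exponent l) * (k * p powr (1 - 1 / l)) * real n powr al" by (simp add: kN)
        also have "\<dots> \<le> real n powr (- gap_exponent l) * (2 * a) * real n powr al"
          using phi by (intro mult_right_mono mult_left_mono) (auto simp: p_def)
        finally show ?thesis by (simp add: mult_ac)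
      qed
      define X where "X = k powr (- 1 / (real l - 1)) * real n powr al"
      define Y where "Y = real n powr (- gap_exponent l) * real n powr al"
      have XY: "X \<ge> 0" "Y \<ge> 0" by (auto simp: X_def Y_def)
      have aq: "a powr q \<ge> 0" by simp
      have "K * t * N = K * (p * N + B powr (- 1 / (2 * real l - 1)) * N)" by (simp add: t_def algebra_simps)
      also have "\<dots> \<le> K * (2 * a powr q * X + 2 * a * Y)"
        using 1 2 K by (intro mult_left_mono add_mono) (auto simp: X_def Y_def)
      also have "\<dots> \<le> K * ((2 * a powr q + 2 * a) * (X + Y))"
        using K XY a by (intro mult_left_mono) (auto simp: algebra_simps)
      also have "\<dots> = C * fingerprint_size l n k"
        by (simp add: C_def fingerprint_size_def X_def Y_def al_def algebra_simps)
      finally show ?thesis .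
    qed
    obtain ct where ct: "\<forall>I\<subseteq>G. (\<forall>e. w e > 0 \<longrightarrow> \<not> e \<subseteq> I) \<longrightarrow>
      (\<exists>Ss. container_for G (2 * l - 1) (K * t * real (card G)) ((1 - \<epsilon>) * real (card G)) I Ss (ct Ss))"
      using cont[THEN spec, THEN spec, THEN spec, THEN spec, THEN mp, THEN mp, THEN mp, THEN mp, THEN mp,
          OF finG B t(1) bw dens] by blast
    have "\<exists>Ss. container_for G (2 * l - 1) (C * fingerprint_size l n k) ((1 - min \<epsilon> (1 / 2)) * real (card G)) I Ss (ct Ss)"
      if I: "I \<subseteq> G" "\<not> contains_copy I (cycle_graph (2 * l))" for I
    proof -
      have "\<not> e \<subseteq> I" if "w e > 0" for e
      proof
        assume "e \<subseteq> I"
        have "e \<in> cycle_copies G (2 * l)" using that H by (auto simp: w_def split: if_splits)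
        from cycle_copy_contains[OF this \<open>e \<subseteq> I\<close> l3] I show False by simp
      qed
      then obtain Ss where Ss: "container_for G (2 * l - 1) (K * t * real (card G)) ((1 - \<epsilon>) * real (card G)) I Ss (ct Ss)"
        using ct I by blast
      have "(1 - \<epsilon>) * real (card G) \<le> (1 - min \<epsilon> (1 / 2)) * real (card G)" by (intro mult_right_mono) auto
      then have "container_for G (2 * l - 1) (C * fingerprint_size l n k) ((1 - min \<epsilon> (1 / 2)) * real (card G)) I Ss (ct Ss)"
        using Ss size unfolding container_for_def N_def by (meson order_trans)
      then show ?thesis by blast
    qed
    then show ?thesis unfolding k_def N_def n_def al_def by blast
  qed
  have "C > 0" using K a by (simp add: C_def add_nonneg_pos)
  moreover have "min \<epsilon> (1 / 2) > 0" "min \<epsilon> (1 / 2) < 1" using \<epsilon> by auto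
  moreover have "a \<ge> 1" using a by simp
  ultimately show ?thesis using main by blast
qed

section \<open>Iterating containers\<close>

lemma finite_card_lists_with_profile:
  assumes fin: "finite G"
  shows "finite {Ss. set Ss \<subseteq> Pow G \<and> map card Ss = ss} \<and>
    card {Ss. set Ss \<subseteq> Pow G \<and> map card Ss = ss} \<le> (\<Prod>j<length ss. card G choose (ss ! j))"
proof (induction ss)
  case Nil
  have "{Ss. set Ss \<subseteq> Pow G \<and> map card Ss = []} = {[]}" by auto
  then show ?case by simp
next
  case (Cons s ss)
  let ?L = "\<lambda>ss. {Ss. set Ss \<subseteq> Pow G \<and> map card Ss = ss}"
  have eq: "?L (s # ss) \<subseteq> (\<lambda>(S, Ss). S # Ss) ` (nsets G s \<times> ?L ss)"
  proof
    fix Ss assume Ss: "Ss \<in> ?L (s # ss)"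
    then obtain S Ts where "Ss = S # Ts" by (cases Ss) auto
    then have "S \<in> nsets G s" "Ts \<in> ?L ss" using Ss fin finite_subset[of S G] by (auto simp: nsets_def)
    then show "Ss \<in> (\<lambda>(S, Ss). S # Ss) ` (nsets G s \<times> ?L ss)" using \<open>Ss = S # Ts\<close> by force
  qed
  have finP: "finite (nsets G s \<times> ?L ss)" using Cons.IH finite_imp_finite_nsets[OF fin] by blast
  have "card (?L (s # ss)) \<le> card (nsets G s \<times> ?L ss)"
    using card_mono[OF finite_imageI[OF finP] eq] card_image_le[OF finP, of "\<lambda>(S, Ss). S # Ss"] by linarith
  also have "\<dots> = (card G choose s) * card (?L ss)" by (simp add: card_cartesian_product)
  also have "\<dots> \<le> (card G choose s) * (\<Prod>j<length ss. card G choose (ss ! j))" using Cons.IH by (intro mult_le_mono2) blast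
  also have "\<dots> = (\<Prod>j<length (s # ss). card G choose ((s # ss) ! j))"
  proof -
    have "length (s # ss) = Suc (length ss)" by simp
    then show ?thesis by (simp only: prod.lessThan_Suc_shift nth_Cons_0 nth_Cons_Suc)
  qed
  finally have "card (?L (s # ss)) \<le> (\<Prod>j<length (s # ss). card G choose ((s # ss) ! j))" .
  moreover have "finite (?L (s # ss))" by (rule finite_subset[OF eq finite_imageI[OF finP]])
  ultimately show ?case by blast
qed

lemma prod_lessThan_add:
  fixes f :: "nat \<Rightarrow> 'b :: comm_monoid_mult"
  shows "(\<Prod>j<a + b. f j) = (\<Prod>j<a. f j) * (\<Prod>j<b. f (a + j))"
  by (induction b) (simp_all add: mult.assoc)

text \<open>Several rounds in one flat list: entry j is one of the q fingerprints of level i + j div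
  q.\<close>

definition fingerprint_chain :: "nat \<Rightarrow> (nat \<Rightarrow> real) \<Rightarrow> nat \<Rightarrow> nat \<Rightarrow> 'a set \<Rightarrow> 'a set list \<Rightarrow> bool" where
  "fingerprint_chain q a i m I Ss \<longleftrightarrow> length Ss = q * m \<and> sorted_wrt (\<lambda>S T. S \<inter> T = {}) Ss \<and>
     (\<forall>S\<in>set Ss. S \<subseteq> I) \<and> (\<forall>j<q * m. real (card (Ss ! j)) \<le> a (i + j div q))"

lemma fingerprint_chain_append:
  assumes q: "q > 0" and Ss: "container_for G q (a i) u I Ss C" and Rs: "fingerprint_chain q a (Suc i) m (I - \<Union>(set Ss)) Rs"
  shows "fingerprint_chain q a i (Suc m) I (Ss @ Rs)"
  unfolding fingerprint_chain_def
proof (intro conjI allI impI)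
  have len: "length Ss = q" "length Rs = q * m" using Ss Rs by (auto simp: container_for_def fingerprint_chain_def)
  then show "length (Ss @ Rs) = q * Suc m" by simp
  show "sorted_wrt (\<lambda>S T. S \<inter> T = {}) (Ss @ Rs)"
    using Ss Rs by (fastforce simp: sorted_wrt_append container_for_def fingerprint_chain_def)
  show "\<forall>S\<in>set (Ss @ Rs). S \<subseteq> I"
    using Ss Rs by (fastforce simp: container_for_def fingerprint_chain_def)
  fix j assume j: "j < q * Suc m"
  show "real (card ((Ss @ Rs) ! j)) \<le> a (i + j div q)"
  proof (cases "j < q")
    case True
    then have "Ss ! j \<in> set Ss" using len by simp
    then have "real (card (Ss ! j)) \<le> a i" using Ss by (simp add: container_for_def)
    then show ?thesis using True len by (simp add: nth_append)
  next
    case False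
    have "j - q < q * m" using False j by simp
    then have "real (card (Rs ! (j - q))) \<le> a (Suc i + (j - q) div q)" using Rs by (simp add: fingerprint_chain_def)
    moreover have "Suc i + (j - q) div q = i + j div q" using False q by (simp add: div_if[of j q])
    ultimately have "real (card (Rs ! (j - q))) \<le> a (i + j div q)" by (simp only:)
    then show ?thesis using False len by (simp add: nth_append)
  qed
qed

text \<open>After a round, the part of I outside its fingerprints lies in the next container and is
  still in the family; continuing with this part keeps the fingerprints of all rounds disjoint. A
  fingerprint of level i is a subset of a container with at most U i elements, so lists with
  prescribed sizes are counted by a product of binomials. \<S> gathers lists independently of I, so
  the count holds for all I at once.\<close>

lemma iterate_containers:
  fixes U a :: "nat \<Rightarrow> real" and Om :: "'a set"
  assumes fin: "finite Om" and q: "q > 0"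
    and down: "\<And>I J. I \<in> \<I> \<Longrightarrow> J \<subseteq> I \<Longrightarrow> J \<in> \<I>"
    and step: "\<And>i G. i < L \<Longrightarrow> G \<subseteq> Om \<Longrightarrow> real (card G) \<le> U i \<Longrightarrow>
      \<exists>cont. \<forall>I\<in>\<I>. I \<subseteq> G \<longrightarrow> (\<exists>Ss. container_for G q (a i) (U (Suc i)) I Ss (cont Ss))"
    and G: "G \<subseteq> Om" "real (card G) \<le> U i" "i + m = L"
  shows "\<exists>h \<S>. (\<forall>I\<in>\<I>. I \<subseteq> G \<longrightarrow> (\<exists>Ss\<in>\<S>. fingerprint_chain q a i m I Ss \<and>
        I \<subseteq> \<Union>(set Ss) \<union> h Ss \<and> h Ss \<subseteq> G \<and> real (card (h Ss)) \<le> U L)) \<and>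
      (\<forall>Ss\<in>\<S>. length Ss = q * m) \<and>
      (\<forall>ss. finite {Ss\<in>\<S>. map card Ss = ss} \<and>
         card {Ss\<in>\<S>. map card Ss = ss} \<le> (\<Prod>j<q * m. nat \<lfloor>U (i + j div q)\<rfloor> choose (ss ! j)))"
  using G
proof (induction m arbitrary: i G)
  case 0
  have "finite {Ss \<in> {[] :: 'a set list}. map card Ss = ss} \<and> card {Ss \<in> {[] :: 'a set list}. map card Ss = ss} \<le> 1" for ss
    using card_mono[of "{[] :: 'a set list}" "{Ss \<in> {[]}. map card Ss = ss}"] by auto
  then show ?case using 0
    by (intro exI[of _ "\<lambda>_. G"] exI[of _ "{[]}"]) (simp add: fingerprint_chain_def)
next
  case (Suc m)
  have iL: "i < L" using Suc.prems by simp
  obtain cont where cont: "\<And>I. I \<in> \<I> \<Longrightarrow> I \<subseteq> G \<Longrightarrow> \<exists>Ss. container_for G q (a i) (U (Suc i)) I Ss (cont Ss)"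
    using step[OF iL Suc.prems(1,2)] by blast
  have finG: "finite G" using Suc.prems fin finite_subset by auto
  define ok where "ok Ss \<longleftrightarrow> length Ss = q \<and> set Ss \<subseteq> Pow G \<and> cont Ss \<subseteq> G \<and> real (card (cont Ss)) \<le> U (Suc i)" for Ss
  let ?P = "\<lambda>Ss h \<S>. (\<forall>I\<in>\<I>. I \<subseteq> cont Ss \<longrightarrow> (\<exists>Rs\<in>\<S>. fingerprint_chain q a (Suc i) m I Rs \<and>
        I \<subseteq> \<Union>(set Rs) \<union> h Rs \<and> h Rs \<subseteq> cont Ss \<and> real (card (h Rs)) \<le> U L)) \<and>
      (\<forall>Rs\<in>\<S>. length Rs = q * m) \<and>
      (\<forall>ss. finite {Rs\<in>\<S>. map card Rs = ss} \<and>
         card {Rs\<in>\<S>. map card Rs = ss} \<le> (\<Prod>j<q * m. nat \<lfloor>U (Suc i + j div q)\<rfloor> choose (ss ! j)))"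
  have "\<forall>Ss. \<exists>h \<S>. ok Ss \<longrightarrow> ?P Ss h \<S>"
  proof
    fix Ss
    show "\<exists>h \<S>. ok Ss \<longrightarrow> ?P Ss h \<S>"
    proof (cases "ok Ss")
      case True
      then have "cont Ss \<subseteq> Om" "real (card (cont Ss)) \<le> U (Suc i)" "Suc i + m = L"
        using Suc.prems by (auto simp: ok_def)
      from Suc.IH[OF this] show ?thesis by blast
    qed blast
  qed
  then obtain h where "\<forall>Ss. \<exists>\<S>. ok Ss \<longrightarrow> ?P Ss (h Ss) \<S>" by (rule exE[OF choice])
  then obtain \<S> where hS': "\<forall>Ss. ok Ss \<longrightarrow> ?P Ss (h Ss) (\<S> Ss)" by (rule exE[OF choice])
  note hS = hS'[THEN spec, THEN mp]
  note hlen = hS[THEN conjunct2, THEN conjunct1, THEN bspec]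
  note hcount = hS[THEN conjunct2, THEN conjunct2, THEN spec]
  \<comment> \<open>Every level has exactly q entries, so the first level is
    \<open>take q Ts\<close> and the container can be replayed from the list.\<close>
  define h' where "h' Ts = h (take q Ts) (drop q Ts)" for Ts
  define \<S>' where "\<S>' = {Ss @ Rs | Ss Rs. ok Ss \<and> Rs \<in> \<S> Ss}"
  have A: "\<exists>Ts\<in>\<S>'. fingerprint_chain q a i (Suc m) I Ts \<and> I \<subseteq> \<Union>(set Ts) \<union> h' Ts \<and> h' Ts \<subseteq> G \<and> real (card (h' Ts)) \<le> U L"
    if I: "I \<in> \<I>" "I \<subseteq> G" for I
  proof -
    obtain Ss where Ss: "container_for G q (a i) (U (Suc i)) I Ss (cont Ss)" using cont[OF I] by blast
    then have okS: "ok Ss" and len: "length Ss = q" using I by (auto simp: ok_def container_for_def)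
    let ?I' = "I - \<Union>(set Ss)"
    have "?I' \<in> \<I>" using down[OF I(1)] by auto
    moreover have "?I' \<subseteq> cont Ss" using Ss by (auto simp: container_for_def)
    ultimately obtain Rs where Rs: "Rs \<in> \<S> Ss" "fingerprint_chain q a (Suc i) m ?I' Rs"
      "?I' \<subseteq> \<Union>(set Rs) \<union> h Ss Rs" "h Ss Rs \<subseteq> cont Ss" "real (card (h Ss Rs)) \<le> U L"
      using hS[OF okS] by blast
    have hh: "h' (Ss @ Rs) = h Ss Rs" using len by (simp add: h'_def)
    have "Ss @ Rs \<in> \<S>'" using okS Rs by (auto simp: \<S>'_def)
    moreover have "fingerprint_chain q a i (Suc m) I (Ss @ Rs)" by (rule fingerprint_chain_append[OF q Ss Rs(2)])
    moreover have "I \<subseteq> \<Union>(set (Ss @ Rs)) \<union> h' (Ss @ Rs)" using Rs(3) unfolding hh by auto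
    moreover have "h' (Ss @ Rs) \<subseteq> G" unfolding hh using Rs(4) okS by (auto simp: ok_def)
    moreover have "real (card (h' (Ss @ Rs))) \<le> U L" unfolding hh by (rule Rs(5))
    ultimately show ?thesis by blast
  qed
  have B: "length Ts = q * Suc m" if Ts: "Ts \<in> \<S>'" for Ts
  proof -
    obtain Ss Rs where SR: "Ts = Ss @ Rs" "ok Ss" "Rs \<in> \<S> Ss"
      using Ts by (auto simp: \<S>'_def)
    then show ?thesis using hlen[OF SR(2,3)] by (simp add: ok_def)
  qed
  have C: "finite {Ts\<in>\<S>'. map card Ts = ss} \<and>
    card {Ts\<in>\<S>'. map card Ts = ss} \<le> (\<Prod>j<q * Suc m. nat \<lfloor>U (i + j div q)\<rfloor> choose (ss ! j))" for ss
  proof (cases "length ss = q * Suc m")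
    case False
    have "length ss = q * Suc m" if "Ts \<in> \<S>'" "map card Ts = ss" for Ts
      using B[OF that(1)] that(2)[symmetric] by simp
    with False have emp: "{Ts\<in>\<S>'. map card Ts = ss} = {}" by blast
    show ?thesis unfolding emp by simp
  next
    case True
    let ?L = "{Ss\<in>{Ss. set Ss \<subseteq> Pow G \<and> map card Ss = take q ss}. ok Ss}"
    let ?R = "\<lambda>Ss. {Rs\<in>\<S> Ss. map card Rs = drop q ss}"
    note profile = finite_card_lists_with_profile[OF finG, of "take q ss"]
    have Lsub: "?L \<subseteq> {Ss. set Ss \<subseteq> Pow G \<and> map card Ss = take q ss}" by blast
    have finL: "finite ?L" by (rule finite_subset[OF Lsub profile[THEN conjunct1]])
    have finR: "finite (?R Ss)" if "Ss \<in> ?L" for Ss using hcount[of Ss, THEN conjunct1] that by blast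
    have sub: "{Ts\<in>\<S>'. map card Ts = ss} \<subseteq> (\<Union>Ss\<in>?L. (@) Ss ` ?R Ss)"
    proof
      fix Ts assume Ts: "Ts \<in> {Ts\<in>\<S>'. map card Ts = ss}"
      then have "Ts \<in> \<S>'" by simp
      then obtain Ss Rs where SR: "Ts = Ss @ Rs" "ok Ss" "Rs \<in> \<S> Ss"
        by (auto simp: \<S>'_def)
      have "length Ss = q" using SR by (simp add: ok_def)
      then have "map card Ss = take q ss" "map card Rs = drop q ss" using Ts SR by auto
      then show "Ts \<in> (\<Union>Ss\<in>?L. (@) Ss ` ?R Ss)" using SR by (auto simp: ok_def)
    qed
    have finU: "finite (\<Union>Ss\<in>?L. (@) Ss ` ?R Ss)" using finL finR by blast
    define Z where "Z = (\<Prod>j<q * m. nat \<lfloor>U (Suc i + j div q)\<rfloor> choose (drop q ss ! j))"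
    have "card {Ts\<in>\<S>'. map card Ts = ss} \<le> card (\<Union>Ss\<in>?L. (@) Ss ` ?R Ss)" by (rule card_mono[OF finU sub])
    also have "\<dots> \<le> (\<Sum>Ss\<in>?L. card ((@) Ss ` ?R Ss))" by (rule card_UN_le[OF finL])
    also have "\<dots> \<le> (\<Sum>Ss\<in>?L. Z)"
    proof (rule sum_mono)
      fix Ss assume Ss: "Ss \<in> ?L"
      have "card ((@) Ss ` ?R Ss) \<le> card (?R Ss)" by (rule card_image_le[OF finR[OF Ss]])
      also have "\<dots> \<le> Z" using hcount[of Ss, THEN conjunct2] Ss unfolding Z_def by blast
      finally show "card ((@) Ss ` ?R Ss) \<le> Z" .
    qed
    also have "\<dots> = card ?L * Z" by simp
    also have "card ?L \<le> card {Ss. set Ss \<subseteq> Pow G \<and> map card Ss = take q ss}"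
      by (rule card_mono[OF profile[THEN conjunct1] Lsub])
    also have "\<dots> \<le> (\<Prod>j<length (take q ss). card G choose (take q ss ! j))"
      by (rule profile[THEN conjunct2])
    also have "\<dots> = (\<Prod>j<q. card G choose (ss ! j))" using True by (intro prod.cong) auto
    also have "\<dots> \<le> (\<Prod>j<q. nat \<lfloor>U (i + j div q)\<rfloor> choose (ss ! j))"
    proof (intro prod_mono conjI)
      fix j assume "j \<in> {..<q}"
      then have "j div q = 0" by simp
      moreover have "card G \<le> nat \<lfloor>U i\<rfloor>" using Suc.prems(2) by (simp add: le_nat_floor)
      ultimately show "card G choose (ss ! j) \<le> nat \<lfloor>U (i + j div q)\<rfloor> choose (ss ! j)"
        by (simp add: binomial_right_mono)
    qed simp
    also have "(\<Prod>j<q. nat \<lfloor>U (i + j div q)\<rfloor> choose (ss ! j)) * Z = (\<Prod>j<q * Suc m. nat \<lfloor>U (i + j div q)\<rfloor> choose (ss ! j))"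
    proof -
      have "Z = (\<Prod>j<q * m. nat \<lfloor>U (i + (q + j) div q)\<rfloor> choose (ss ! (q + j)))"
        unfolding Z_def using True q by (intro prod.cong) auto
      moreover have "(\<Prod>j<q + q * m. nat \<lfloor>U (i + j div q)\<rfloor> choose (ss ! j)) =
        (\<Prod>j<q. nat \<lfloor>U (i + j div q)\<rfloor> choose (ss ! j)) * (\<Prod>j<q * m. nat \<lfloor>U (i + (q + j) div q)\<rfloor> choose (ss ! (q + j)))"
        by (rule prod_lessThan_add)
      ultimately show ?thesis by simp
    qed
    finally have "card {Ts\<in>\<S>'. map card Ts = ss} \<le> (\<Prod>j<q * Suc m. nat \<lfloor>U (i + j div q)\<rfloor> choose (ss ! j))"
      by (simp add: mult_le_mono1)
    moreover have "finite {Ts\<in>\<S>'. map card Ts = ss}" by (rule finite_subset[OF sub finU])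
    ultimately show ?thesis by blast
  qed
  show ?case by (intro exI[of _ h'] exI[of _ \<S>'] conjI) (use A B C in blast)+
qed

section \<open>Counting fingerprints\<close>

lemma choose_le_exp_power:
  assumes "0 < x"
  shows "real (N choose x) \<le> (exp 1 * real N / real x) ^ x"
proof -
  have "(\<Sum>n\<in>{x}. real x ^ n /\<^sub>R fact n) \<le> (\<Sum>n. real x ^ n /\<^sub>R fact n)"
    using exp_converges[of "real x"] by (intro sum_le_suminf) (auto simp: sums_iff)
  then have e: "real x ^ x / fact x \<le> exp (real x)"
    using exp_converges[of "real x"] by (simp add: sums_iff divide_inverse mult.commute)
  have "real ((N choose x) * fact x) \<le> real (N ^ x)" by (intro of_nat_mono binomial_fact_pow)
  then have "real (N choose x) \<le> real N ^ x / fact x" by (simp add: le_divide_eq)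
  also have "\<dots> = (real N ^ x / real x ^ x) * (real x ^ x / fact x)" using assms by simp
  also have "\<dots> \<le> (real N ^ x / real x ^ x) * exp (real x)" using e by (intro mult_left_mono) auto
  also have "exp (real x) = exp 1 ^ x" by (simp flip: exp_of_nat_mult)
  finally show ?thesis by (simp add: power_divide power_mult_distrib mult.commute)
qed

text \<open>The source of the exponent l in the count. A fingerprint too large for the
  \<open>eta\<close> term has x = O(K powr (- 1 / (l - 1)) * M), so K = O((M / x) ^ (l - 1)), and
  the base e K M / x of the binomial bound is O((M / x) ^ l).\<close>

lemma large_fingerprint_choose:
  fixes K M C1 C4 eta :: real
  assumes l: "l \<ge> 2" and pos: "M > 0" "C1 > 0" "K > 0" and x: "0 < x"
    and le: "real x \<le> C1 * (K powr (- 1 / (real l - 1)) + eta) * M" and large: "real x > 2 * C1 * eta * M"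
    and N: "real N \<le> K * M" and C4: "exp 1 \<le> C4" "2 * C1 \<le> C4"
  shows "real (N choose x) \<le> (C4 * M / real x) ^ (l * x)"
proof -
  define \<kappa> where "\<kappa> = K powr (- 1 / (real l - 1))"
  define y where "y = real x / (2 * C1 * M)"
  have l1: "real l - 1 > 0" using l by simp
  have y: "y > 0" using x pos by (simp add: y_def)
  have "2 * C1 * eta * M < C1 * (\<kappa> + eta) * M" using le large unfolding \<kappa>_def by linarith
  then have "C1 * M * eta < C1 * M * \<kappa>" by (simp add: algebra_simps)
  then have "eta < \<kappa>" using pos by simp
  then have "C1 * (\<kappa> + eta) * M \<le> C1 * (\<kappa> + \<kappa>) * M" using pos by (intro mult_left_mono mult_right_mono) auto
  then have "real x \<le> 2 * C1 * M * \<kappa>" using le unfolding \<kappa>_def by (simp add: algebra_simps)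
  then have y\<kappa>: "y \<le> \<kappa>" using pos by (simp add: y_def divide_le_eq mult_ac)
  have "- 1 / (real l - 1) * (- (real l - 1)) = 1" using l1 by (simp add: field_simps)
  then have "K = \<kappa> powr (- (real l - 1))" unfolding \<kappa>_def powr_powr using pos by simp
  also have "\<kappa> powr (- (real l - 1)) \<le> y powr (- (real l - 1))" using y y\<kappa> l1 by (intro powr_mono2') auto
  also have "\<dots> = (1 / y) ^ (l - 1)"
  proof -
    have "real l - 1 = real (l - 1)" using l by simp
    then have "y powr (real l - 1) = y ^ (l - 1)" using y by (simp only: powr_realpow)
    then show ?thesis by (simp only: powr_minus_divide power_one_over)
  qed
  also have "1 / y = 2 * C1 * M / real x" by (simp add: y_def)
  finally have K: "K \<le> (2 * C1 * M / real x) ^ (l - 1)" .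
  have C40: "C4 > 0" using C4 pos by linarith
  have "exp 1 * real N / real x \<le> exp 1 * (K * M) / real x"
    using N by (intro divide_right_mono mult_left_mono) auto
  also have "\<dots> = K * (exp 1 * M / real x)" by simp
  also have "\<dots> \<le> (C4 * M / real x) ^ (l - 1) * (C4 * M / real x)"
  proof (intro mult_mono)
    show "exp 1 * M / real x \<le> C4 * M / real x" using C4 pos by (intro divide_right_mono mult_right_mono) auto
    have "(2 * C1 * M / real x) ^ (l - 1) \<le> (C4 * M / real x) ^ (l - 1)"
      using C4 pos by (intro power_mono divide_right_mono mult_right_mono) auto
    then show "K \<le> (C4 * M / real x) ^ (l - 1)" using K by linarith
  qed (use pos C40 in auto)
  also have "\<dots> = (C4 * M / real x) ^ l" using l by (cases l) auto
  finally have "(exp 1 * real N / real x) ^ x \<le> ((C4 * M / real x) ^ l) ^ x" by (intro power_mono) auto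
  then show ?thesis using choose_le_exp_power[OF x, of N] by (simp add: power_mult)
qed

text \<open>The price for replacing a size x by the total s in the denominator. Because ln z <= 2
  sqrt z, it is governed by sqrt (s x), which still sums geometrically over the levels.\<close>

lemma power_ratio_le_exp_sqrt:
  assumes "0 < x" "x \<le> s"
  shows "(real s / real x) ^ (l * x) \<le> exp (2 * real l * sqrt (real s * real x))"
proof -
  define z where "z = real s / real x"
  have z: "z > 0" using assms by (simp add: z_def)
  have "ln (sqrt z) \<le> sqrt z" using ln_le_minus_one[of "sqrt z"] z by simp
  then have "ln z \<le> 2 * sqrt z" using z by (simp add: ln_sqrt)
  then have "real (l * x) * ln z \<le> real (l * x) * (2 * sqrt z)" by (intro mult_left_mono) auto
  also have "\<dots> = 2 * real l * (real x * sqrt z)" by simp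
  also have "real x * sqrt z = sqrt (real s * real x)"
  proof -
    have "real x * sqrt z = sqrt ((real x)\<^sup>2 * z)" by (simp add: real_sqrt_mult)
    also have "(real x)\<^sup>2 * z = real s * real x" using assms by (simp add: z_def power2_eq_square)
    finally show ?thesis .
  qed
  finally have "exp (real (l * x) * ln z) \<le> exp (2 * real l * sqrt (real s * real x))" by simp
  moreover have "z ^ (l * x) = exp (real (l * x) * ln z)" unfolding exp_of_nat_mult using z by simp
  ultimately show ?thesis by (simp add: z_def)
qed

lemma sum_div_group:
  fixes f :: "nat \<Rightarrow> real"
  assumes "q > 0"
  shows "(\<Sum>j<q * L. f (j div q)) = real q * (\<Sum>i<L. f i)"
proof -
  have "(\<Sum>j<q * L. f (j div q)) = (\<Sum>i<L. \<Sum>j\<in>{i * q..<i * q + q}. f (j div q))"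
    using sum.nat_group[of "\<lambda>j. f (j div q)" q L] by (simp add: mult.commute)
  also have "\<dots> = (\<Sum>i<L. \<Sum>j\<in>{i * q..<i * q + q}. f i)"
  proof (intro sum.cong refl)
    fix i j assume "j \<in> {i * q..<i * q + q}"
    then have "j div q = i" by (intro div_nat_eqI) (auto simp: mult.commute)
    then show "f (j div q) = f i" by simp
  qed
  finally show ?thesis by (simp add: sum_distrib_left)
qed

lemma geometric_sum_le:
  assumes "0 < r" "r < (1::real)"
  shows "(\<Sum>i<L. r ^ (L - Suc i)) \<le> 1 / (1 - r)"
proof -
  have "(\<Sum>i<L. r ^ (L - Suc i)) = (\<Sum>i<L. r ^ i)" by (rule sum.nat_diff_reindex)
  also have "\<dots> = (1 - r ^ L) / (1 - r)" using assms by (simp add: sum_gp_strict)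
  also have "\<dots> \<le> 1 / (1 - r)" using assms by (intro divide_right_mono) auto
  finally show ?thesis .
qed

text \<open>The last level still has density above k, so densities grow geometrically backwards from
  it and the fingerprint bounds decay in the same way. The factor (n^2 + 1) ^ (q * L) bounds the
  number of size profiles: the later sum over profiles is paid for here.\<close>

theorem fingerprint_profile_bounds:
  fixes l q :: nat and \<epsilon> C1 :: real
  assumes l: "l \<ge> 2" and q: "q > 0" and \<epsilon>: "0 < \<epsilon>" "\<epsilon> < 1" and C1: "C1 > 0"
  shows "\<exists>C>0. \<forall>(n::nat) (k::real) L (ss :: nat \<Rightarrow> nat). n \<ge> 3 \<longrightarrow> k \<ge> 1 \<longrightarrow>
    real n powr (- gap_exponent l) * (ln (real n))\<^sup>2 \<le> k powr (- 1 / (real l - 1)) \<longrightarrow>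
    (\<forall>i<L. k * real n powr (1 + 1 / real l) < (1 - \<epsilon>) ^ i * (real n)\<^sup>2) \<longrightarrow>
    (\<forall>j<q * L. real (ss j) \<le> C1 * fingerprint_size l (real n)
        ((1 - \<epsilon>) ^ (j div q) * (real n)\<^sup>2 / real n powr (1 + 1 / real l))) \<longrightarrow>
    real (\<Sum>j<q * L. ss j) \<le> C * k powr (- 1 / (real l - 1)) * real n powr (1 + 1 / real l) \<and>
    real ((n\<^sup>2 + 1) ^ (q * L)) * real (\<Prod>j<q * L. nat \<lfloor>(1 - \<epsilon>) ^ (j div q) * (real n)\<^sup>2\<rfloor> choose ss j)
      \<le> (C * real n powr (1 + 1 / real l) / real (\<Sum>j<q * L. ss j)) ^ (l * (\<Sum>j<q * L. ss j))
        * exp (C * k powr (- 1 / (real l - 1)) * real n powr (1 + 1 / real l))"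
proof -
  define b where "b = 1 - \<epsilon>"
  \<comment> \<open>Ratio by which the main term of the fingerprint bound changes between levels;
    its root \<rho>' serves the terms sqrt (s x).\<close>
  define \<rho> where "\<rho> = b powr (1 / (real l - 1))"
  define \<rho>' where "\<rho>' = sqrt \<rho>"
  \<comment> \<open>Bounds the number of levels by CL * ln n.\<close>
  define CL where "CL = 1 + 2 / ln (1 / b)"
  define C3 where "C3 = real q * C1 * (1 / (1 - \<rho>) + CL)"
  define C' where "C' = max (exp 1) (max (2 * C1) C3)"
  define D1 where "D1 = 2 * real l * sqrt (2 * C1 * C3)"
  define D2 where "D2 = 4 * C1"
  define E where "E = real q * (D1 / (1 - \<rho>') + D2 * CL)"
  define C where "C = C' + E + 3 * real q * CL"
  have l1: "real l - 1 > 0" using l by simp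
  have b: "0 < b" "b < 1" using \<epsilon> by (auto simp: b_def)
  have \<rho>: "0 < \<rho>" "\<rho> < 1" unfolding \<rho>_def using b l1 powr_less_mono2[of "1 / (real l - 1)" b 1] by auto
  have \<rho>': "0 < \<rho>'" "\<rho>' < 1" using \<rho> by (auto simp: \<rho>'_def)
  have lb: "ln (1 / b) > 0" using b by (simp add: ln_gt_zero)
  then have CL: "CL \<ge> 1" by (simp add: CL_def)
  have C3: "C3 > 0" using q C1 \<rho> CL unfolding C3_def by (intro mult_pos_pos add_pos_nonneg) auto
  have C': "exp 1 \<le> C'" "2 * C1 \<le> C'" "C3 \<le> C'" by (auto simp: C'_def)
  have C'0: "C' > 0" using C' C3 by linarith
  have D: "D1 \<ge> 0" "D2 \<ge> 0" using C1 C3 by (auto simp: D1_def D2_def)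
  have E0: "E \<ge> 0" using D \<rho>' CL by (simp add: E_def)
  have CC: "C' \<le> C" "E + 3 * real q * CL \<le> C" using E0 CL C'0 by (auto simp: C_def)
  have C0: "C > 0" using CC C'0 by linarith
  have main: "real (\<Sum>j<q * L. ss j) \<le> C * k powr (- 1 / (real l - 1)) * real n powr (1 + 1 / real l) \<and>
    real ((n\<^sup>2 + 1) ^ (q * L)) * real (\<Prod>j<q * L. nat \<lfloor>b ^ (j div q) * (real n)\<^sup>2\<rfloor> choose ss j)
      \<le> (C * real n powr (1 + 1 / real l) / real (\<Sum>j<q * L. ss j)) ^ (l * (\<Sum>j<q * L. ss j))
        * exp (C * k powr (- 1 / (real l - 1)) * real n powr (1 + 1 / real l))"
    if n: "n \<ge> 3" and k: "k \<ge> 1" and small: "real n powr (- gap_exponent l) * (ln (real n))\<^sup>2 \<le> k powr (- 1 / (real l - 1))"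
      and U: "\<forall>i<L. k * real n powr (1 + 1 / real l) < b ^ i * (real n)\<^sup>2"
      and ss: "\<forall>j<q * L. real (ss j) \<le> C1 * fingerprint_size l (real n) (b ^ (j div q) * (real n)\<^sup>2 / real n powr (1 + 1 / real l))"
    for n :: nat and k :: real and L and ss :: "nat \<Rightarrow> nat"
  proof -
    define M where "M = real n powr (1 + 1 / real l)"
    define \<delta> where "\<delta> = k powr (- 1 / (real l - 1))"
    define \<eta> where "\<eta> = real n powr (- gap_exponent l)"
    define \<mu> where "\<mu> = ln (real n)"
    define s where "s = (\<Sum>j<q * L. ss j)"
    define K where "K i = b ^ i * (real n)\<^sup>2 / M" for i :: nat
    define \<kappa> where "\<kappa> i = K i powr (- 1 / (real l - 1))" for i
    have nn: "real n > 0" using n by simp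
    have M: "M \<ge> 1" using n unfolding M_def by (intro ge_one_powr_ge_zero) auto
    have \<delta>: "0 < \<delta>" "\<delta> \<le> 1"
      using k l1 powr_mono[of "- 1 / (real l - 1)" 0 k] by (auto simp: \<delta>_def)
    have \<eta>: "\<eta> > 0" using nn by (simp add: \<eta>_def)
    have \<mu>: "\<mu> \<ge> 1"
    proof -
      have "exp 1 \<le> real n" using exp_le n by linarith
      then show ?thesis unfolding \<mu>_def using nn by (simp add: ln_ge_iff)
    qed
    have \<eta>\<delta>: "\<eta> * \<mu>\<^sup>2 \<le> \<delta>" using small by (simp add: \<eta>_def \<mu>_def \<delta>_def)
    have \<eta>\<delta>': "\<eta> \<le> \<delta> / \<mu>\<^sup>2" using \<eta>\<delta> \<mu> by (simp add: le_divide_eq)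
    have K0: "K i > 0" for i using b nn M by (simp add: K_def)
    have \<kappa>: "\<kappa> i \<le> \<delta> * \<rho> ^ (L - Suc i)" if i: "i < L" for i
    proof -
      let ?t = "L - Suc i"
      have "k * M < b ^ (L - 1) * (real n)\<^sup>2" using U i by (simp add: M_def)
      also have "b ^ (L - 1) = b ^ i * b ^ ?t" using i by (simp flip: power_add)
      finally have "k \<le> K i * b ^ ?t" using M by (simp add: K_def le_divide_eq mult_ac)
      then have "k / b ^ ?t \<le> K i" using b by (simp add: divide_le_eq)
      then have "\<kappa> i \<le> (k / b ^ ?t) powr (- 1 / (real l - 1))"
        unfolding \<kappa>_def using k b l1 by (intro powr_mono2') auto
      also have "\<dots> = \<delta> * (b ^ ?t) powr (1 / (real l - 1))"
      proof -
        have "(k / b ^ ?t) powr (- (1 / (real l - 1))) = k powr (- (1 / (real l - 1))) / (b ^ ?t) powr (- (1 / (real l - 1)))"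
          using k b by (subst powr_divide) auto
        then show ?thesis using powr_minus_divide[of "b ^ ?t" "1 / (real l - 1)"] by (simp add: \<delta>_def)
      qed
      also have "(b ^ ?t) powr (1 / (real l - 1)) = \<rho> ^ ?t"
        using b by (simp add: \<rho>_def powr_powr mult.commute flip: powr_realpow)
      finally show ?thesis .
    qed
    have L: "real L \<le> CL * \<mu>"
    proof (cases "L = 0")
      case False
      have "1 * 1 \<le> k * M" using k M by (intro mult_mono) auto
      then have "1 < b ^ (L - 1) * (real n)\<^sup>2" using U[rule_format, of "L - 1"] False by (simp add: M_def)
      then have "0 < ln (b ^ (L - 1) * (real n)\<^sup>2)" by (rule ln_gt_zero)
      also have "\<dots> = real (L - 1) * ln b + 2 * \<mu>" using b nn by (simp add: ln_mult ln_realpow \<mu>_def)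
      finally have "real (L - 1) * ln (1 / b) < 2 * \<mu>" using b by (simp add: ln_div)
      then have "real (L - 1) < 2 * \<mu> / ln (1 / b)" using lb by (simp add: pos_less_divide_eq)
      then have "real L \<le> 1 + 2 / ln (1 / b) * \<mu>" using False by simp
      also have "\<dots> \<le> CL * \<mu>" using \<mu> by (simp add: CL_def algebra_simps)
      finally show ?thesis .
    qed (use CL \<mu> in simp)
    have L2: "real L * (\<delta> / \<mu>) \<le> CL * \<delta>"
    proof -
      have "real L * (\<delta> / \<mu>) \<le> (CL * \<mu>) * (\<delta> / \<mu>)" using L \<delta> \<mu> by (intro mult_right_mono) auto
      then show ?thesis using \<mu> by simp
    qed
    have dv: "j div q < L" if "j < q * L" for j using that q by (simp add: less_mult_imp_div_less mult.commute)
    have ss': "real (ss j) \<le> C1 * (\<kappa> (j div q) + \<eta>) * M" if "j < q * L" for j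
      using ss that by (simp add: fingerprint_size_def \<kappa>_def K_def \<eta>_def M_def mult.assoc)
    have s3: "real s \<le> C3 * \<delta> * M"
    proof -
      have "real s \<le> (\<Sum>j<q * L. C1 * (\<kappa> (j div q) + \<eta>) * M)"
        unfolding s_def of_nat_sum using ss' by (intro sum_mono) auto
      also have "\<dots> = real q * (\<Sum>i<L. C1 * (\<kappa> i + \<eta>) * M)"
        using sum_div_group[OF q, of "\<lambda>i. C1 * (\<kappa> i + \<eta>) * M"] by simp
      also have "\<dots> = real q * (C1 * ((\<Sum>i<L. \<kappa> i) + real L * \<eta>) * M)"
        by (simp add: sum.distrib flip: sum_distrib_left sum_distrib_right)
      also have "\<dots> \<le> real q * (C1 * (\<delta> * (1 / (1 - \<rho>)) + CL * \<delta>) * M)"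
      proof (intro mult_left_mono mult_right_mono add_mono)
        have "(\<Sum>i<L. \<kappa> i) \<le> (\<Sum>i<L. \<delta> * \<rho> ^ (L - Suc i))" using \<kappa> by (intro sum_mono) auto
        also have "\<dots> = \<delta> * (\<Sum>i<L. \<rho> ^ (L - Suc i))" by (simp add: sum_distrib_left)
        also have "\<dots> \<le> \<delta> * (1 / (1 - \<rho>))" using \<delta> geometric_sum_le[OF \<rho>, of L] by (intro mult_left_mono) auto
        finally show "(\<Sum>i<L. \<kappa> i) \<le> \<delta> * (1 / (1 - \<rho>))" .
        have "\<mu> * 1 \<le> \<mu> * \<mu>" using \<mu> by (intro mult_left_mono) auto
        then have "\<delta> / \<mu>\<^sup>2 \<le> \<delta> / \<mu>" using \<mu> \<delta> by (intro divide_left_mono) (auto simp: power2_eq_square)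
        then have "\<eta> \<le> \<delta> / \<mu>" using \<eta>\<delta>' by linarith
        then have "real L * \<eta> \<le> real L * (\<delta> / \<mu>)" by (intro mult_left_mono) auto
        then show "real L * \<eta> \<le> CL * \<delta>" using L2 by linarith
      qed (use C1 M in auto)
      also have "\<dots> = C3 * \<delta> * M" by (simp add: C3_def algebra_simps)
      finally show ?thesis .
    qed
    have "C3 * \<delta> * M \<le> C * \<delta> * M" using C' CC \<delta> M by (intro mult_right_mono) auto
    with s3 have part1: "real s \<le> C * \<delta> * M" by linarith
    have sC': "real s \<le> C' * M"
    proof -
      have "C3 * \<delta> * M \<le> C' * 1 * M" using C' C3 \<delta> M by (intro mult_right_mono mult_mono) auto
      then show ?thesis using s3 by simp
    qed
    \<comment> \<open>Exponent charged to a fingerprint of level i. The first term pays for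
      exchanging x for s when x is large, the second for n^2 choices per edge when x <= 2 C1 \<eta>
      M; its divisor \<mu> makes it affordable on all O(\<mu>) levels.\<close>
    define e where "e i = D1 * \<delta> * M * \<rho>' ^ (L - Suc i) + D2 * \<delta> * M / \<mu>" for i
    have e0: "e i \<ge> 0" for i using D \<delta> M \<rho>' \<mu> by (simp add: e_def)
    have each: "real (nat \<lfloor>b ^ (j div q) * (real n)\<^sup>2\<rfloor> choose ss j) \<le> (C' * M / real s) ^ (l * ss j) * exp (e (j div q))"
      if j: "j < q * L" for j
    proof (cases "ss j = 0")
      \<comment> \<open>This includes s = 0, where division by zero makes the base 0 but its power
        with exponent 0 is 1.\<close>
      case True
      then show ?thesis using e0[of "j div q"] by simp
    next
      case False
      define x where "x = ss j"
      define i where "i = j div q"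
      have x0: "0 < x" using False by (simp add: x_def)
      have xs: "x \<le> s" unfolding x_def s_def using j by (intro member_le_sum) auto
      have s0: "0 < s" using x0 xs by linarith
      have i: "i < L" using dv[OF j] by (simp add: i_def)
      have xi: "real x \<le> C1 * (\<kappa> i + \<eta>) * M" using ss'[OF j] by (simp add: x_def i_def)
      define N where "N = nat \<lfloor>b ^ i * (real n)\<^sup>2\<rfloor>"
      have Nle: "real N \<le> b ^ i * (real n)\<^sup>2" using b by (simp add: N_def of_nat_floor)
      have NK: "real N \<le> K i * M" using Nle M by (simp add: K_def)
      have base1: "1 \<le> C' * M / real s" using sC' s0 by (simp add: le_divide_eq)
      have "real (N choose x) \<le> (C' * M / real s) ^ (l * x) * exp (e i)"
      proof (cases "real x \<le> 2 * C1 * \<eta> * M")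
        case True
        have bn: "b ^ i * (real n)\<^sup>2 \<le> 1 * (real n)\<^sup>2" using b by (intro mult_right_mono power_le_one) auto
        have "N choose x \<le> N ^ x"
        proof (cases "x \<le> N")
          case True
          then show ?thesis by (rule binomial_le_pow)
        qed (simp add: binomial_eq_0)
        then have "real (N choose x) \<le> real (N ^ x)" by (rule of_nat_mono)
        also have "\<dots> \<le> ((real n)\<^sup>2) ^ x"
          unfolding of_nat_power using order_trans[OF Nle bn, unfolded mult_1_left] by (rule power_mono) simp
        also have "\<dots> = exp (real x * (2 * \<mu>))"
          unfolding exp_of_nat_mult exp_double using nn by (simp add: \<mu>_def)
        also have "\<dots> \<le> exp (e i)"
        proof -
          have "real x * (2 * \<mu>) \<le> (2 * C1 * \<eta> * M) * (2 * \<mu>)" using True \<mu> by (intro mult_right_mono) auto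
          also have "\<dots> = 4 * C1 * M * (\<eta> * \<mu>)" by simp
          also have "\<dots> \<le> 4 * C1 * M * (\<delta> / \<mu>)"
            using \<eta>\<delta> \<mu> C1 M by (intro mult_left_mono) (auto simp: le_divide_eq power2_eq_square mult.assoc)
          also have "\<dots> = D2 * \<delta> * M / \<mu>" by (simp add: D2_def)
          also have "\<dots> \<le> e i" using D \<delta> M \<rho>' by (simp add: e_def)
          finally show ?thesis by simp
        qed
        also have "\<dots> \<le> (C' * M / real s) ^ (l * x) * exp (e i)"
          using one_le_power[OF base1, of "l * x"] by simp
        finally show ?thesis .
      next
        case False
        then have large: "real x > 2 * C1 * \<eta> * M" by simp
        have "real (N choose x) \<le> (C' * M / real x) ^ (l * x)"
          using large_fingerprint_choose[OF l _ C1 K0 x0 xi[unfolded \<kappa>_def] large NK C'(1,2)] M by simp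
        also have "C' * M / real x = (C' * M / real s) * (real s / real x)" using s0 by simp
        also have "\<dots> ^ (l * x) = (C' * M / real s) ^ (l * x) * (real s / real x) ^ (l * x)" by (rule power_mult_distrib)
        also have "\<dots> \<le> (C' * M / real s) ^ (l * x) * exp (e i)"
        proof (intro mult_left_mono)
          have "2 * C1 * \<eta> * M < C1 * (\<kappa> i + \<eta>) * M" using large xi by linarith
          then have "C1 * M * \<eta> < C1 * M * \<kappa> i" by (simp add: algebra_simps)
          then have "\<eta> < \<kappa> i" using C1 M by simp
          then have "C1 * (\<kappa> i + \<eta>) * M \<le> C1 * (2 * (\<delta> * \<rho> ^ (L - Suc i))) * M"
            using \<kappa>[OF i] C1 M by (intro mult_left_mono mult_right_mono) auto
          then have x2: "real x \<le> 2 * C1 * \<delta> * \<rho> ^ (L - Suc i) * M" using xi by (simp add: mult_ac)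
          have "real s * real x \<le> (C3 * \<delta> * M) * (2 * C1 * \<delta> * \<rho> ^ (L - Suc i) * M)"
            using s3 x2 C3 \<delta> M by (intro mult_mono) auto
          also have "\<dots> = (2 * C1 * C3) * \<rho> ^ (L - Suc i) * (\<delta> * M)\<^sup>2" by (simp add: power2_eq_square)
          finally have "sqrt (real s * real x) \<le> sqrt ((2 * C1 * C3) * \<rho> ^ (L - Suc i) * (\<delta> * M)\<^sup>2)"
            by (rule real_sqrt_le_mono)
          also have "\<dots> = sqrt (2 * C1 * C3) * \<rho>' ^ (L - Suc i) * (\<delta> * M)"
          proof -
            have "sqrt (u * v * y\<^sup>2) = sqrt u * sqrt v * y" if "y \<ge> 0" for u v y :: real
              using that by (simp add: real_sqrt_mult)
            moreover have "\<delta> * M \<ge> 0" using \<delta> M by simp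
            ultimately show ?thesis by (simp only: real_sqrt_power \<rho>'_def)
          qed
          finally have "2 * real l * sqrt (real s * real x) \<le> 2 * real l * (sqrt (2 * C1 * C3) * \<rho>' ^ (L - Suc i) * (\<delta> * M))"
            by (intro mult_left_mono) auto
          also have "\<dots> = D1 * \<delta> * M * \<rho>' ^ (L - Suc i)" by (simp add: D1_def mult_ac)
          also have "\<dots> \<le> e i" using D \<delta> M \<mu> by (simp add: e_def)
          finally show "(real s / real x) ^ (l * x) \<le> exp (e i)"
            using power_ratio_le_exp_sqrt[OF x0 xs, of l] by (meson exp_le_cancel_iff order_trans)
        qed (use base1 in simp)
        finally show ?thesis .
      qed
      then show ?thesis by (simp add: N_def x_def i_def)
    qed
    have "real (\<Prod>j<q * L. nat \<lfloor>b ^ (j div q) * (real n)\<^sup>2\<rfloor> choose ss j) \<le> (\<Prod>j<q * L. (C' * M / real s) ^ (l * ss j) * exp (e (j div q)))"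
      unfolding of_nat_prod using each by (intro prod_mono) auto
    also have "\<dots> = (C' * M / real s) ^ (l * s) * exp (\<Sum>j<q * L. e (j div q))"
      by (simp add: prod.distrib exp_sum power_sum s_def sum_distrib_left)
    also have "\<dots> \<le> (C' * M / real s) ^ (l * s) * exp (E * \<delta> * M)"
    proof (intro mult_left_mono)
      have "(\<Sum>j<q * L. e (j div q)) = real q * (\<Sum>i<L. e i)" by (rule sum_div_group[OF q])
      also have "(\<Sum>i<L. e i) = D1 * \<delta> * M * (\<Sum>i<L. \<rho>' ^ (L - Suc i)) + D2 * M * (real L * (\<delta> / \<mu>))"
        by (simp add: e_def sum.distrib sum_distrib_left)
      also have "real q * \<dots> \<le> real q * (D1 * \<delta> * M * (1 / (1 - \<rho>')) + D2 * M * (CL * \<delta>))"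
        using D \<delta> M L2 geometric_sum_le[OF \<rho>', of L] by (intro mult_left_mono add_mono) auto
      also have "\<dots> = E * \<delta> * M" by (simp add: E_def algebra_simps)
      finally show "exp (\<Sum>j<q * L. e (j div q)) \<le> exp (E * \<delta> * M)" by simp
    qed (use C'0 M in auto)
    finally have prod: "real (\<Prod>j<q * L. nat \<lfloor>b ^ (j div q) * (real n)\<^sup>2\<rfloor> choose ss j) \<le> (C' * M / real s) ^ (l * s) * exp (E * \<delta> * M)" .
    have poly: "real ((n\<^sup>2 + 1) ^ (q * L)) \<le> exp (3 * real q * CL * \<delta> * M)"
    proof -
      have "n\<^sup>2 + 1 \<le> n\<^sup>2 * 2" using n by simp
      also have "\<dots> \<le> n\<^sup>2 * n" using n by (intro mult_le_mono2) simp
      finally have "n\<^sup>2 + 1 \<le> n ^ 3" by (simp only: power3_eq_cube power2_eq_square)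
      then have "real ((n\<^sup>2 + 1) ^ (q * L)) \<le> real ((n ^ 3) ^ (q * L))" by (intro of_nat_mono power_mono) auto
      also have "\<dots> = real n ^ (3 * (q * L))" by (simp add: power_mult)
      also have "\<dots> = exp (real (3 * (q * L)) * \<mu>)" unfolding exp_of_nat_mult using nn by (simp add: \<mu>_def)
      also have "\<dots> \<le> exp (3 * real q * CL * \<delta> * M)"
      proof -
        have "real (3 * (q * L)) * \<mu> = 3 * real q * \<mu> * real L" by simp
        also have "\<dots> \<le> 3 * real q * \<mu> * (CL * \<mu>)" using L \<mu> by (intro mult_left_mono) auto
        also have "\<dots> = 3 * real q * CL * \<mu>\<^sup>2" by (simp add: power2_eq_square)
        \<comment> \<open>The exponents of n in \<eta> and M have a nonnegative sum, so \<eta> M >=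
          1, and \<eta> \<mu>^2 <= \<delta> gives \<mu>^2 <= \<delta> M.\<close>
        also have "\<dots> \<le> 3 * real q * CL * (\<delta> * M)"
        proof (intro mult_left_mono)
          have "gap_exponent l \<le> 1"
          proof -
            have "(real l - 1) * 1 \<le> real l * (2 * real l - 1)" using l by (intro mult_mono) auto
            then show ?thesis using l by (simp add: gap_exponent_def divide_le_eq)
          qed
          then have "0 \<le> - gap_exponent l + (1 + 1 / real l)" by (smt (verit) of_nat_0_le_iff zero_le_divide_1_iff)
          then have "1 \<le> real n powr (- gap_exponent l + (1 + 1 / real l))" using n by (intro ge_one_powr_ge_zero) auto
          then have "1 \<le> \<eta> * M" unfolding \<eta>_def M_def powr_add[symmetric] .
          then have "\<mu>\<^sup>2 * 1 \<le> \<mu>\<^sup>2 * (\<eta> * M)" by (intro mult_left_mono) auto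
          also have "\<dots> = (\<eta> * \<mu>\<^sup>2) * M" by simp
          also have "\<dots> \<le> \<delta> * M" using \<eta>\<delta> M by (intro mult_right_mono) auto
          finally show "\<mu>\<^sup>2 \<le> \<delta> * M" by simp
        qed (use CL in auto)
        finally show ?thesis by (simp add: mult.assoc)
      qed
      finally show ?thesis .
    qed
    have "real ((n\<^sup>2 + 1) ^ (q * L)) * real (\<Prod>j<q * L. nat \<lfloor>b ^ (j div q) * (real n)\<^sup>2\<rfloor> choose ss j)
      \<le> exp (3 * real q * CL * \<delta> * M) * ((C' * M / real s) ^ (l * s) * exp (E * \<delta> * M))"
      using poly prod by (intro mult_mono exp_ge_zero of_nat_0_le_iff)
    also have "\<dots> = (C' * M / real s) ^ (l * s) * exp ((E + 3 * real q * CL) * \<delta> * M)"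
      by (simp add: algebra_simps flip: exp_add)
    also have "\<dots> \<le> (C * M / real s) ^ (l * s) * exp (C * \<delta> * M)"
    proof (intro mult_mono)
      show "(C' * M / real s) ^ (l * s) \<le> (C * M / real s) ^ (l * s)"
        using CC C'0 M by (intro power_mono divide_right_mono mult_right_mono) auto
      have "(E + 3 * real q * CL) * \<delta> * M \<le> C * \<delta> * M" using CC \<delta> M by (intro mult_right_mono) auto
      then show "exp ((E + 3 * real q * CL) * \<delta> * M) \<le> exp (C * \<delta> * M)" by simp
    qed (use C0 M in auto)
    finally show ?thesis using part1 by (simp add: s_def M_def \<delta>_def)
  qed
  then show ?thesis using C0 unfolding b_def by blast
qed

section \<open>Coloured containers\<close>

lemma card_Union_disjoint_list:
  assumes "sorted_wrt (\<lambda>S T. S \<inter> T = {}) Ss" "\<And>S. S \<in> set Ss \<Longrightarrow> finite S"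
  shows "card (\<Union>(set Ss)) = (\<Sum>j<length Ss. card (Ss ! j))"
proof -
  have "card (\<Union>(set Ss)) = sum_list (map card Ss)"
    using assms
  proof (induction Ss)
    case (Cons S Ss)
    have "S \<inter> \<Union>(set Ss) = {}" using Cons.prems(1) by auto
    then have "card (S \<union> \<Union>(set Ss)) = card S + card (\<Union>(set Ss))"
      using Cons.prems(2) by (intro card_Un_disjoint) auto
    then show ?case using Cons by simp
  qed simp
  then show ?thesis by (simp add: sum_list_sum_nth lessThan_atLeast0)
qed

lemma disjoint_family_on_nth:
  assumes "sorted_wrt (\<lambda>S T. S \<inter> T = {}) Ss"
  shows "disjoint_family_on (\<lambda>i. Ss ! i) {..<length Ss}"
  unfolding disjoint_family_on_def
proof (intro ballI impI)
  fix i j assume "i \<in> {..<length Ss}" "j \<in> {..<length Ss}" "i \<noteq> j"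
  then show "Ss ! i \<inter> Ss ! j = {}"
    using sorted_wrt_nth_less[OF assms, of i j] sorted_wrt_nth_less[OF assms, of j i] by (cases "i < j") auto
qed

lemma card_UN_le_uniform:
  assumes "finite I" "\<And>i. i \<in> I \<Longrightarrow> real (card (A i)) \<le> B"
  shows "real (card (\<Union>i\<in>I. A i)) \<le> real (card I) * B"
proof -
  have "real (card (\<Union>i\<in>I. A i)) \<le> real (\<Sum>i\<in>I. card (A i))" by (intro of_nat_mono card_UN_le assms(1))
  also have "\<dots> = (\<Sum>i\<in>I. real (card (A i)))" by simp
  also have "\<dots> \<le> (\<Sum>i\<in>I. B)" using assms(2) by (rule sum_mono)
  finally show ?thesis by simp
qed

text \<open>The bound on k raised to the power 1 / (l - 1): the exponent of n becomes
  \<open>gap_exponent l\<close>, that of the logarithm becomes 2. One logarithm pays for the number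
  of levels, the other for the n^2 choices per edge of a small fingerprint.\<close>

lemma gap_condition:
  fixes l n :: nat and k :: real
  assumes l: "l \<ge> 2" and n: "n \<ge> 3" and k: "k \<ge> 1"
    and le: "k \<le> real n powr ((real l - 1)^2 / (real l * (2 * real l - 1))) / ln (real n) ^ (2 * l - 2)"
  shows "real n powr (- gap_exponent l) * (ln (real n))\<^sup>2 \<le> k powr (- 1 / (real l - 1))"
proof -
  define c where "c = 1 / (real l - 1)"
  have l1: "real l - 1 > 0" using l by simp
  have c: "c > 0" using l1 by (simp add: c_def)
  have ln: "ln (real n) > 0" using n by simp
  have pos: "real n powr (gap_exponent l) > 0" "k powr c > 0" using n k by auto
  have lp: "(ln (real n) ^ (2 * l - 2)) powr c = (ln (real n))\<^sup>2"
  proof -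
    have "(ln (real n) ^ (2 * l - 2)) powr c = ln (real n) powr (real (2 * l - 2) * c)"
      using ln by (simp add: powr_powr flip: powr_realpow)
    also have "real (2 * l - 2) * c = 2" using l l1 by (simp add: c_def of_nat_diff field_simps)
    finally show ?thesis using ln by (simp add: powr_numeral)
  qed
  have "k powr c \<le> (real n powr ((real l - 1)^2 / (real l * (2 * real l - 1))) / ln (real n) ^ (2 * l - 2)) powr c"
    using le k c by (intro powr_mono2) auto
  also have "\<dots> = (real n powr ((real l - 1)^2 / (real l * (2 * real l - 1)))) powr c / (ln (real n))\<^sup>2"
    using ln lp by (simp add: powr_divide)
  also have "(real n powr ((real l - 1)^2 / (real l * (2 * real l - 1)))) powr c = real n powr gap_exponent l"
  proof -
    have "(real l - 1)^2 / (real l * (2 * real l - 1)) * c = gap_exponent l"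
      using l1 by (simp add: gap_exponent_def c_def power2_eq_square)
    then show ?thesis by (simp add: powr_powr)
  qed
  finally have "k powr c * (ln (real n))\<^sup>2 \<le> real n powr gap_exponent l" using ln by (simp add: pos_le_divide_eq)
  then have "(ln (real n))\<^sup>2 / real n powr gap_exponent l \<le> 1 / k powr c"
    using pos by (simp add: field_simps)
  moreover have "real n powr (- gap_exponent l) = 1 / real n powr gap_exponent l" by (rule powr_minus_divide)
  moreover have "k powr (- 1 / (real l - 1)) = 1 / k powr c" using powr_minus_divide[of k c] by (simp add: c_def)
  ultimately show ?thesis by simp
qed

text \<open>A level knows only the bound u on its container. If G has at most (1 - \<epsilon>) u
  edges, G itself serves with empty fingerprints; otherwise its size is within a factor 1 -
  \<epsilon> of u, which costs a constant factor in the fingerprint bound.\<close>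

lemma level_container:
  fixes l n :: nat and C0 \<epsilon> k0 u :: real
  assumes l: "l \<ge> 2" and n: "n \<ge> 1" and \<epsilon>: "0 < \<epsilon>" "\<epsilon> < 1" and C0: "C0 > 0"
    and cont: "\<forall>G. G \<subseteq> nsets {1..n} 2 \<longrightarrow> k0 * real n powr (1 + 1 / real l) \<le> real (card G) \<longrightarrow>
      (\<exists>cont. \<forall>I\<subseteq>G. \<not> contains_copy I (cycle_graph (2 * l)) \<longrightarrow>
      (\<exists>Ss. container_for G (2 * l - 1) (C0 * fingerprint_size l n (real (card G) / real n powr (1 + 1 / real l)))
        ((1 - \<epsilon>) * real (card G)) I Ss (cont Ss)))"
    and G: "G \<subseteq> nsets {1..n} 2" "real (card G) \<le> u" and u: "u > 0" "k0 * real n powr (1 + 1 / real l) \<le> (1 - \<epsilon>) * u"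
  shows "\<exists>cont. \<forall>I\<in>free_graphs_on {1..n} (cycle_graph (2 * l)). I \<subseteq> G \<longrightarrow>
      (\<exists>Ss. container_for G (2 * l - 1)
        (C0 * (1 - \<epsilon>) powr (- 1 / (real l - 1)) * fingerprint_size l n (u / real n powr (1 + 1 / real l)))
        ((1 - \<epsilon>) * u) I Ss (cont Ss))"
proof -
  let ?M = "real n powr (1 + 1 / real l)"
  define b where "b = (1 - \<epsilon>) powr (- 1 / (real l - 1))"
  have M: "?M > 0" using n by simp
  have l1: "real l - 1 > 0" using l by simp
  have fs0: "fingerprint_size l n x \<ge> 0" for x by (simp add: fingerprint_size_def)
  have b1: "b \<ge> 1"
  proof -
    have "1 powr (- 1 / (real l - 1)) \<le> (1 - \<epsilon>) powr (- 1 / (real l - 1))" using \<epsilon> l1 by (intro powr_mono2') auto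
    then show ?thesis by (simp add: b_def)
  qed
  show ?thesis
  proof (cases "real (card G) \<le> (1 - \<epsilon>) * u")
    case True
    have "sorted_wrt (\<lambda>S T. S \<inter> T = {}) (replicate q ({} :: 'z set))" for q by (induction q) auto
    then have "container_for G (2 * l - 1) (C0 * b * fingerprint_size l n (u / ?M)) ((1 - \<epsilon>) * u) I (replicate (2 * l - 1) {}) G"
      if "I \<subseteq> G" for I
      using that True C0 b1 fs0[of "u / ?M"] by (auto simp: container_for_def)
    then show ?thesis unfolding b_def by (intro exI[of _ "\<lambda>_. G"]) blast
  next
    case False
    define x where "x = real (card G) / ?M"
    have big: "(1 - \<epsilon>) * u < real (card G)" using False by simp
    have "k0 * ?M \<le> real (card G)" using u big by linarith
    then obtain ct where ct: "\<forall>I\<subseteq>G. \<not> contains_copy I (cycle_graph (2 * l)) \<longrightarrow>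
      (\<exists>Ss. container_for G (2 * l - 1) (C0 * fingerprint_size l n x) ((1 - \<epsilon>) * real (card G)) I Ss (ct Ss))"
      using cont G unfolding x_def by blast
    have "fingerprint_size l n x \<le> b * fingerprint_size l n (u / ?M)"
    proof -
      have "x powr (- 1 / (real l - 1)) \<le> ((1 - \<epsilon>) * (u / ?M)) powr (- 1 / (real l - 1))"
      proof (rule powr_mono2')
        show "(1 - \<epsilon>) * (u / ?M) \<le> x" using big M by (simp add: x_def divide_right_mono)
      qed (use \<epsilon> u M l1 in auto)
      also have "\<dots> = b * (u / ?M) powr (- 1 / (real l - 1))" unfolding b_def using \<epsilon> u M by (subst powr_mult) auto
      finally have 1: "x powr (- 1 / (real l - 1)) \<le> b * (u / ?M) powr (- 1 / (real l - 1))" .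
      have "1 * real n powr (- gap_exponent l) \<le> b * real n powr (- gap_exponent l)" using b1 by (intro mult_right_mono) auto
      with 1 have "x powr (- 1 / (real l - 1)) + real n powr (- gap_exponent l) \<le> b * ((u / ?M) powr (- 1 / (real l - 1)) + real n powr (- gap_exponent l))"
        by (simp add: distrib_left)
      then have "(x powr (- 1 / (real l - 1)) + real n powr (- gap_exponent l)) * ?M \<le> b * ((u / ?M) powr (- 1 / (real l - 1)) + real n powr (- gap_exponent l)) * ?M"
        using M by (intro mult_right_mono) auto
      then show ?thesis by (simp add: fingerprint_size_def mult.assoc)
    qed
    then have size: "C0 * fingerprint_size l n x \<le> C0 * b * fingerprint_size l n (u / ?M)" using C0 by (simp add: mult.assoc)
    have card: "(1 - \<epsilon>) * real (card G) \<le> (1 - \<epsilon>) * u" using G \<epsilon> by (intro mult_left_mono) auto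
    have "\<exists>Ss. container_for G (2 * l - 1) (C0 * b * fingerprint_size l n (u / ?M)) ((1 - \<epsilon>) * u) I Ss (ct Ss)"
      if I: "I \<in> free_graphs_on {1..n} (cycle_graph (2 * l))" "I \<subseteq> G" for I
    proof -
      obtain Ss where Ss: "container_for G (2 * l - 1) (C0 * fingerprint_size l n x) ((1 - \<epsilon>) * real (card G)) I Ss (ct Ss)"
        using ct I by (auto simp: free_graphs_on_def)
      have "container_for G (2 * l - 1) (C0 * b * fingerprint_size l n (u / ?M)) ((1 - \<epsilon>) * u) I Ss (ct Ss)"
        using Ss size card unfolding container_for_def by (meson order_trans)
      then show ?thesis by blast
    qed
    then show ?thesis unfolding b_def by blast
  qed
qed

lemma free_graphs_on_subset:
  assumes "I \<in> free_graphs_on V H" "J \<subseteq> I"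
  shows "J \<in> free_graphs_on V H"
  using assms unfolding free_graphs_on_def graphs_on_def contains_copy_def by blast

theorem theorem6p1:
  fixes l :: nat
  assumes "l \<ge> 2"
  shows "\<exists>C::real. C > 0 \<and> (\<exists>N::nat. \<forall>n\<ge>N. \<forall>k\<ge>N.
    real k \<le> real n powr ((real l - 1)^2 / (real l * (2 * real l - 1)))
               / ln (real n) ^ (2 * l - 2) \<longrightarrow>
    (let \<I> = free_graphs_on {1..n} (cycle_graph (2 * l));
         \<G> = {G \<in> graphs_on {1..n}. real (card G) \<le> real k * real n powr (1 + 1 / real l)}
     in \<exists>\<S> \<subseteq> coloured_graphs_on {1..n}. \<exists>g \<in> \<I> \<rightarrow> \<S>. \<exists>h \<in> \<S> \<rightarrow> \<G>.
          (\<forall>S\<in>\<S>. real (card (underlying S))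
             \<le> C * real k powr (- 1 / (real l - 1)) * real n powr (1 + 1 / real l)) \<and>
          (\<forall>s::nat.
             finite {S \<in> \<S>. card (underlying S) = s} \<and>
             real (card {S \<in> \<S>. card (underlying S) = s})
               \<le> (C * real n powr (1 + 1 / real l) / real s) ^ (l * s)
                   * exp (C * real k powr (- 1 / (real l - 1)) * real n powr (1 + 1 / real l))) \<and>
          (\<forall>I\<in>\<I>. underlying (g I) \<subseteq> I \<and> I \<subseteq> underlying (g I) \<union> h (g I))))"
proof -
  obtain \<epsilon> C0 k0 where \<epsilon>: "0 < \<epsilon>" "\<epsilon> < 1" and C0: "C0 > 0" and k0: "k0 \<ge> 1" and cont:
    "\<forall>(V :: nat set) G. finite V \<longrightarrow> V \<noteq> {} \<longrightarrow> G \<subseteq> nsets V 2 \<longrightarrow>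
    k0 * real (card V) powr (1 + 1 / real l) \<le> real (card G) \<longrightarrow>
    (\<exists>cont. \<forall>I\<subseteq>G. \<not> contains_copy I (cycle_graph (2 * l)) \<longrightarrow>
      (\<exists>Ss. container_for G (2 * l - 1)
        (C0 * fingerprint_size l (card V) (real (card G) / real (card V) powr (1 + 1 / real l)))
        ((1 - \<epsilon>) * real (card G)) I Ss (cont Ss)))"
    using cycle_free_containers[OF assms] by (elim exE conjE)
  define C1 where "C1 = C0 * (1 - \<epsilon>) powr (- 1 / (real l - 1))"
  define q where "q = 2 * l - 1"
  have q: "q > 0" using assms by (simp add: q_def)
  have C1: "C1 > 0" using C0 \<epsilon> by (simp add: C1_def)
  obtain C where C: "C > 0" and profile:
    "\<forall>(n::nat) (k::real) L (ss :: nat \<Rightarrow> nat). n \<ge> 3 \<longrightarrow> k \<ge> 1 \<longrightarrow>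
    real n powr (- gap_exponent l) * (ln (real n))\<^sup>2 \<le> k powr (- 1 / (real l - 1)) \<longrightarrow>
    (\<forall>i<L. k * real n powr (1 + 1 / real l) < (1 - \<epsilon>) ^ i * (real n)\<^sup>2) \<longrightarrow>
    (\<forall>j<q * L. real (ss j) \<le> C1 * fingerprint_size l (real n)
        ((1 - \<epsilon>) ^ (j div q) * (real n)\<^sup>2 / real n powr (1 + 1 / real l))) \<longrightarrow>
    real (\<Sum>j<q * L. ss j) \<le> C * k powr (- 1 / (real l - 1)) * real n powr (1 + 1 / real l) \<and>
    real ((n\<^sup>2 + 1) ^ (q * L)) * real (\<Prod>j<q * L. nat \<lfloor>(1 - \<epsilon>) ^ (j div q) * (real n)\<^sup>2\<rfloor> choose ss j)
      \<le> (C * real n powr (1 + 1 / real l) / real (\<Sum>j<q * L. ss j)) ^ (l * (\<Sum>j<q * L. ss j))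
        * exp (C * k powr (- 1 / (real l - 1)) * real n powr (1 + 1 / real l))"
    using fingerprint_profile_bounds[OF assms q \<epsilon> C1] by (elim exE conjE)
  \<comment> \<open>The first entry gives ln n >= 1, the second k0 <= (1 - \<epsilon>) k, so that
    \<open>level_container\<close> applies wherever the bound exceeds k M.\<close>
  define N where "N = max 3 (nat \<lceil>k0 / (1 - \<epsilon>)\<rceil>)"
  have main: "\<exists>\<S> \<subseteq> coloured_graphs_on {1..n}. \<exists>g \<in> free_graphs_on {1..n} (cycle_graph (2 * l)) \<rightarrow> \<S>.
      \<exists>h \<in> \<S> \<rightarrow> {G \<in> graphs_on {1..n}. real (card G) \<le> real k * real n powr (1 + 1 / real l)}.
          (\<forall>S\<in>\<S>. real (card (underlying S))
             \<le> C * real k powr (- 1 / (real l - 1)) * real n powr (1 + 1 / real l)) \<and>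
          (\<forall>s::nat.
             finite {S \<in> \<S>. card (underlying S) = s} \<and>
             real (card {S \<in> \<S>. card (underlying S) = s})
               \<le> (C * real n powr (1 + 1 / real l) / real s) ^ (l * s)
                   * exp (C * real k powr (- 1 / (real l - 1)) * real n powr (1 + 1 / real l))) \<and>
          (\<forall>I\<in>free_graphs_on {1..n} (cycle_graph (2 * l)). underlying (g I) \<subseteq> I \<and> I \<subseteq> underlying (g I) \<union> h (g I))"
    if nN: "n \<ge> N" and kN: "k \<ge> N" and
      hyp: "real k \<le> real n powr ((real l - 1)^2 / (real l * (2 * real l - 1))) / ln (real n) ^ (2 * l - 2)" for n k :: nat
  proof -
    let ?Om = "nsets {1..n} 2" and ?\<I> = "free_graphs_on {1..n} (cycle_graph (2 * l))"
    define M where "M = real n powr (1 + 1 / real l)"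
    define U where "U i = (1 - \<epsilon>) ^ i * (real n)\<^sup>2" for i
    define a where "a i = C1 * fingerprint_size l (real n) (U i / M)" for i
    have n: "n \<ge> 3" and k: "real k \<ge> 1" using nN kN by (auto simp: N_def)
    have kk0: "k0 \<le> (1 - \<epsilon>) * real k"
    proof -
      have "k0 / (1 - \<epsilon>) \<le> real (nat \<lceil>k0 / (1 - \<epsilon>)\<rceil>)" by linarith
      also have "\<dots> \<le> real k" using kN by (simp add: N_def)
      finally show ?thesis using \<epsilon> by (simp add: divide_le_eq mult.commute)
    qed
    have M: "M > 0" using n by (simp add: M_def)
    have gap: "real n powr (- gap_exponent l) * (ln (real n))\<^sup>2 \<le> real k powr (- 1 / (real l - 1))"
      by (rule gap_condition[OF assms n k hyp])
    \<comment> \<open>Leastness matters: all earlier levels exceed k M, which gives both the density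
      for each step and the geometric decay of the fingerprint bounds.\<close>
    define L where "L = (LEAST i. U i \<le> real k * M)"
    have "0 < real k * M / (real n)\<^sup>2" using k M n by simp
    then obtain i0 where "(1 - \<epsilon>) ^ i0 < real k * M / (real n)\<^sup>2"
      using real_arch_pow_inv[of "real k * M / (real n)\<^sup>2" "1 - \<epsilon>"] \<epsilon> by auto
    then have "U i0 \<le> real k * M" using n by (simp add: U_def less_divide_eq)
    then have UL: "U L \<le> real k * M" unfolding L_def by (rule LeastI)
    have below: "real k * M < U i" if "i < L" for i
      using not_less_Least[of i "\<lambda>i. U i \<le> real k * M"] that unfolding L_def by simp
    have finOm: "finite ?Om" by (intro finite_imp_finite_nsets) simp
    have cardOm: "card ?Om \<le> n\<^sup>2"
    proof -
      have "card ?Om = n choose 2" by simp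
      also have "\<dots> \<le> n * (n - 1)" by (simp add: choose_two)
      also have "\<dots> \<le> n\<^sup>2" by (simp add: power2_eq_square)
      finally show ?thesis .
    qed
    have \<I>Om: "I \<subseteq> ?Om" if "I \<in> ?\<I>" for I using that by (simp add: free_graphs_on_def graphs_on_def)
    have cont': "\<forall>G. G \<subseteq> ?Om \<longrightarrow> k0 * real n powr (1 + 1 / real l) \<le> real (card G) \<longrightarrow>
      (\<exists>cont. \<forall>I\<subseteq>G. \<not> contains_copy I (cycle_graph (2 * l)) \<longrightarrow>
      (\<exists>Ss. container_for G (2 * l - 1) (C0 * fingerprint_size l n (real (card G) / real n powr (1 + 1 / real l)))
        ((1 - \<epsilon>) * real (card G)) I Ss (cont Ss)))"
      using cont[THEN spec, of "{1..n}"] n by simp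
    have step: "\<exists>cont. \<forall>I\<in>?\<I>. I \<subseteq> G \<longrightarrow> (\<exists>Ss. container_for G q (a i) (U (Suc i)) I Ss (cont Ss))"
      if i: "i < L" and G: "G \<subseteq> ?Om" "real (card G) \<le> U i" for i G
    proof -
      have n1: "n \<ge> 1" and U0: "U i > 0" using n \<epsilon> by (auto simp: U_def)
      have "k0 * M \<le> (1 - \<epsilon>) * real k * M" using kk0 M by (intro mult_right_mono) auto
      also have "\<dots> \<le> (1 - \<epsilon>) * U i" using below[OF i] \<epsilon> by (simp add: mult.assoc)
      finally have big: "k0 * real n powr (1 + 1 / real l) \<le> (1 - \<epsilon>) * U i" by (simp add: M_def)
      have "U (Suc i) = (1 - \<epsilon>) * U i" by (simp add: U_def)
      then show ?thesis
        using level_container[OF assms n1 \<epsilon> C0 cont' G U0 big] by (simp only: a_def C1_def q_def M_def)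
    qed
    have down: "J \<in> ?\<I>" if "I \<in> ?\<I>" "J \<subseteq> I" for I J by (rule free_graphs_on_subset[OF that])
    have card0: "real (card ?Om) \<le> U 0" using cardOm by (simp add: U_def flip: of_nat_power del: card_nsets)
    have "\<exists>h \<S>. (\<forall>I\<in>?\<I>. I \<subseteq> ?Om \<longrightarrow> (\<exists>Ss\<in>\<S>. fingerprint_chain q a 0 L I Ss \<and>
        I \<subseteq> \<Union>(set Ss) \<union> h Ss \<and> h Ss \<subseteq> ?Om \<and> real (card (h Ss)) \<le> U L)) \<and>
      (\<forall>Ss\<in>\<S>. length Ss = q * L) \<and>
      (\<forall>ss. finite {Ss\<in>\<S>. map card Ss = ss} \<and>
         card {Ss\<in>\<S>. map card Ss = ss} \<le> (\<Prod>j<q * L. nat \<lfloor>U (0 + j div q)\<rfloor> choose (ss ! j)))"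
    proof (rule iterate_containers[OF finOm q])
      show "J \<in> ?\<I>" if "I \<in> ?\<I>" "J \<subseteq> I" for I J by (rule down[OF that])
      show "\<exists>cont. \<forall>I\<in>?\<I>. I \<subseteq> G \<longrightarrow> (\<exists>Ss. container_for G q (a i) (U (Suc i)) I Ss (cont Ss))"
        if "i < L" "G \<subseteq> ?Om" "real (card G) \<le> U i" for i G by (rule step[OF that])
    qed (use card0 in auto)
    then obtain h \<S>0 where
      chain: "\<forall>I\<in>?\<I>. I \<subseteq> ?Om \<longrightarrow> (\<exists>Ss\<in>\<S>0. fingerprint_chain q a 0 L I Ss \<and>
        I \<subseteq> \<Union>(set Ss) \<union> h Ss \<and> h Ss \<subseteq> ?Om \<and> real (card (h Ss)) \<le> U L)" and
      count: "\<forall>ss. finite {Ss\<in>\<S>0. map card Ss = ss} \<and>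
         card {Ss\<in>\<S>0. map card Ss = ss} \<le> (\<Prod>j<q * L. nat \<lfloor>U (0 + j div q)\<rfloor> choose (ss ! j))"
      by (elim exE conjE) (rule that)
    have "\<forall>I\<in>?\<I>. \<exists>Ss. Ss \<in> \<S>0 \<and> fingerprint_chain q a 0 L I Ss \<and>
        I \<subseteq> \<Union>(set Ss) \<union> h Ss \<and> h Ss \<subseteq> ?Om \<and> real (card (h Ss)) \<le> U L"
    proof
      fix I assume I: "I \<in> ?\<I>"
      from chain[THEN bspec, OF I, THEN mp, OF \<I>Om[OF I]]
      show "\<exists>Ss. Ss \<in> \<S>0 \<and> fingerprint_chain q a 0 L I Ss \<and>
        I \<subseteq> \<Union>(set Ss) \<union> h Ss \<and> h Ss \<subseteq> ?Om \<and> real (card (h Ss)) \<le> U L" by (simp only: Bex_def)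
    qed
    then obtain g where "\<forall>I\<in>?\<I>. g I \<in> \<S>0 \<and> fingerprint_chain q a 0 L I (g I) \<and>
        I \<subseteq> \<Union>(set (g I)) \<union> h (g I) \<and> h (g I) \<subseteq> ?Om \<and> real (card (h (g I))) \<le> U L"
      by (rule exE[OF bchoice])
    note g = this[THEN bspec]
    \<comment> \<open>The image of g instead of all of \<S>0: each member comes from some I and so
      has disjoint classes and a small container, while the count for \<S>0 still bounds it.\<close>
    define \<S> where "\<S> = g ` ?\<I>"
    have Sprops: "S \<in> \<S>0 \<and> length S = q * L \<and> set S \<subseteq> Pow ?Om \<and> sorted_wrt (\<lambda>S T. S \<inter> T = {}) S \<and>
        (\<forall>j<q * L. real (card (S ! j)) \<le> a (j div q)) \<and> h S \<subseteq> ?Om \<and> real (card (h S)) \<le> real k * M"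
      if S: "S \<in> \<S>" for S
    proof -
      obtain I where I: "I \<in> ?\<I>" "S = g I" using S unfolding \<S>_def by (rule imageE)
      note gI = g[OF I(1)]
      have "set S \<subseteq> Pow ?Om" using gI \<I>Om[OF I(1)] unfolding I(2) fingerprint_chain_def by blast
      moreover have "real (card (h S)) \<le> real k * M" using gI UL unfolding I(2) by linarith
      ultimately show ?thesis using gI unfolding I(2) fingerprint_chain_def by simp
    qed
    have under: "card (underlying S) = (\<Sum>j<q * L. card (S ! j))" if S: "S \<in> \<S>" for S
    proof -
      have SO: "set S \<subseteq> Pow ?Om" and dis: "sorted_wrt (\<lambda>S T. S \<inter> T = {}) S" and len: "length S = q * L"
        using Sprops[OF S] by simp_all
      have "finite T" if "T \<in> set S" for T using subsetD[OF SO that] finite_subset[OF _ finOm] by simp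
      from card_Union_disjoint_list[OF dis this] show ?thesis by (simp add: underlying_def len)
    qed
    have bounds: "real (\<Sum>j<q * L. ss j) \<le> C * real k powr (- 1 / (real l - 1)) * M \<and>
      real ((n\<^sup>2 + 1) ^ (q * L)) * real (\<Prod>j<q * L. nat \<lfloor>U (j div q)\<rfloor> choose ss j)
      \<le> (C * M / real (\<Sum>j<q * L. ss j)) ^ (l * (\<Sum>j<q * L. ss j)) * exp (C * real k powr (- 1 / (real l - 1)) * M)"
      if "\<forall>j<q * L. real (ss j) \<le> a (j div q)" for ss :: "nat \<Rightarrow> nat"
      using profile[THEN spec, THEN spec, THEN spec, THEN spec, THEN mp, THEN mp, THEN mp, THEN mp, THEN mp,
          OF n k gap, of L ss] below that
      unfolding a_def U_def M_def by blast
    show ?thesis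
      unfolding M_def[symmetric]
    proof (intro bexI[of _ h] bexI[of _ g] exI[of _ \<S>] conjI ballI allI)
      show "\<S> \<subseteq> coloured_graphs_on {1..n}"
      proof
        fix S assume S: "S \<in> \<S>"
        have "underlying S \<subseteq> ?Om" using Sprops[OF S] by (auto simp: underlying_def)
        then show "S \<in> coloured_graphs_on {1..n}"
          using disjoint_family_on_nth[of S] Sprops[OF S] by (simp add: coloured_graphs_on_def graphs_on_def)
      qed
      show "g \<in> ?\<I> \<rightarrow> \<S>" by (auto simp: \<S>_def)
      show "h \<in> \<S> \<rightarrow> {G \<in> graphs_on {1..n}. real (card G) \<le> real k * M}"
        using Sprops by (auto simp: graphs_on_def)
    next
      fix S assume S: "S \<in> \<S>"
      show "real (card (underlying S)) \<le> C * real k powr (- 1 / (real l - 1)) * M"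
        unfolding under[OF S] using bounds[of "\<lambda>j. card (S ! j)"] Sprops[OF S] by blast
    next
      fix s :: nat
      let ?A = "{S \<in> \<S>. card (underlying S) = s}"
      let ?X = "(C * M / real s) ^ (l * s) * exp (C * real k powr (- 1 / (real l - 1)) * M)"
      \<comment> \<open>The size profiles of total s. Entries are at most n^2, the number of edges
        available, so the number of profiles is at most the factor built into
        \<open>fingerprint_profile_bounds\<close>.\<close>
      define Prof where "Prof = {ss. set ss \<subseteq> {..n\<^sup>2} \<and> length ss = q * L \<and>
        (\<forall>j<q * L. real (ss ! j) \<le> a (j div q)) \<and> (\<Sum>j<q * L. ss ! j) = s}"
      let ?lists = "{ss :: nat list. set ss \<subseteq> {..n\<^sup>2} \<and> length ss = q * L}"
      have finlists: "finite ?lists" by (rule finite_lists_length_eq) simp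
      have Psub: "Prof \<subseteq> ?lists" by (auto simp: Prof_def)
      have finP: "finite Prof" by (rule finite_subset[OF Psub finlists])
      have "card Prof \<le> (n\<^sup>2 + 1) ^ (q * L)"
        using card_mono[OF finlists Psub] card_lists_length_eq[of "{..n\<^sup>2}" "q * L"] by simp
      then have cardP: "real (card Prof) \<le> real ((n\<^sup>2 + 1) ^ (q * L))" by (rule of_nat_mono)
      have sub: "?A \<subseteq> (\<Union>ss\<in>Prof. {Ss\<in>\<S>0. map card Ss = ss})"
      proof
        fix S assume "S \<in> ?A"
        then have S: "S \<in> \<S>" and s: "card (underlying S) = s" by auto
        have "card T \<le> n\<^sup>2" if "T \<in> set S" for T
        proof -
          have "T \<subseteq> ?Om" using Sprops[OF S] that by blast
          then show ?thesis using card_mono[OF finOm] cardOm le_trans by blast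
        qed
        then have "map card S \<in> Prof" using Sprops[OF S] s under[OF S] by (auto simp: Prof_def)
        moreover have "S \<in> \<S>0" using Sprops[OF S] by (rule conjunct1)
        ultimately show "S \<in> (\<Union>ss\<in>Prof. {Ss\<in>\<S>0. map card Ss = ss})" by (intro UN_I[of "map card S"]) simp_all
      qed
      have finU: "finite (\<Union>ss\<in>Prof. {Ss\<in>\<S>0. map card Ss = ss})"
        by (intro finite_UN_I finP count[THEN spec, THEN conjunct1])
      show "finite ?A" by (rule finite_subset[OF sub finU])
      have pos: "real ((n\<^sup>2 + 1) ^ (q * L)) > 0" unfolding of_nat_0_less_iff by simp
      have each: "real (card {Ss\<in>\<S>0. map card Ss = ss}) \<le> ?X / real ((n\<^sup>2 + 1) ^ (q * L))" if ss: "ss \<in> Prof" for ss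
      proof -
        have "real (card {Ss\<in>\<S>0. map card Ss = ss}) \<le> real (\<Prod>j<q * L. nat \<lfloor>U (j div q)\<rfloor> choose (ss ! j))"
          using count[THEN spec, of ss] by (simp only: add_0 of_nat_le_iff)
        moreover have "real ((n\<^sup>2 + 1) ^ (q * L)) * real (\<Prod>j<q * L. nat \<lfloor>U (j div q)\<rfloor> choose (ss ! j)) \<le> ?X"
        proof -
          have "\<forall>j<q * L. real (ss ! j) \<le> a (j div q)" "(\<Sum>j<q * L. ss ! j) = s" using ss by (auto simp: Prof_def)
          then show ?thesis using bounds[of "\<lambda>j. ss ! j"] by simp
        qed
        ultimately have "real ((n\<^sup>2 + 1) ^ (q * L)) * real (card {Ss\<in>\<S>0. map card Ss = ss}) \<le> ?X"
          using pos by (meson mult_left_mono less_imp_le order_trans)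
        then show ?thesis using pos by (simp add: le_divide_eq mult.commute)
      qed
      have X0: "?X \<ge> 0" using C M by simp
      have "real (card ?A) \<le> real (card (\<Union>ss\<in>Prof. {Ss\<in>\<S>0. map card Ss = ss}))"
        by (intro of_nat_mono card_mono finU sub)
      also have "\<dots> \<le> real (card Prof) * (?X / real ((n\<^sup>2 + 1) ^ (q * L)))"
        by (rule card_UN_le_uniform[OF finP each])
      also have "\<dots> \<le> real ((n\<^sup>2 + 1) ^ (q * L)) * (?X / real ((n\<^sup>2 + 1) ^ (q * L)))"
        using cardP X0 pos by (intro mult_right_mono) auto
      also have "\<dots> = ?X" using less_imp_neq[OF pos] by (metis nonzero_mult_div_cancel_left times_divide_eq_right)
      finally show "real (card ?A) \<le> ?X" .
    next
      fix I assume I: "I \<in> ?\<I>"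
      show "underlying (g I) \<subseteq> I" using g[OF I] unfolding underlying_def fingerprint_chain_def by blast
      show "I \<subseteq> underlying (g I) \<union> h (g I)" using g[OF I] unfolding underlying_def by blast
    qed
  qed
  show ?thesis
    unfolding Let_def by (intro exI[of _ C] conjI C exI[of _ N] allI impI) (rule main)
qed

end
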